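(* The function $\eta$ defined on permutations $\sigma\in S_n$ (for all $n$) by $$\eta(\sigma)\ :=\ e(P_\sigma)\,e(P_{\overline\sigma})\ -\ n!$$ (a nonnegative integer) is in the complexity class $\#\mathrm{P}$.
   Context: For $\sigma\in S_n$, the permutation poset $P_\sigma=([n],\prec)$ is defined by $i\prec j$ iff $i<j$ and $\sigma(i)<\sigma(j)$. For $\sigma=(\sigma(1),\dots,\sigma(n))$, $\overline\sigma:=(\sigma(n),\dots,\sigma(1))$. $e(P)$ is the number of linear extensions of a poset $P$ (bijections $f$ onto $[n]$ with $f(x)<f(y)$ whenever $x\prec y$). $\#\mathrm{P}$ is the class of functions that count the number of witnesses of a relation whose membership can be decided in polynomial time. *)

theory Defs
  imports
    "HOL-Combinatorics.Permutations"
    "HOL-Computational_Algebra.Polynomial"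
    "HOL-Library.FuncSet"
begin

section \<open>Linear extensions of permutation posets\<close>

text \<open>A finite poset is given by its ground set \<open>A\<close> and its strict order relation \<open>r\<close>.\<close>

definition linear_extensions :: "'a set \<Rightarrow> 'a rel \<Rightarrow> ('a \<Rightarrow> nat) set" where
  "linear_extensions A r =
     {f \<in> A \<rightarrow>\<^sub>E {1..card A}. bij_betw f A {1..card A} \<and> (\<forall>(x, y) \<in> r. f x < f y)}"

definition num_linear_extensions :: "'a set \<Rightarrow> 'a rel \<Rightarrow> nat" where
  "num_linear_extensions A r = card (linear_extensions A r)"

definition perm_order :: "nat \<Rightarrow> (nat \<Rightarrow> nat) \<Rightarrow> nat rel" where
  "perm_order n \<sigma> = {(i, j). i \<in> {1..n} \<and> j \<in> {1..n} \<and> i < j \<and> \<sigma> i < \<sigma> j}"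

definition reverse_perm :: "nat \<Rightarrow> (nat \<Rightarrow> nat) \<Rightarrow> nat \<Rightarrow> nat" where
  "reverse_perm n \<sigma> = (\<lambda>i. if i \<in> {1..n} then \<sigma> (n + 1 - i) else i)"

definition eta :: "nat \<Rightarrow> (nat \<Rightarrow> nat) \<Rightarrow> int" where
  "eta n \<sigma> =
     int (num_linear_extensions {1..n} (perm_order n \<sigma>)) *
     int (num_linear_extensions {1..n} (perm_order n (reverse_perm n \<sigma>))) - fact n"


section \<open>Deterministic multitape Turing machines\<close>

text \<open>
  States and tape symbols are initial segments of the natural numbers, so that one can
  quantify over machines. Symbol 0 is the blank, 1 and 2 stand for the input bits 0 and 1,
  and 3 separates the two components of an input pair; a machine may use further symbols.
  The tapes are infinite in both directions.
\<close>

datatype dir = Lft | Stay | Rgt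

type_synonym tape = "(int \<Rightarrow> nat) \<times> int"

type_synonym config = "nat \<times> tape list"

record tm =
  num_tapes :: nat
  num_states :: nat
  num_symbols :: nat
  start_state :: nat
  accept_state :: nat
  reject_state :: nat
  delta :: "nat \<Rightarrow> nat list \<Rightarrow> nat \<times> (nat \<times> dir) list"

definition wf_tm :: "tm \<Rightarrow> bool" where
  "wf_tm M \<longleftrightarrow>
     1 \<le> num_tapes M \<and> 4 \<le> num_symbols M \<and>
     start_state M < num_states M \<and> accept_state M < num_states M \<and>
     reject_state M < num_states M \<and> accept_state M \<noteq> reject_state M \<and>
     (\<forall>q ss q' acts. q < num_states M \<and> length ss = num_tapes M \<and>
        set ss \<subseteq> {..<num_symbols M} \<and> delta M q ss = (q', acts) \<longrightarrow>
        q' < num_states M \<and> length acts = num_tapes M \<and>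
        fst ` set acts \<subseteq> {..<num_symbols M})"

fun read_tape :: "tape \<Rightarrow> nat" where
  "read_tape (t, h) = t h"

fun offset :: "dir \<Rightarrow> int" where
  "offset Lft = - 1"
| "offset Stay = 0"
| "offset Rgt = 1"

fun act_tape :: "tape \<Rightarrow> nat \<times> dir \<Rightarrow> tape" where
  "act_tape (t, h) (s, d) = (t(h := s), h + offset d)"

fun step :: "tm \<Rightarrow> config \<Rightarrow> config" where
  "step M (q, ts) =
     (if q = accept_state M \<or> q = reject_state M then (q, ts)
      else (case delta M q (map read_tape ts) of
              (q', acts) \<Rightarrow> (q', map2 act_tape ts acts)))"

definition bit_symbol :: "bool \<Rightarrow> nat" where
  "bit_symbol b = (if b then 2 else 1)"

definition pair_word :: "bool list \<Rightarrow> bool list \<Rightarrow> nat list" where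
  "pair_word x y = map bit_symbol x @ [3] @ map bit_symbol y"

definition word_tape :: "nat list \<Rightarrow> tape" where
  "word_tape w = ((\<lambda>i. if 0 \<le> i \<and> i < int (length w) then w ! nat i else 0), 0)"

definition init_config :: "tm \<Rightarrow> nat list \<Rightarrow> config" where
  "init_config M w =
     (start_state M, word_tape w # replicate (num_tapes M - 1) (word_tape []))"


section \<open>The class \<open>#P\<close>\<close>

definition poly_time_decidable :: "(bool list \<Rightarrow> bool list \<Rightarrow> bool) \<Rightarrow> bool" where
  "poly_time_decidable R \<longleftrightarrow>
     (\<exists>M (p :: nat poly). wf_tm M \<and>
        (\<forall>x y. \<exists>t \<le> poly p (length (pair_word x y)).
           fst ((step M ^^ t) (init_config M (pair_word x y))) =
             (if R x y then accept_state M else reject_state M)))"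

text \<open>As usual, witnesses have length polynomially bounded in the length of the instance.\<close>

definition sharpP :: "(bool list \<Rightarrow> nat) set" where
  "sharpP =
     {f. \<exists>R (p :: nat poly). poly_time_decidable R \<and>
           (\<forall>x y. R x y \<longrightarrow> length y \<le> poly p (length x)) \<and>
           (\<forall>x. f x = card {y. R x y})}"

text \<open>
  A permutation in \<open>S\<^sub>n\<close> is written down in one-line notation, the entry \<open>k\<close> as \<open>k\<close> ones
  followed by a zero. As all entries are at most \<open>n\<close>, the code has length at most
  \<open>n (n + 1)\<close>, and it can be translated from and to the binary notation of the entries in
  polynomial time; so membership in \<open>#P\<close> does not depend on this choice.
\<close>

definition encode_perm :: "nat \<Rightarrow> (nat \<Rightarrow> nat) \<Rightarrow> bool list" where
  "encode_perm n \<sigma> = concat (map (\<lambda>i. replicate (\<sigma> i) True @ [False]) [1..<n + 1])"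

end

theory Submission
  imports Defs
begin

text \<open>
  Write \<open>P\<close> and \<open>Q\<close> for the orders of \<open>\<sigma>\<close> and of its reversal, carried over to one ground set
  \<open>A\<close>; any two elements are comparable in exactly one of them. Let a linear extension run through
  its greedy chain: start with the first element and pass to the next listed element above the
  current one. Sliding each chain element up to the place of its successor until \<open>x\<close> drops out is a
  bijection between the linear extensions of \<open>P\<close> whose chain contains \<open>x\<close> and the linear extensions
  of \<open>P - x\<close>. A chain of \<open>P\<close> and a chain of \<open>Q\<close> share at most one element, whence
  \<open>e(P) e(Q) = d(A) + (\<Sum>x\<in>A. e(P - x) e(Q - x))\<close>, where \<open>d(A)\<close> counts the pairs of linear extensions with
  disjoint chains. Unfolding this recursion, \<open>e(P) e(Q) - n!\<close> counts the triples of a sequence \<open>X\<close> of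
  distinct elements not exhausting \<open>A\<close> and a pair with disjoint chains on \<open>A - X\<close>.

  Such a triple, together with its two chains, is a tuple of binary relations on the positions
  of the input word, and validity is a first-order property with order, addition and
  multiplication. Quantifiers over positions become loops of a counter program, and a counter is
  a tape whose head position is the value of the counter.
\<close>

section \<open>Counter programs on Turing machines\<close>

text \<open>The obstacle is the subtraction: \<open>n!\<close> cannot simply be taken off a count,
  it has to disappear by leaving out objects. The product \<open>e(P) e(Q)\<close> and the factorial
  satisfy the same recursion over \<open>x \<in> A\<close>, apart from the term \<open>d(A)\<close>.
  Since \<open>d\<close> of the empty set is 1, the branches that unfold down to the empty set are
  the \<open>n!\<close> orderings of \<open>A\<close>, each worth exactly 1; dropping them leaves
  the difference, and \<open>n! \<le> e(P) e(Q)\<close> comes out on the way.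

  The second obstacle is that a greedy chain is produced by an iteration along the list, whereas the
  formulas only quantify over positions. This is why the chains belong to the witness: a local
  condition pins each of them down, so storing them adds nothing to the count.

  Quantifiers run over positions of \<open>x\<close> only, and bits of \<open>y\<close> are
  addressed by arithmetic on such positions. Thus only terms, connectives and one bounded quantifier
  have to be compiled to a machine.\<close>

definition sym :: "nat list \<Rightarrow> nat \<Rightarrow> nat" where
  "sym w p = (if p < length w then w ! p else 0)"

type_synonym regs = "nat \<Rightarrow> nat"

datatype cond = Pos nat | Reads nat

text \<open>
  Register 0 is the head position on the input tape. It cannot be tested for zero, so a test
  \<open>Pos 0\<close> counts as failed.
\<close>

fun holds :: "nat list \<Rightarrow> cond \<Rightarrow> regs \<Rightarrow> bool" where
  "holds w (Pos r) s \<longleftrightarrow> 0 < r \<and> 0 < s r"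
| "holds w (Reads a) s \<longleftrightarrow> sym w (s 0) = a"

datatype cmd = SKIP | INC nat | DEC nat | SEQ cmd cmd | IF cond cmd cmd | WHILE cond cmd

text \<open>The step count is exact for the compiled machine: every elementary command and every
  test costs one step. \<open>DEC\<close> at 0 has no rule, because the head would leave the range
  of register values.\<close>

inductive exec :: "nat list \<Rightarrow> cmd \<Rightarrow> regs \<Rightarrow> nat \<Rightarrow> regs \<Rightarrow> bool" for w where
  Skip: "exec w SKIP s 1 s"
| Inc: "exec w (INC r) s 1 (s(r := Suc (s r)))"
| Dec: "0 < s r \<Longrightarrow> exec w (DEC r) s 1 (s(r := s r - 1))"
| Seq: "exec w c1 s t1 s1 \<Longrightarrow> exec w c2 s1 t2 s2 \<Longrightarrow> exec w (SEQ c1 c2) s (t1 + t2) s2"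
| IfT: "holds w b s \<Longrightarrow> exec w c1 s t s' \<Longrightarrow> exec w (IF b c1 c2) s (Suc t) s'"
| IfF: "\<not> holds w b s \<Longrightarrow> exec w c2 s t s' \<Longrightarrow> exec w (IF b c1 c2) s (Suc t) s'"
| WhileF: "\<not> holds w b s \<Longrightarrow> exec w (WHILE b c) s 1 s"
| WhileT: "holds w b s \<Longrightarrow> exec w c s t1 s1 \<Longrightarrow> exec w (WHILE b c) s1 t2 s2
    \<Longrightarrow> exec w (WHILE b c) s (Suc (t1 + t2)) s2"

section \<open>Compilation to multitape Turing machines\<close>

datatype instr = Move nat dir nat | Branch cond nat nat

fun code_size :: "cmd \<Rightarrow> nat" where
  "code_size (SEQ c1 c2) = code_size c1 + code_size c2"
| "code_size (IF b c1 c2) = Suc (code_size c1 + code_size c2)"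
| "code_size (WHILE b c) = Suc (code_size c)"
| "code_size _ = 1"

text \<open>The code is placed at address \<open>p\<close> and control passes to address
  \<open>e\<close> afterwards. Handing \<open>e\<close> down saves jumps: both branches of
  \<open>IF\<close> continue at \<open>e\<close>, and the body of \<open>WHILE\<close> continues at
  its own test \<open>p\<close>. \<open>SKIP\<close> is a branch with equal targets, as it has to
  take its one step.\<close>

fun compile :: "cmd \<Rightarrow> nat \<Rightarrow> nat \<Rightarrow> instr list" where
  "compile SKIP p e = [Branch (Pos 0) e e]"
| "compile (INC r) p e = [Move r Rgt e]"
| "compile (DEC r) p e = [Move r Lft e]"
| "compile (SEQ c1 c2) p e =
     compile c1 p (p + code_size c1) @ compile c2 (p + code_size c1) e"
| "compile (IF b c1 c2) p e =
     Branch b (Suc p) (Suc (p + code_size c1)) #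
       compile c1 (Suc p) e @ compile c2 (Suc (p + code_size c1)) e"
| "compile (WHILE b c) p e = Branch b (Suc p) e # compile c (Suc p) p"

lemma length_compile [simp]: "length (compile c p e) = code_size c"
  by (induction c arbitrary: p e) auto

fun targets :: "instr \<Rightarrow> nat set" where
  "targets (Move r d q) = {q}"
| "targets (Branch b q q') = {q, q'}"

lemma targets_compile:
  "i \<in> set (compile c p e) \<Longrightarrow> q \<in> targets i \<Longrightarrow> q \<le> p + code_size c \<or> q = e"
  by (induction c arbitrary: p e) (fastforce)+

fun cond_reg :: "cond \<Rightarrow> nat" where
  "cond_reg (Pos r) = r"
| "cond_reg (Reads a) = 0"

fun instr_reg :: "instr \<Rightarrow> nat" where
  "instr_reg (Move r d q) = r"
| "instr_reg (Branch b q q') = cond_reg b"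

fun test :: "cond \<Rightarrow> nat list \<Rightarrow> bool" where
  "test (Pos r) ss \<longleftrightarrow> 0 < r \<and> ss ! r \<noteq> 1"
| "test (Reads a) ss \<longleftrightarrow> ss ! 0 = a"

fun next_state :: "instr \<Rightarrow> nat list \<Rightarrow> nat" where
  "next_state (Move r d q) ss = q"
| "next_state (Branch b q q') ss = (if test b ss then q else q')"

fun actions :: "instr \<Rightarrow> nat list \<Rightarrow> (nat \<times> dir) list" where
  "actions (Move r d q) ss = (map (\<lambda>a. (a, Stay)) ss)[r := (ss ! r, d)]"
| "actions (Branch b q q') ss = map (\<lambda>a. (a, Stay)) ss"

text \<open>The states are the addresses of \<open>cs\<close>, followed by the accepting, the
  rejecting and the start state. As \<open>step\<close> halts in the first two of these, among the
  states of the machine only the start state uses the else branch of \<open>delta\<close>: it prints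
  the mark 1 on every counter tape and goes to address 0.\<close>

definition machine :: "nat \<Rightarrow> instr list \<Rightarrow> tm" where
  "machine K cs =
     \<lparr>num_tapes = K, num_states = length cs + 3, num_symbols = 4,
      start_state = length cs + 2, accept_state = length cs, reject_state = Suc (length cs),
      delta = (\<lambda>q ss. if q < length cs then (next_state (cs ! q) ss, actions (cs ! q) ss)
                 else (0, map (\<lambda>i. (if i = 0 then ss ! 0 else 1, Stay)) [0..<length ss]))\<rparr>"

lemma wf_machine:
  assumes "0 < K" and "\<And>i q. i \<in> set cs \<Longrightarrow> q \<in> targets i \<Longrightarrow> q < length cs + 2"
    and "\<And>i. i \<in> set cs \<Longrightarrow> instr_reg i < K"
  shows "wf_tm (machine K cs)"
proof -
  have next_less: "next_state i ss < length cs + 3" if "i \<in> set cs" for i ss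
    using assms(2)[OF that] by (cases i) (force split: if_splits)+
  have acts: "length (actions i ss) = K \<and> fst ` set (actions i ss) \<subseteq> {..<4}"
    if i: "i \<in> set cs" and ss: "length ss = K" "set ss \<subseteq> {..<4}" for i ss
  proof (cases i)
    case (Move r d q)
    have "ss ! r < 4"
      using assms(3)[OF i] ss Move subsetD[OF ss(2) nth_mem[of r]] by auto
    then show ?thesis
      using ss Move set_update_subset_insert[of "map (\<lambda>a. (a, Stay)) ss" r "(ss ! r, d)"]
      by fastforce
  qed (use ss in auto)
  have "q' < length cs + 3 \<and> length as = K \<and> fst ` set as \<subseteq> {..<4}"
    if ss: "length ss = K" "set ss \<subseteq> {..<4}" and "delta (machine K cs) q ss = (q', as)"
    for q ss q' as
  proof (cases "q < length cs")
    case True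
    then show ?thesis
      using that next_less[of "cs ! q" ss] acts[of "cs ! q" ss] by (auto simp: machine_def)
  next
    case False
    then show ?thesis
      using that assms(1) subsetD[OF ss(2) nth_mem[of 0]] by (auto simp: machine_def)
  qed
  moreover have "num_tapes (machine K cs) = K" "num_states (machine K cs) = length cs + 3"
    "num_symbols (machine K cs) = 4" "start_state (machine K cs) = length cs + 2"
    "accept_state (machine K cs) = length cs" "reject_state (machine K cs) = Suc (length cs)"
    by (simp_all add: machine_def)
  ultimately show ?thesis
    using assms(1) unfolding wf_tm_def by (simp, blast)
qed

text \<open>A counter tape carries a 1 at position 0 and blanks elsewhere, so the scanned symbol shows whether the counter is 0.\<close>

definition counter_tapes :: "nat \<Rightarrow> nat list \<Rightarrow> regs \<Rightarrow> tape list" where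
  "counter_tapes K w s =
     map (\<lambda>i. (if i = 0 then fst (word_tape w) else (\<lambda>j. if j = 0 then 1 else 0), int (s i))) [0..<K]"

lemma length_counter_tapes [simp]: "length (counter_tapes K w s) = K"
  by (simp add: counter_tapes_def)

lemma test_counter_tapes:
  assumes "cond_reg b < K"
  shows "test b (map read_tape (counter_tapes K w s)) \<longleftrightarrow> holds w b s"
  using assms by (cases b) (auto simp: counter_tapes_def word_tape_def sym_def)

lemma act_tape_Stay: "act_tape T (read_tape T, Stay) = T"
  by (cases T) auto

lemma map2_act_tape_Stay:
  "map2 act_tape ts (map (\<lambda>a. (a, Stay)) (map read_tape ts)) = ts"
  by (induction ts) (auto simp: act_tape_Stay simp del: act_tape.simps)

lemma step_machine:
  assumes "q < length cs"
  shows "step (machine K cs) (q, ts) =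
    (next_state (cs ! q) (map read_tape ts), map2 act_tape ts (actions (cs ! q) (map read_tape ts)))"
  using assms by (simp add: machine_def)

lemma step_Branch:
  assumes "q < length cs" "cs ! q = Branch b q1 q2" "cond_reg b < K"
  shows "step (machine K cs) (q, counter_tapes K w s) =
    (if holds w b s then q1 else q2, counter_tapes K w s)"
  using assms by (simp add: step_machine map2_act_tape_Stay test_counter_tapes del: step.simps map_map)

text \<open>A move writes back every symbol that was read, so the tape contents stay fixed and only
  one head position changes. The equation over \<open>int\<close> covers \<open>INC\<close> and
  \<open>DEC\<close> alike and keeps the head at a nonnegative position.\<close>

lemma step_Move:
  assumes "q < length cs" "cs ! q = Move r d q'" "r < K" "int (s r) + offset d = int m"
  shows "step (machine K cs) (q, counter_tapes K w s) = (q', counter_tapes K w (s(r := m)))"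
proof -
  let ?ts = "counter_tapes K w s"
  have "map2 act_tape ?ts ((map (\<lambda>a. (a, Stay)) (map read_tape ?ts))[r := (map read_tape ?ts ! r, d)])
      = counter_tapes K w (s(r := m))"
    using assms(3,4)
    by (intro nth_equalityI) (auto simp: counter_tapes_def nth_list_update)
  then show ?thesis
    by (simp only: step_machine[OF assms(1)] assms(2) next_state.simps actions.simps)
qed

definition contains :: "instr list \<Rightarrow> nat \<Rightarrow> instr list \<Rightarrow> bool" where
  "contains cs p ds \<longleftrightarrow> p + length ds \<le> length cs \<and> (\<forall>i<length ds. cs ! (p + i) = ds ! i)"

lemma contains_Cons:
  "contains cs p (d # ds) \<longleftrightarrow> p < length cs \<and> cs ! p = d \<and> contains cs (Suc p) ds"
  by (auto simp: contains_def All_less_Suc2)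

lemma contains_append:
  "contains cs p (ds @ es) \<longleftrightarrow> contains cs p ds \<and> contains cs (p + length ds) es"
  by (induction ds arbitrary: p) (auto simp: contains_Cons, auto simp: contains_def)

text \<open>Induction over the execution, with \<open>p\<close> and \<open>e\<close> arbitrary: the
  body of a loop is compiled with continuation \<open>p\<close>, after which the remaining rounds
  re-enter the same code.\<close>

lemma exec_compile:
  assumes "exec w c s t s'" "contains cs p (compile c p e)"
    and "\<And>i. i \<in> set cs \<Longrightarrow> instr_reg i < K"
  shows "(step (machine K cs) ^^ t) (p, counter_tapes K w s) = (e, counter_tapes K w s')"
  using assms(1,2)
proof (induction arbitrary: p e rule: exec.induct)
  case (Skip s)
  then have "p < length cs" "cs ! p = Branch (Pos 0) e e" by (auto simp: contains_Cons)
  then show ?case using assms(3)[OF nth_mem, of p] by (simp add: step_Branch del: step.simps)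
next
  case (Inc r s)
  then have "p < length cs" "cs ! p = Move r Rgt e" by (auto simp: contains_Cons)
  then show ?case
    using assms(3)[OF nth_mem, of p]
    unfolding One_nat_def funpow.simps comp_id by (intro step_Move) auto
next
  case (Dec s r)
  then have "p < length cs" "cs ! p = Move r Lft e" by (auto simp: contains_Cons)
  then show ?case
    using assms(3)[OF nth_mem, of p] Dec.hyps
    unfolding One_nat_def funpow.simps comp_id by (intro step_Move) auto
next
  case (Seq c1 s t1 s1 c2 t2 s2)
  from Seq.prems have
    "contains cs p (compile c1 p (p + code_size c1))"
    "contains cs (p + code_size c1) (compile c2 (p + code_size c1) e)"
    by (auto simp: contains_append)
  from Seq.IH(1)[OF this(1)] Seq.IH(2)[OF this(2)] show ?case
    by (subst add.commute) (simp add: funpow_add)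
next
  case (IfT b s c1 t s' c2)
  from IfT.prems have p: "p < length cs"
    "cs ! p = Branch b (Suc p) (Suc (p + code_size c1))"
    "contains cs (Suc p) (compile c1 (Suc p) e)"
    by (auto simp: contains_Cons contains_append)
  then show ?case
    using assms(3)[OF nth_mem, of p] IfT.IH[OF p(3)] IfT.hyps(1)
    by (simp add: step_Branch funpow_Suc_right del: step.simps funpow.simps)
next
  case (IfF b s c2 t s' c1)
  from IfF.prems have p: "p < length cs"
    "cs ! p = Branch b (Suc p) (Suc (p + code_size c1))"
    "contains cs (Suc (p + code_size c1)) (compile c2 (Suc (p + code_size c1)) e)"
    by (auto simp: contains_Cons contains_append)
  then show ?case
    using assms(3)[OF nth_mem, of p] IfF.IH[OF p(3)] IfF.hyps(1)
    by (simp add: step_Branch funpow_Suc_right del: step.simps funpow.simps)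
next
  case (WhileF b s c)
  then have "p < length cs" "cs ! p = Branch b (Suc p) e" by (auto simp: contains_Cons)
  then show ?case
    using assms(3)[OF nth_mem, of p] WhileF.hyps by (simp add: step_Branch del: step.simps)
next
  case (WhileT b s c t1 s1 t2 s2)
  from WhileT.prems have p: "p < length cs" "cs ! p = Branch b (Suc p) e"
    "contains cs (Suc p) (compile c (Suc p) p)"
    by (auto simp: contains_Cons)
  have "(step (machine K cs) ^^ Suc (t1 + t2)) (p, counter_tapes K w s) =
      (step (machine K cs) ^^ t2) ((step (machine K cs) ^^ t1) (Suc p, counter_tapes K w s))"
    using p assms(3)[OF nth_mem, of p] WhileT.hyps(1)
    by (subst add.commute)
      (simp add: step_Branch funpow_Suc_right funpow_add del: step.simps funpow.simps)
  then show ?case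
    using WhileT.IH(1)[OF p(3)] WhileT.IH(2)[OF WhileT.prems] by simp
qed

lemma poly_time_decidableI:
  assumes "\<And>x y. \<exists>t s. exec (pair_word x y) c (\<lambda>_. 0) t s \<and>
    t \<le> poly p (length (pair_word x y)) \<and> (0 < s 1 \<longleftrightarrow> R x y)"
  shows "poly_time_decidable R"
proof -
  let ?n = "code_size c"
  \<comment> \<open>The extra instruction sits at the exit address \<open>?n\<close> of the program.
    As \<open>length cs = Suc ?n\<close>, its two targets are the accepting and the rejecting state
    of \<open>machine\<close>.\<close>
  define cs where "cs = compile c 0 ?n @ [Branch (Pos 1) (Suc ?n) (Suc (Suc ?n))]"
  define K where "K = Suc (Max (instr_reg ` set cs))"
  have len: "length cs = Suc ?n" by (simp add: cs_def)
  have reg: "instr_reg i < K" if "i \<in> set cs" for i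
    unfolding K_def using that by (auto simp: less_Suc_eq_le)
  have last: "?n < length cs" "cs ! ?n = Branch (Pos 1) (Suc ?n) (Suc (Suc ?n))"
    by (simp_all add: cs_def nth_append)
  then have K: "1 < K" using reg[OF nth_mem, of ?n] by simp
  define M where "M = machine K cs"
  have wf: "wf_tm M"
    unfolding M_def
  proof (rule wf_machine)
    fix i q assume "i \<in> set cs" "q \<in> targets i"
    then show "q < length cs + 2"
      using targets_compile[of i c 0 ?n q] by (auto simp: cs_def)
  qed (use reg K in auto)
  \<comment> \<open>The two additional steps are the initial one, which marks the counter tapes, and
    the final branch on register 1.\<close>
  have "\<exists>t\<le>poly (p + 2) (length (pair_word x y)).
      fst ((step M ^^ t) (init_config M (pair_word x y))) =
        (if R x y then accept_state M else reject_state M)" for x y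
  proof -
    let ?w = "pair_word x y"
    obtain t s where t: "exec ?w c (\<lambda>_. 0) t s" "t \<le> poly p (length ?w)" "0 < s 1 \<longleftrightarrow> R x y"
      using assms[of x y] by (elim exE conjE)
    have "contains cs 0 (compile c 0 ?n)" by (simp add: contains_def cs_def nth_append)
    note run = exec_compile[OF t(1) this reg, folded M_def]
    define ts where "ts = word_tape ?w # replicate (K - 1) (word_tape [])"
    have len_ts: "length ts = K" using K by (simp add: ts_def)
    have "init_config M ?w = (length cs + 2, ts)"
      by (simp add: init_config_def M_def machine_def ts_def)
    moreover have "step M (length cs + 2, ts) =
        (0, map2 act_tape ts (map (\<lambda>i. (if i = 0 then map read_tape ts ! 0 else 1, Stay)) [0..<K]))"
      by (simp add: M_def machine_def len_ts)
    moreover have "map2 act_tape ts (map (\<lambda>i. (if i = 0 then map read_tape ts ! 0 else 1, Stay)) [0..<K])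
        = counter_tapes K ?w (\<lambda>_. 0)"
    proof (rule nth_equalityI)
      fix i assume "i < length (map2 act_tape ts
        (map (\<lambda>i. (if i = 0 then map read_tape ts ! 0 else 1, Stay)) [0..<K]))"
      then have i: "i < K" by (simp add: len_ts)
      have "map2 act_tape ts (map (\<lambda>i. (if i = 0 then map read_tape ts ! 0 else 1, Stay)) [0..<K]) ! i
          = act_tape (ts ! i) (if i = 0 then map read_tape ts ! 0 else 1, Stay)"
        using i len_ts by simp
      also have "\<dots> = counter_tapes K ?w (\<lambda>_. 0) ! i"
        using i by (cases i) (auto simp: ts_def counter_tapes_def word_tape_def)
      finally show "map2 act_tape ts
          (map (\<lambda>i. (if i = 0 then map read_tape ts ! 0 else 1, Stay)) [0..<K]) ! i
          = counter_tapes K ?w (\<lambda>_. 0) ! i" .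
    qed (simp add: len_ts)
    ultimately have start: "step M (init_config M ?w) = (0, counter_tapes K ?w (\<lambda>_. 0))"
      by simp
    have "(step M ^^ Suc (t + 1)) (init_config M ?w) =
        step M ((step M ^^ t) (step M (init_config M ?w)))"
      by (simp add: funpow_swap1)
    also have "\<dots> = (if 0 < s 1 then Suc ?n else Suc (Suc ?n), counter_tapes K ?w s)"
      using K by (simp add: start run step_Branch[OF last, of K, folded M_def] del: step.simps)
    finally have "fst ((step M ^^ Suc (t + 1)) (init_config M ?w)) =
        (if R x y then accept_state M else reject_state M)"
      using t(3) by (simp add: M_def machine_def len)
    then show ?thesis
      using t(2) by (intro exI[of _ "Suc (t + 1)"]) simp
  qed
  then show ?thesis
    unfolding poly_time_decidable_def using wf by blast
qed

section \<open>Evaluation of first-order formulas\<close>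

text \<open>Only an upper bound on the time is kept, so that both branches of a conditional can
  share one bound.\<close>

definition run :: "nat list \<Rightarrow> cmd \<Rightarrow> regs \<Rightarrow> nat \<Rightarrow> regs \<Rightarrow> bool" where
  "run w c s b s' \<longleftrightarrow> (\<exists>t\<le>b. exec w c s t s')"

lemma run_mono: "run w c s b s' \<Longrightarrow> b \<le> b' \<Longrightarrow> run w c s b' s'"
  unfolding run_def by (meson le_trans)

lemma run_SKIP: "run w SKIP s 1 s"
  unfolding run_def by (blast intro: exec.Skip)

lemma run_INC: "run w (INC r) s 1 (s(r := Suc (s r)))"
  unfolding run_def by (blast intro: exec.Inc)

lemma run_DEC: "0 < s r \<Longrightarrow> run w (DEC r) s 1 (s(r := s r - 1))"
  unfolding run_def by (blast intro: exec.Dec)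

lemma run_SEQ:
  assumes "run w c1 s b1 s1" "run w c2 s1 b2 s2"
  shows "run w (SEQ c1 c2) s (b1 + b2) s2"
proof -
  obtain t1 t2 where "t1 \<le> b1" "exec w c1 s t1 s1" "t2 \<le> b2" "exec w c2 s1 t2 s2"
    using assms unfolding run_def by blast
  then show ?thesis
    unfolding run_def by (intro exI[of _ "t1 + t2"]) (auto intro: exec.Seq)
qed

lemma run_IF:
  assumes "holds w b s \<Longrightarrow> run w c1 s t s'" "\<not> holds w b s \<Longrightarrow> run w c2 s t s'"
  shows "run w (IF b c1 c2) s (Suc t) s'"
proof (cases "holds w b s")
  case True
  then show ?thesis
    using assms(1) unfolding run_def by (meson exec.IfT Suc_le_mono)
next
  case False
  then show ?thesis
    using assms(2) unfolding run_def by (meson exec.IfF Suc_le_mono)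
qed

text \<open>In place of an invariant, the state \<open>S i\<close> after \<open>i\<close> rounds is
  named in advance; this also fixes the number of rounds. The summand 1 is the last, failing
  test.\<close>

lemma run_WHILE:
  assumes "\<And>i. i < n \<Longrightarrow> holds w b (S i) \<and> run w c (S i) t (S (Suc i))"
    and "\<not> holds w b (S n)"
  shows "run w (WHILE b c) (S 0) (n * Suc t + 1) (S n)"
  using assms
proof (induction n arbitrary: S)
  case 0
  then show ?case unfolding run_def by (auto intro!: exI[of _ 1] exec.WhileF)
next
  case (Suc n)
  have "run w (WHILE b c) (S (Suc 0)) (n * Suc t + 1) (S (Suc n))"
    using Suc.IH[of "\<lambda>i. S (Suc i)"] Suc.prems by simp
  then obtain t2 where t2: "t2 \<le> n * Suc t + 1" "exec w (WHILE b c) (S (Suc 0)) t2 (S (Suc n))"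
    unfolding run_def by blast
  obtain t1 where t1: "t1 \<le> t" "exec w c (S 0) t1 (S (Suc 0))" and "holds w b (S 0)"
    using Suc.prems(1)[of 0] unfolding run_def by auto
  then have "exec w (WHILE b c) (S 0) (Suc (t1 + t2)) (S (Suc n))"
    using t2 by (auto intro: exec.WhileT)
  moreover have "Suc (t1 + t2) \<le> Suc n * Suc t + 1" using t1 t2 by simp
  ultimately show ?case unfolding run_def by blast
qed

text \<open>
  Registers \<open>k\<close> and \<open>k + 1\<close> are scratch: register \<open>v\<close> is copied to \<open>k\<close> and restored first, so that the
  body can read it.
\<close>

definition FOR :: "nat \<Rightarrow> nat \<Rightarrow> cmd \<Rightarrow> cmd" where
  "FOR v k c =
     SEQ (WHILE (Pos v) (SEQ (DEC v) (SEQ (INC k) (INC (Suc k)))))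
       (SEQ (WHILE (Pos (Suc k)) (SEQ (DEC (Suc k)) (INC v)))
         (WHILE (Pos k) (SEQ (DEC k) c)))"

text \<open>\<open>S\<close> describes the registers apart from \<open>k\<close>, which during a
  round holds the number of rounds still to come. The bound adds up the three loops:
  \<open>4 n + 1\<close> for copying, \<open>3 n + 1\<close> for restoring and
  \<open>n (b + 2) + 1\<close> for the rounds.\<close>

lemma run_FOR:
  assumes "0 < v" "v < k" "S 0 k = 0" "S 0 (Suc k) = 0" "S 0 v = n"
    and body: "\<And>i. i < n \<Longrightarrow> run w c ((S i)(k := n - Suc i)) b ((S (Suc i))(k := n - Suc i))"
    and zero: "\<And>i. i \<le> n \<Longrightarrow> S i k = 0"
  shows "run w (FOR v k c) (S 0) (n * (b + 9) + 3) (S n)"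
proof -
  let ?s = "S 0"
  define A where "A i = ?s(v := n - i, k := i, Suc k := i)" for i
  define B where "B i = ?s(v := i, k := n, Suc k := n - i)" for i
  define C where "C i = (S i)(k := n - i)" for i
  have A: "run w (WHILE (Pos v) (SEQ (DEC v) (SEQ (INC k) (INC (Suc k))))) (A 0) (n * Suc 3 + 1) (A n)"
  proof (rule run_WHILE)
    fix i assume "i < n"
    have "run w (SEQ (DEC v) (SEQ (INC k) (INC (Suc k)))) (A i) (1 + (1 + 1))
        (((A i)(v := A i v - 1))(k := Suc (A i k), Suc k := Suc (A i (Suc k))))"
      using \<open>i < n\<close> assms(1,2)
      by (intro run_SEQ[OF run_DEC run_SEQ[OF run_INC run_INC[THEN back_subst[of "run _ _ _ _"]]]])
        (auto simp: A_def fun_eq_iff)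
    also have "((A i)(v := A i v - 1))(k := Suc (A i k), Suc k := Suc (A i (Suc k))) = A (Suc i)"
      using assms(2) by (auto simp: A_def fun_eq_iff)
    finally have "run w (SEQ (DEC v) (SEQ (INC k) (INC (Suc k)))) (A i) 3 (A (Suc i))"
      by (rule run_mono) simp
    moreover have "holds w (Pos v) (A i)" using \<open>i < n\<close> assms(1,2) by (simp add: A_def)
    ultimately show "holds w (Pos v) (A i) \<and>
        run w (SEQ (DEC v) (SEQ (INC k) (INC (Suc k)))) (A i) 3 (A (Suc i))"
      by blast
  qed (use assms(2) in \<open>simp add: A_def\<close>)
  have B: "run w (WHILE (Pos (Suc k)) (SEQ (DEC (Suc k)) (INC v))) (B 0) (n * Suc 2 + 1) (B n)"
  proof (rule run_WHILE)
    fix i assume "i < n"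
    have "run w (SEQ (DEC (Suc k)) (INC v)) (B i) (1 + 1)
        (((B i)(Suc k := B i (Suc k) - 1))(v := Suc (B i v)))"
      using \<open>i < n\<close> assms(2)
      by (intro run_SEQ[OF run_DEC run_INC[THEN back_subst[of "run _ _ _ _"]]])
        (auto simp: B_def fun_eq_iff)
    also have "((B i)(Suc k := B i (Suc k) - 1))(v := Suc (B i v)) = B (Suc i)"
      using assms(2) by (auto simp: B_def fun_eq_iff)
    finally have "run w (SEQ (DEC (Suc k)) (INC v)) (B i) 2 (B (Suc i))"
      by (rule run_mono) simp
    moreover have "holds w (Pos (Suc k)) (B i)" using \<open>i < n\<close> by (simp add: B_def)
    ultimately show "holds w (Pos (Suc k)) (B i) \<and>
        run w (SEQ (DEC (Suc k)) (INC v)) (B i) 2 (B (Suc i))"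
      by blast
  qed (use assms(2) in \<open>simp add: B_def\<close>)
  have C: "run w (WHILE (Pos k) (SEQ (DEC k) c)) (C 0) (n * Suc (1 + b) + 1) (C n)"
  proof (rule run_WHILE)
    fix i assume "i < n"
    have *: "(C i)(k := C i k - 1) = (S i)(k := n - Suc i)" by (auto simp: C_def)
    have "C (Suc i) = (S (Suc i))(k := n - Suc i)" by (simp add: C_def)
    then have "run w c ((C i)(k := C i k - 1)) b (C (Suc i))"
      using body[OF \<open>i < n\<close>] * by simp
    then show "holds w (Pos k) (C i) \<and> run w (SEQ (DEC k) c) (C i) (1 + b) (C (Suc i))"
      using \<open>i < n\<close> assms(2) by (intro conjI run_SEQ[OF run_DEC]) (auto simp: C_def)
  qed (use assms(2) in \<open>simp add: C_def\<close>)
  have "A 0 = ?s" "A n = B 0" "B n = C 0" "C n = S n"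
    using assms(3-5) zero[of n] by (auto simp: A_def B_def C_def fun_eq_iff)
  then have "run w (FOR v k c) ?s ((n * Suc 3 + 1) + ((n * Suc 2 + 1) + (n * Suc (1 + b) + 1))) (S n)"
    unfolding FOR_def using A B C by (metis run_SEQ)
  then show ?thesis
    by (rule run_mono) (simp add: algebra_simps)
qed

section \<open>Terms with polynomially bounded values\<close>

definition poly_bounded :: "(nat \<Rightarrow> nat) \<Rightarrow> bool" where
  "poly_bounded f \<longleftrightarrow> (\<exists>p :: nat poly. \<forall>n. f n \<le> poly p n)"

lemma poly_bounded_const: "poly_bounded (\<lambda>_. c)"
  unfolding poly_bounded_def by (intro exI[of _ "[:c:]"]) simp

lemma poly_bounded_id: "poly_bounded (\<lambda>n. n)"
  unfolding poly_bounded_def by (intro exI[of _ "[:0, 1:]"]) simp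

lemma poly_bounded_add: "poly_bounded f \<Longrightarrow> poly_bounded g \<Longrightarrow> poly_bounded (\<lambda>n. f n + g n)"
  unfolding poly_bounded_def by (metis add_mono poly_add)

lemma poly_bounded_mult: "poly_bounded f \<Longrightarrow> poly_bounded g \<Longrightarrow> poly_bounded (\<lambda>n. f n * g n)"
  unfolding poly_bounded_def by (metis mult_le_mono poly_mult)

lemmas poly_bounded_intros =
  poly_bounded_const poly_bounded_id poly_bounded_add poly_bounded_mult

type_synonym 'a wordfun = "bool list \<Rightarrow> bool list \<Rightarrow> (nat \<Rightarrow> nat) \<Rightarrow> 'a"

definition depends :: "nat \<Rightarrow> 'a wordfun \<Rightarrow> bool" where
  "depends j T \<longleftrightarrow> (\<forall>x y e e'. (\<forall>i<j. e i = e' i) \<longrightarrow> T x y e = T x y e')"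

text \<open>Registers 0, 1 and 2 hold the input head, the truth value of the last formula and \<open>length x\<close>.\<close>

definition env :: "regs \<Rightarrow> nat \<Rightarrow> nat" where
  "env s i = s (i + 3)"

definition small :: "nat \<Rightarrow> nat \<Rightarrow> bool list \<Rightarrow> regs \<Rightarrow> bool" where
  "small j k x s \<longleftrightarrow> s 2 = length x \<and> (\<forall>i<j. env s i \<le> length x) \<and> (\<forall>i\<ge>k. s i = 0)"

text \<open>The program adds the value to a register instead of storing it there, so a sum is a
  composition and a product is a repeated addition. It has to exist for every choice of the target
  \<open>r\<close> and of the start \<open>k\<close> of the scratch space, since enclosing loops
  shift both; the bound \<open>b\<close> on value and time is chosen beforehand.\<close>

definition eterm :: "nat \<Rightarrow> nat wordfun \<Rightarrow> bool" where
  "eterm j T \<longleftrightarrow> depends j T \<and>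
     (\<exists>b. poly_bounded b \<and> (\<forall>x y e. (\<forall>i<j. e i \<le> length x) \<longrightarrow> T x y e \<le> b (length x)) \<and>
       (\<forall>r k. j + 3 \<le> r \<longrightarrow> r < k \<longrightarrow> (\<exists>c. \<forall>x y s. small j k x s \<longrightarrow>
          run (pair_word x y) c s (b (length x)) (s(r := s r + T x y (env s))))))"

lemma small_upd [simp]:
  "j + 3 \<le> r \<Longrightarrow> r < k \<Longrightarrow> small j k x (s(r := a)) = small j k x s"
  by (auto simp: small_def env_def)

lemma depends_upd:
  assumes "depends j T" "j + 3 \<le> r"
  shows "T x y (env (s(r := a))) = T x y (env s)"
proof -
  have "\<forall>i<j. env (s(r := a)) i = env s i" using assms(2) by (simp add: env_def)
  then show ?thesis using assms(1) unfolding depends_def by blast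
qed

lemma env_upd_low: "r < 3 \<Longrightarrow> env (s(r := a)) = env s"
  by (auto simp: env_def)

lemma eterm_const: "eterm j (\<lambda>x y e. n)"
proof (induction n)
  case 0
  show ?case
    unfolding eterm_def depends_def
    by (intro conjI exI[of _ "\<lambda>_. 1"] allI impI exI[of _ SKIP] poly_bounded_const)
      (auto intro: run_SKIP[unfolded One_nat_def])
next
  case (Suc n)
  then obtain b where b: "poly_bounded b" "\<And>x :: bool list. n \<le> b (length x)"
    and c: "\<And>r k. j + 3 \<le> r \<Longrightarrow> r < k \<Longrightarrow> \<exists>c. \<forall>x y s. small j k x s \<longrightarrow>
          run (pair_word x y) c s (b (length x)) (s(r := s r + n))"
    unfolding eterm_def by auto (metis le0)
  show ?case
    unfolding eterm_def
  proof (intro conjI exI[of _ "\<lambda>n. b n + 1"] allI impI)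
    show "poly_bounded (\<lambda>n. b n + 1)" using b by (intro poly_bounded_intros)
  next
    fix r k :: nat assume "j + 3 \<le> r" "r < k"
    then obtain c where c: "\<And>x y s. small j k x s \<Longrightarrow>
          run (pair_word x y) c s (b (length x)) (s(r := s r + n))"
      using c by blast
    show "\<exists>c. \<forall>x y s. small j k x s \<longrightarrow>
          run (pair_word x y) c s (b (length x) + 1) (s(r := s r + Suc n))"
      using run_SEQ[OF c run_INC[of _ r]] by (intro exI[of _ "SEQ c (INC r)"]) simp
  next
    show "depends j (\<lambda>x y e. Suc n)" by (simp add: depends_def)
  next
    fix x :: "bool list" and e :: "nat \<Rightarrow> nat"
    show "Suc n \<le> b (length x) + 1" using b(2) by simp
  qed
qed

lemma eterm_plus:
  assumes "eterm j T" "eterm j U"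
  shows "eterm j (\<lambda>x y e. T x y e + U x y e)"
proof -
  from assms(1) obtain b1 where b1: "depends j T" "poly_bounded b1"
    "\<And>x y e. (\<forall>i<j. e i \<le> length x) \<Longrightarrow> T x y e \<le> b1 (length x)"
    and c1: "\<And>r k. j + 3 \<le> r \<Longrightarrow> r < k \<Longrightarrow> \<exists>c. \<forall>x y s. small j k x s \<longrightarrow>
          run (pair_word x y) c s (b1 (length x)) (s(r := s r + T x y (env s)))"
    unfolding eterm_def by blast
  from assms(2) obtain b2 where b2: "depends j U" "poly_bounded b2"
    "\<And>x y e. (\<forall>i<j. e i \<le> length x) \<Longrightarrow> U x y e \<le> b2 (length x)"
    and c2: "\<And>r k. j + 3 \<le> r \<Longrightarrow> r < k \<Longrightarrow> \<exists>c. \<forall>x y s. small j k x s \<longrightarrow>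
          run (pair_word x y) c s (b2 (length x)) (s(r := s r + U x y (env s)))"
    unfolding eterm_def by blast
  show ?thesis
    unfolding eterm_def
  proof (intro conjI exI[of _ "\<lambda>n. b1 n + b2 n"] allI impI)
    show "poly_bounded (\<lambda>n. b1 n + b2 n)" using b1 b2 by (intro poly_bounded_intros)
    show "depends j (\<lambda>x y e. T x y e + U x y e)"
      using b1(1) b2(1) unfolding depends_def by metis
  next
    fix r k :: nat assume rk: "j + 3 \<le> r" "r < k"
    obtain c where c: "\<And>x y s. small j k x s \<Longrightarrow>
          run (pair_word x y) c s (b1 (length x)) (s(r := s r + T x y (env s)))"
      using c1[OF rk] by blast
    obtain d where d: "\<And>x y s. small j k x s \<Longrightarrow>
          run (pair_word x y) d s (b2 (length x)) (s(r := s r + U x y (env s)))"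
      using c2[OF rk] by blast
    have "run (pair_word x y) (SEQ c d) s (b1 (length x) + b2 (length x))
        (s(r := s r + (T x y (env s) + U x y (env s))))" if "small j k x s" for x y s
      using run_SEQ[OF c[OF that, of y] d[of x "s(r := s r + T x y (env s))" y]] that rk b2(1)
      by (simp add: depends_upd add.assoc)
    then show "\<exists>c. \<forall>x y s. small j k x s \<longrightarrow> run (pair_word x y) c s (b1 (length x) + b2 (length x))
        (s(r := s r + (T x y (env s) + U x y (env s))))" by blast
  next
    fix x y :: "bool list" and e :: "nat \<Rightarrow> nat" assume "\<forall>i<j. e i \<le> length x"
    then show "T x y e + U x y e \<le> b1 (length x) + b2 (length x)"
      by (intro add_mono b1(3) b2(3))
  qed
qed

text \<open>A product is computed by adding \<open>T\<close> in a loop over register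
  \<open>v\<close>, which holds either \<open>length x\<close> (\<open>v = 2\<close>) or a variable.
  In both cases there are at most \<open>length x\<close> rounds, which keeps the time
  polynomial.\<close>

lemma eterm_iterate:
  assumes "eterm j T" and v: "1 < v" "v < j + 3"
    and V: "V = (\<lambda>x y e. if v = 2 then length x else e (v - 3))"
  shows "eterm j (\<lambda>x y e. V x y e * T x y e)"
proof -
  from assms(1) obtain b where b: "depends j T" "poly_bounded b"
    "\<And>x y e. (\<forall>i<j. e i \<le> length x) \<Longrightarrow> T x y e \<le> b (length x)"
    and c: "\<And>r k. j + 3 \<le> r \<Longrightarrow> r < k \<Longrightarrow> \<exists>c. \<forall>x y s. small j k x s \<longrightarrow>
          run (pair_word x y) c s (b (length x)) (s(r := s r + T x y (env s)))"
    unfolding eterm_def by blast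
  have V_le: "V x y e \<le> length x" if "\<forall>i<j. e i \<le> length x" for x y :: "bool list" and e
    using that v by (auto simp: V)
  show ?thesis
    unfolding eterm_def
  proof (intro conjI exI[of _ "\<lambda>n. n * (b n + 9) + 3"] allI impI)
    show "poly_bounded (\<lambda>n. n * (b n + 9) + 3)" using b by (intro poly_bounded_intros)
    show "depends j (\<lambda>x y e. V x y e * T x y e)"
      unfolding depends_def
    proof (intro allI impI)
      fix x y :: "bool list" and e e' :: "nat \<Rightarrow> nat" assume *: "\<forall>i<j. e i = e' i"
      then have "T x y e = T x y e'" using b(1) unfolding depends_def by blast
      moreover have "V x y e = V x y e'" using * v by (auto simp: V)
      ultimately show "V x y e * T x y e = V x y e' * T x y e'" by simp
    qed
  next
    fix x y :: "bool list" and e :: "nat \<Rightarrow> nat" assume *: "\<forall>i<j. e i \<le> length x"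
    have "V x y e * T x y e \<le> length x * b (length x)"
      using V_le[OF *] b(3)[OF *] by (rule mult_le_mono)
    then show "V x y e * T x y e \<le> length x * (b (length x) + 9) + 3"
      by (simp add: algebra_simps)
  next
    fix r k :: nat assume rk: "j + 3 \<le> r" "r < k"
    \<comment> \<open>The loop itself occupies registers \<open>k\<close> and \<open>k + 1\<close>,
      so the program for \<open>T\<close> gets its scratch space from \<open>k + 2\<close>
      on.\<close>
    then obtain c where c: "\<And>x y s. small j (k + 2) x s \<Longrightarrow>
          run (pair_word x y) c s (b (length x)) (s(r := s r + T x y (env s)))"
      using c[of r "k + 2"] by auto
    have "run (pair_word x y) (FOR v k c) s (length x * (b (length x) + 9) + 3)
        (s(r := s r + V x y (env s) * T x y (env s)))" if s: "small j k x s" for x y s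
    proof -
      define S where "S i = s(r := s r + i * T x y (env s))" for i
      have Sv: "s v = V x y (env s)" using v s by (auto simp: V env_def small_def)
      have "run (pair_word x y) (FOR v k c) (S 0) (s v * (b (length x) + 9) + 3) (S (s v))"
      proof (rule run_FOR)
        fix i assume "i < s v"
        have "small j (k + 2) x ((S i)(k := s v - Suc i))"
          using s rk by (auto simp: small_def S_def env_def)
        from c[OF this, of y] show "run (pair_word x y) c ((S i)(k := s v - Suc i)) (b (length x))
            ((S (Suc i))(k := s v - Suc i))"
          using rk by (simp add: depends_upd[OF b(1)] S_def fun_upd_twist ac_simps)
      qed (use s v rk in \<open>auto simp: S_def small_def\<close>)
      moreover have "s v \<le> length x"
        using s v V_le[of "env s" x y] unfolding Sv small_def by blast
      ultimately show ?thesis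
        unfolding Sv[symmetric] by (auto simp: S_def elim!: run_mono intro!: mult_le_mono)
    qed
    then show "\<exists>c. \<forall>x y s. small j k x s \<longrightarrow> run (pair_word x y) c s
        (length x * (b (length x) + 9) + 3) (s(r := s r + V x y (env s) * T x y (env s)))" by blast
  qed
qed

lemma eterm_times_var: "v < j \<Longrightarrow> eterm j T \<Longrightarrow> eterm j (\<lambda>x y e. e v * T x y e)"
  by (rule eterm_iterate[of j T "v + 3"]) auto

lemma eterm_times_length: "eterm j T \<Longrightarrow> eterm j (\<lambda>x y e. length x * T x y e)"
  by (rule eterm_iterate[of j T 2]) auto

lemma eterm_var: "v < j \<Longrightarrow> eterm j (\<lambda>x y e. e v)"
  using eterm_times_var[OF _ eterm_const[of j 1]] by simp

lemma eterm_length: "eterm j (\<lambda>x y e. length x)"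
  using eterm_times_length[OF eterm_const[of j 1]] by simp

section \<open>Formulas evaluated into the flag register\<close>

definition SET_FLAG :: "cond \<Rightarrow> cmd" where
  "SET_FLAG b = SEQ (IF (Pos 1) (DEC 1) SKIP) (IF b (INC 1) SKIP)"

lemma run_SET_FLAG:
  assumes "s 1 \<le> 1"
  shows "run w (SET_FLAG b) s 4 (s(1 := of_bool (holds w b (s(1 := 0)))))"
proof -
  have "run w (IF (Pos 1) (DEC 1) SKIP) s (Suc 1) (s(1 := 0))"
  proof (rule run_IF)
    assume "holds w (Pos 1) s"
    then have "s 1 = 1" using assms by simp
    then show "run w (DEC 1) s 1 (s(1 := 0))" using run_DEC[of s 1 w] by simp
  next
    assume "\<not> holds w (Pos 1) s"
    then have "s(1 := 0) = s" by auto
    then show "run w SKIP s 1 (s(1 := 0))" using run_SKIP[of w s] by simp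
  qed
  moreover have "run w (IF b (INC 1) SKIP) (s(1 := 0)) (Suc 1)
      (s(1 := of_bool (holds w b (s(1 := 0)))))"
  proof (rule run_IF)
    assume "holds w b (s(1 := 0))"
    then show "run w (INC 1) (s(1 := 0)) 1 (s(1 := of_bool (holds w b (s(1 := 0)))))"
      using run_INC[of w 1 "s(1 := 0)"] by simp
  next
    assume "\<not> holds w b (s(1 := 0))"
    then show "run w SKIP (s(1 := 0)) 1 (s(1 := of_bool (holds w b (s(1 := 0)))))"
      using run_SKIP[of w "s(1 := 0)"] by simp
  qed
  ultimately have "run w (SET_FLAG b) s (Suc 1 + Suc 1) (s(1 := of_bool (holds w b (s(1 := 0)))))"
    unfolding SET_FLAG_def by (rule run_SEQ)
  then show ?thesis by (rule run_mono) simp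
qed

lemma run_clear:
  assumes "0 < r"
  shows "run w (WHILE (Pos r) (DEC r)) s (s r * 2 + 1) (s(r := 0))"
proof -
  define S where "S i = s(r := s r - i)" for i
  have "run w (WHILE (Pos r) (DEC r)) (S 0) (s r * Suc 1 + 1) (S (s r))"
  proof (rule run_WHILE)
    fix i assume "i < s r"
    have "(S i)(r := S i r - 1) = S (Suc i)" by (simp add: S_def)
    then show "holds w (Pos r) (S i) \<and> run w (DEC r) (S i) 1 (S (Suc i))"
      using run_DEC[of "S i" r w] \<open>i < s r\<close> assms by (simp add: S_def)
  qed (simp add: S_def)
  moreover have "S 0 = s" "S (s r) = s(r := 0)" by (auto simp: S_def)
  ultimately show ?thesis by (simp add: numeral_2_eq_2)
qed

definition ready :: "nat \<Rightarrow> bool list \<Rightarrow> regs \<Rightarrow> bool" where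
  "ready j x s \<longleftrightarrow> s 0 = 0 \<and> s 1 \<le> 1 \<and> small j (j + 3) x s"

text \<open>The time is bounded in \<open>length x\<close> alone, however long \<open>y\<close> is:
  quantifiers stay below \<open>length x\<close> and terms are polynomial in it, so only a short
  prefix of the input is ever visited. All registers but the flag are restored, which is what makes
  evaluations composable.\<close>

definition definable :: "nat \<Rightarrow> bool wordfun \<Rightarrow> bool" where
  "definable j P \<longleftrightarrow> (\<exists>c b. poly_bounded b \<and> (\<forall>x y s. ready j x s \<longrightarrow>
     run (pair_word x y) c s (b (length x)) (s(1 := of_bool (P x y (env s))))))"

lemma definableI:
  assumes "poly_bounded b"
    and "\<And>x y s. ready j x s \<Longrightarrow>
      run (pair_word x y) c s (b (length x)) (s(1 := of_bool (P x y (env s))))"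
  shows "definable j P"
  using assms unfolding definable_def by blast

lemma definableE:
  assumes "definable j P"
  obtains b c where "poly_bounded b"
    and "\<And>x y s. ready j x s \<Longrightarrow>
      run (pair_word x y) c s (b (length x)) (s(1 := of_bool (P x y (env s))))"
  using assms unfolding definable_def by blast

lemma ready_flag: "ready j x s \<Longrightarrow> ready j x (s(1 := of_bool b))"
  by (simp add: ready_def small_def env_def)

lemma env_flag [simp]: "env (s(Suc 0 := a)) = env s"
  by (simp add: env_upd_low)

lemma definable_not:
  assumes "definable j P"
  shows "definable j (\<lambda>x y e. \<not> P x y e)"
proof -
  obtain b c where b: "poly_bounded b" and c: "\<And>x y s. ready j x s \<Longrightarrow>
      run (pair_word x y) c s (b (length x)) (s(1 := of_bool (P x y (env s))))"
    using assms by (rule definableE) blast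
  show ?thesis
  proof (rule definableI)
    show "poly_bounded (\<lambda>n. b n + Suc 1)" using b by (intro poly_bounded_intros)
  next
    fix x y s assume s: "ready j x s"
    let ?s = "s(1 := of_bool (P x y (env s)))" and ?t = "s(1 := of_bool (\<not> P x y (env s)))"
    have "run (pair_word x y) (IF (Pos 1) (DEC 1) (INC 1)) ?s (Suc 1) ?t"
    proof (rule run_IF)
      assume "holds (pair_word x y) (Pos 1) ?s"
      then show "run (pair_word x y) (DEC 1) ?s 1 ?t"
        using run_DEC[of ?s 1 "pair_word x y"] by (simp split: if_splits)
    next
      assume "\<not> holds (pair_word x y) (Pos 1) ?s"
      then show "run (pair_word x y) (INC 1) ?s 1 ?t"
        using run_INC[of "pair_word x y" 1 ?s] by (simp split: if_splits)
    qed
    with c[OF s, of y] show "run (pair_word x y) (SEQ c (IF (Pos 1) (DEC 1) (INC 1))) s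
        (b (length x) + Suc 1) ?t"
      by (rule run_SEQ)
  qed
qed

lemma definable_conj:
  assumes "definable j P" "definable j Q"
  shows "definable j (\<lambda>x y e. P x y e \<and> Q x y e)"
proof -
  obtain b c where b: "poly_bounded b" and c: "\<And>x y s. ready j x s \<Longrightarrow>
      run (pair_word x y) c s (b (length x)) (s(1 := of_bool (P x y (env s))))"
    using assms(1) by (rule definableE) blast
  obtain b' c' where b': "poly_bounded b'" and c': "\<And>x y s. ready j x s \<Longrightarrow>
      run (pair_word x y) c' s (b' (length x)) (s(1 := of_bool (Q x y (env s))))"
    using assms(2) by (rule definableE) blast
  show ?thesis
  proof (rule definableI)
    show "poly_bounded (\<lambda>n. b n + Suc (b' n + 1))" using b b' by (intro poly_bounded_intros poly_bounded_add[of "\<lambda>_. 1", simplified])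
  next
    fix x y s assume s: "ready j x s"
    let ?s = "s(1 := of_bool (P x y (env s)))"
      and ?t = "s(1 := of_bool (P x y (env s) \<and> Q x y (env s)))"
    have "run (pair_word x y) (IF (Pos 1) c' SKIP) ?s (Suc (b' (length x) + 1)) ?t"
    proof (rule run_IF)
      assume "holds (pair_word x y) (Pos 1) ?s"
      then have "P x y (env s)" by (simp split: if_splits)
      then show "run (pair_word x y) c' ?s (b' (length x) + 1) ?t"
        using run_mono[OF c'[OF ready_flag[OF s, of "P x y (env s)"], of y], of "b' (length x) + 1"]
        by simp
    next
      assume "\<not> holds (pair_word x y) (Pos 1) ?s"
      then have "?t = ?s" by (simp split: if_splits)
      then show "run (pair_word x y) SKIP ?s (b' (length x) + 1) ?t"
        using run_mono[OF run_SKIP[of "pair_word x y" ?s], of "b' (length x) + 1"] by simp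
    qed
    with c[OF s, of y] show "run (pair_word x y) (SEQ c (IF (Pos 1) c' SKIP)) s
        (b (length x) + Suc (b' (length x) + 1)) ?t"
      by (rule run_SEQ)
  qed
qed

text \<open>The loop counter occupies register \<open>j + 4\<close>, so the body sees an arbitrary value of variable \<open>j + 1\<close>.\<close>

lemma definable_Bex:
  assumes "definable (Suc (Suc j)) (\<lambda>x y e. Q x y e (e j))"
    and indep: "\<And>x y e a b c. Q x y (e(j := a, Suc j := b)) c = Q x y e c"
  shows "definable j (\<lambda>x y e. \<exists>a<length x. Q x y e a)"
proof -
  obtain b c where b: "poly_bounded b" and c: "\<And>x y s. ready (Suc (Suc j)) x s \<Longrightarrow>
      run (pair_word x y) c s (b (length x)) (s(1 := of_bool (Q x y (env s) (env s j))))"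
    using assms(1) by (rule definableE) blast
  let ?v = "j + 3" and ?k = "j + 4"
  let ?body = "SEQ (IF (Pos 1) SKIP c) (INC ?v)"
  show ?thesis
  proof (rule definableI)
    show "poly_bounded (\<lambda>n. 4 + ((n * ((b n + 3) + 9) + 3) + (n * 2 + 1)))"
      using b by (intro poly_bounded_intros)
  next
    fix x y s assume s: "ready j x s"
    let ?w = "pair_word x y" and ?n = "length x"
    define S where "S i = s(1 := of_bool (\<exists>a<i. Q x y (env s) a), ?v := i)" for i
    have S0: "S 0 = s(1 := 0)" using s by (auto simp: S_def ready_def small_def)
    \<comment> \<open>The test \<open>Pos 0\<close> never holds, so this merely clears the
      flag.\<close>
    have 1: "run ?w (SET_FLAG (Pos 0)) s 4 (S 0)"
      using run_SET_FLAG[of s ?w "Pos 0"] s by (simp add: S0 ready_def)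
    have 2: "run ?w (FOR 2 ?k ?body) (S 0) (?n * ((b ?n + 3) + 9) + 3) (S ?n)"
    proof (rule run_FOR)
      fix i assume i: "i < ?n"
      define m where "m = ?n - Suc i"
      have m: "m \<le> ?n" by (simp add: m_def)
      let ?s = "(S i)(?k := m)" and ?t = "(S i)(?k := m, 1 := of_bool (\<exists>a<Suc i. Q x y (env s) a))"
      have env: "env ?s = (env s)(j := i, Suc j := m)"
        by (auto simp: S_def env_def fun_eq_iff)
      have "env s a \<le> ?n" if "a < j" for a
        using s that by (simp add: ready_def small_def)
      then have "env ?s a \<le> ?n" if "a < Suc (Suc j)" for a
        using i m that unfolding env by (auto simp: less_Suc_eq)
      moreover have "?s a = 0" if "a \<ge> Suc (Suc j) + 3" for a
        using s that by (simp add: S_def ready_def small_def)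
      moreover have "?s 0 = 0" "?s 1 \<le> 1" "?s 2 = ?n"
        using s by (simp_all add: S_def ready_def small_def)
      ultimately have "ready (Suc (Suc j)) x ?s" unfolding ready_def small_def by blast
      note c = c[OF this, of y]
      have "Q x y (env ?s) (env ?s j) = Q x y (env s) i"
        unfolding env by (simp add: indep)
      note c = c[unfolded this]
      \<comment> \<open>Once a suitable position has been found, the evaluation is skipped; running
        it again would overwrite the flag.\<close>
      have *: "run ?w (IF (Pos 1) SKIP c) ?s (Suc (b ?n + 1)) ?t"
      proof (rule run_IF)
        assume "holds ?w (Pos 1) ?s"
        then have "\<exists>a<i. Q x y (env s) a" by (simp add: S_def split: if_splits)
        then have "?t = ?s" by (auto simp: S_def fun_eq_iff less_Suc_eq)
        then show "run ?w SKIP ?s (b ?n + 1) ?t"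
          using run_mono[OF run_SKIP[of ?w ?s], of "b ?n + 1"] by simp
      next
        assume "\<not> holds ?w (Pos 1) ?s"
        then have "\<not> (\<exists>a<i. Q x y (env s) a)" by (simp add: S_def split: if_splits)
        then have "(\<exists>a<Suc i. Q x y (env s) a) = Q x y (env s) i" by (auto simp: less_Suc_eq)
        then show "run ?w c ?s (b ?n + 1) ?t"
          using run_mono[OF c, of "b ?n + 1"] by simp
      qed
      have "run ?w ?body ?s (Suc (b ?n + 1) + 1) (?t(?v := Suc (?t ?v)))"
        by (rule run_SEQ[OF * run_INC])
      also have "?t(?v := Suc (?t ?v)) = (S (Suc i))(?k := m)"
        by (auto simp: S_def fun_eq_iff)
      finally have "run ?w ?body ?s (Suc (b ?n + 1) + 1) ((S (Suc i))(?k := m))" .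
      then show "run ?w ?body ((S i)(?k := ?n - Suc i)) (b ?n + 3) ((S (Suc i))(?k := ?n - Suc i))"
        unfolding m_def[symmetric] by (rule run_mono) simp
    qed (use s in \<open>auto simp: S_def ready_def small_def\<close>)
    have 3: "run ?w (WHILE (Pos ?v) (DEC ?v)) (S ?n) (?n * 2 + 1)
        (s(1 := of_bool (\<exists>a<?n. Q x y (env s) a)))"
    proof -
      have "(S ?n)(?v := 0) = s(1 := of_bool (\<exists>a<?n. Q x y (env s) a))"
        using s by (auto simp: S_def ready_def small_def fun_eq_iff)
      moreover have "S ?n ?v = ?n" by (simp add: S_def)
      ultimately show ?thesis using run_clear[of ?v ?w "S ?n"] by simp
    qed
    show "run ?w (SEQ (SET_FLAG (Pos 0)) (SEQ (FOR 2 ?k ?body) (WHILE (Pos ?v) (DEC ?v)))) s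
       (4 + ((?n * ((b ?n + 3) + 9) + 3) + (?n * 2 + 1)))
       (s(1 := of_bool (\<exists>a<?n. Q x y (env s) a)))"
      by (intro run_SEQ[OF 1] run_SEQ[OF 2] 3)
  qed
qed

lemma eterm_program:
  assumes "eterm j T"
  obtains b c where "poly_bounded b"
    and "\<And>x y e. (\<forall>i<j. e i \<le> length x) \<Longrightarrow> T x y e \<le> b (length x)"
    and "\<And>r k x y s. j + 3 \<le> r \<Longrightarrow> r < k \<Longrightarrow> small j k x s \<Longrightarrow>
      run (pair_word x y) (c r k) s (b (length x)) (s(r := s r + T x y (env s)))"
proof -
  obtain b where b: "poly_bounded b"
    "\<And>x y e. (\<forall>i<j. e i \<le> length x) \<Longrightarrow> T x y e \<le> b (length x)"
    and c: "\<And>r k. j + 3 \<le> r \<Longrightarrow> r < k \<Longrightarrow> \<exists>c. \<forall>x y s. small j k x s \<longrightarrow>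
          run (pair_word x y) c s (b (length x)) (s(r := s r + T x y (env s)))"
    using assms unfolding eterm_def by blast
  have "\<exists>c. j + 3 \<le> r \<longrightarrow> r < k \<longrightarrow> (\<forall>x y s. small j k x s \<longrightarrow>
          run (pair_word x y) c s (b (length x)) (s(r := s r + T x y (env s))))" for r k
    using c[of r k] by blast
  then obtain c where "\<And>r k. j + 3 \<le> r \<longrightarrow> r < k \<longrightarrow> (\<forall>x y s. small j k x s \<longrightarrow>
          run (pair_word x y) (c r k) s (b (length x)) (s(r := s r + T x y (env s))))"
    by metis
  with b show ?thesis by (intro that[of b c]) blast+
qed

text \<open>Truncated subtraction: lowering both values as often as \<open>T\<close> says leaves
  \<open>U - T\<close> in register \<open>j + 4\<close>, and this is nonzero exactly if
  \<open>T < U\<close>.\<close>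

lemma definable_less:
  assumes "eterm j T" "eterm j U"
  shows "definable j (\<lambda>x y e. T x y e < U x y e)"
proof -
  obtain b c where b: "poly_bounded b"
    "\<And>x y e. (\<forall>i<j. e i \<le> length x) \<Longrightarrow> T x y e \<le> b (length x)"
    and c: "\<And>r k x y s. j + 3 \<le> r \<Longrightarrow> r < k \<Longrightarrow> small j k x s \<Longrightarrow>
      run (pair_word x y) (c r k) s (b (length x)) (s(r := s r + T x y (env s)))"
    using assms(1) by (rule eterm_program) blast
  obtain b' c' where b': "poly_bounded b'"
    "\<And>x y e. (\<forall>i<j. e i \<le> length x) \<Longrightarrow> U x y e \<le> b' (length x)"
    and c': "\<And>r k x y s. j + 3 \<le> r \<Longrightarrow> r < k \<Longrightarrow> small j k x s \<Longrightarrow>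
      run (pair_word x y) (c' r k) s (b' (length x)) (s(r := s r + U x y (env s)))"
    using assms(2) by (rule eterm_program) blast
  let ?p = "j + 3" and ?q = "j + 4"
  let ?loop = "WHILE (Pos ?p) (SEQ (DEC ?p) (IF (Pos ?q) (DEC ?q) SKIP))"
  let ?clear = "WHILE (Pos ?q) (DEC ?q)"
  show ?thesis
  proof (rule definableI)
    show "poly_bounded (\<lambda>n. b n + (b' n + ((b n * 4 + 1) + (4 + (b' n * 2 + 1)))))"
      using b b' by (intro poly_bounded_intros)
  next
    fix x y s assume s: "ready j x s"
    let ?w = "pair_word x y" and ?n = "length x"
    define m n where "m = T x y (env s)" and "n = U x y (env s)"
    have dep: "depends j U" using assms(2) by (simp add: eterm_def)
    have small: "small j (j + 5) x s" using s by (auto simp: ready_def small_def)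
    have mn: "m \<le> b ?n" "n \<le> b' ?n"
      using b(2) b'(2) small unfolding m_def n_def small_def by blast+
    have "s ?p = 0" "s ?q = 0" using s by (simp_all add: ready_def small_def)
    then have 1: "run ?w (c ?p (j + 5)) s (b ?n) (s(?p := m))"
      using c[OF _ _ small, of ?p y] by (simp add: m_def)
    have "small j (j + 5) x (s(?p := m))" using small by simp
    from c'[OF _ _ this, of ?q y] have 2: "run ?w (c' ?q (j + 5)) (s(?p := m)) (b' ?n) (s(?p := m, ?q := n))"
      using \<open>s ?q = 0\<close> depends_upd[OF dep, of ?p x y s m] by (simp add: n_def)
    define S where "S i = s(?p := m - i, ?q := n - i)" for i
    have 3: "run ?w ?loop (S 0) (m * Suc 3 + 1) (S m)"
    proof (rule run_WHILE)
      fix i assume i: "i < m"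
      define s' where "s' = (S i)(?p := S i ?p - 1)"
      have "run ?w (DEC ?p) (S i) 1 s'"
        unfolding s'_def using i by (intro run_DEC) (simp add: S_def)
      moreover have "run ?w (IF (Pos ?q) (DEC ?q) SKIP) s' (Suc 1) (S (Suc i))"
      proof (rule run_IF)
        assume "holds ?w (Pos ?q) s'"
        moreover have "s'(?q := s' ?q - 1) = S (Suc i)"
          by (auto simp: s'_def S_def fun_eq_iff)
        ultimately show "run ?w (DEC ?q) s' 1 (S (Suc i))"
          using run_DEC[of s' ?q ?w] by simp
      next
        assume "\<not> holds ?w (Pos ?q) s'"
        then have "s' = S (Suc i)"
          by (auto simp: s'_def S_def fun_eq_iff)
        then show "run ?w SKIP s' 1 (S (Suc i))"
          using run_SKIP[of ?w s'] by simp
      qed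
      ultimately have "run ?w (SEQ (DEC ?p) (IF (Pos ?q) (DEC ?q) SKIP)) (S i) (1 + Suc 1) (S (Suc i))"
        by (rule run_SEQ)
      then have "run ?w (SEQ (DEC ?p) (IF (Pos ?q) (DEC ?q) SKIP)) (S i) 3 (S (Suc i))"
        by (rule run_mono) simp
      moreover have "holds ?w (Pos ?p) (S i)" using i by (simp add: S_def)
      ultimately show "holds ?w (Pos ?p) (S i) \<and>
        run ?w (SEQ (DEC ?p) (IF (Pos ?q) (DEC ?q) SKIP)) (S i) 3 (S (Suc i))" by blast
    qed (simp add: S_def)
    have S0: "S 0 = s(?p := m, ?q := n)" by (simp add: S_def)
    have 4: "run ?w (SET_FLAG (Pos ?q)) (S m) 4 ((S m)(1 := of_bool (m < n)))"
      using run_SET_FLAG[of "S m" ?w "Pos ?q"] s by (simp add: S_def ready_def)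
    have "run ?w ?clear ((S m)(1 := of_bool (m < n))) ((n - m) * 2 + 1)
        ((S m)(1 := of_bool (m < n), ?q := 0))"
      using run_clear[of ?q ?w "(S m)(1 := of_bool (m < n))"] by (simp add: S_def)
    moreover have "(S m)(1 := of_bool (m < n), ?q := 0) = s(1 := of_bool (m < n))"
      using \<open>s ?p = 0\<close> \<open>s ?q = 0\<close> by (auto simp: S_def fun_eq_iff)
    ultimately have 5: "run ?w ?clear ((S m)(1 := of_bool (m < n))) ((n - m) * 2 + 1)
        (s(1 := of_bool (m < n)))" by simp
    have "run ?w (SEQ (c ?p (j + 5)) (SEQ (c' ?q (j + 5)) (SEQ ?loop (SEQ (SET_FLAG (Pos ?q)) ?clear)))) s
        (b ?n + (b' ?n + ((m * Suc 3 + 1) + (4 + ((n - m) * 2 + 1))))) (s(1 := of_bool (m < n)))"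
      by (intro run_SEQ[OF 1] run_SEQ[OF 2] run_SEQ[OF 3[unfolded S0]] run_SEQ[OF 4] 5)
    then show "run ?w (SEQ (c ?p (j + 5)) (SEQ (c' ?q (j + 5)) (SEQ ?loop (SEQ (SET_FLAG (Pos ?q)) ?clear)))) s
        (b ?n + (b' ?n + ((b ?n * 4 + 1) + (4 + (b' ?n * 2 + 1)))))
        (s(1 := of_bool (T x y (env s) < U x y (env s))))"
      unfolding m_def[symmetric] n_def[symmetric]
      by (rule run_mono) (use mn in simp)
  qed
qed

text \<open>The head is sent to position \<open>T\<close>, the symbol is tested, and the head is
  brought back. Register 0 cannot be tested for zero, so a copy of the distance is kept in register
  \<open>j + 4\<close> to control the way back.\<close>

lemma definable_sym:
  assumes "eterm j T"
  shows "definable j (\<lambda>x y e. sym (pair_word x y) (T x y e) = a)"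
proof -
  obtain b c where b: "poly_bounded b"
    "\<And>x y e. (\<forall>i<j. e i \<le> length x) \<Longrightarrow> T x y e \<le> b (length x)"
    and c: "\<And>r k x y s. j + 3 \<le> r \<Longrightarrow> r < k \<Longrightarrow> small j k x s \<Longrightarrow>
      run (pair_word x y) (c r k) s (b (length x)) (s(r := s r + T x y (env s)))"
    using assms by (rule eterm_program) blast
  let ?p = "j + 3" and ?q = "j + 4"
  let ?forth = "WHILE (Pos ?p) (SEQ (DEC ?p) (SEQ (INC 0) (INC ?q)))"
  let ?back = "WHILE (Pos ?q) (SEQ (DEC ?q) (DEC 0))"
  show ?thesis
  proof (rule definableI)
    show "poly_bounded (\<lambda>n. b n + ((b n * 4 + 1) + (4 + (b n * 3 + 1))))"
      using b by (intro poly_bounded_intros)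
  next
    fix x y s assume s: "ready j x s"
    let ?w = "pair_word x y" and ?n = "length x"
    define m where "m = T x y (env s)"
    define f :: nat where "f = of_bool (sym ?w m = a)"
    have small: "small j (j + 5) x s" using s by (auto simp: ready_def small_def)
    have m: "m \<le> b ?n"
      using b(2) small unfolding m_def small_def by blast
    have z: "s ?p = 0" "s ?q = 0" "s 0 = 0" using s by (simp_all add: ready_def small_def)
    then have 1: "run ?w (c ?p (j + 5)) s (b ?n) (s(?p := m))"
      using c[OF _ _ small, of ?p y] by (simp add: m_def)
    define S where "S i = s(?p := m - i, 0 := i, ?q := i)" for i
    have 2: "run ?w ?forth (S 0) (m * Suc 3 + 1) (S m)"
    proof (rule run_WHILE)
      fix i assume i: "i < m"
      define s1 where "s1 = (S i)(?p := S i ?p - 1)"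
      define s2 where "s2 = s1(0 := Suc (s1 0))"
      have "s2(?q := Suc (s2 ?q)) = S (Suc i)"
        by (auto simp: s1_def s2_def S_def fun_eq_iff)
      then have "run ?w (INC ?q) s2 1 (S (Suc i))" using run_INC[of ?w ?q s2] by simp
      moreover have "run ?w (INC 0) s1 1 s2" unfolding s2_def by (rule run_INC)
      moreover have "run ?w (DEC ?p) (S i) 1 s1"
        unfolding s1_def using i by (intro run_DEC) (simp add: S_def)
      ultimately have "run ?w (SEQ (DEC ?p) (SEQ (INC 0) (INC ?q))) (S i) (1 + (1 + 1)) (S (Suc i))"
        by (intro run_SEQ)
      then have "run ?w (SEQ (DEC ?p) (SEQ (INC 0) (INC ?q))) (S i) 3 (S (Suc i))"
        by (rule run_mono) simp
      moreover have "holds ?w (Pos ?p) (S i)" using i by (simp add: S_def)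
      ultimately show "holds ?w (Pos ?p) (S i) \<and>
        run ?w (SEQ (DEC ?p) (SEQ (INC 0) (INC ?q))) (S i) 3 (S (Suc i))" by blast
    qed (simp add: S_def)
    have S0: "S 0 = s(?p := m)" using z by (auto simp: S_def fun_eq_iff)
    have 3: "run ?w (SET_FLAG (Reads a)) (S m) 4 ((S m)(1 := f))"
      using run_SET_FLAG[of "S m" ?w "Reads a"] s by (simp add: S_def ready_def f_def)
    define B where "B i = s(1 := f, 0 := m - i, ?q := m - i)" for i
    have 4: "run ?w ?back (B 0) (m * Suc 2 + 1) (B m)"
    proof (rule run_WHILE)
      fix i assume i: "i < m"
      define s1 where "s1 = (B i)(?q := B i ?q - 1)"
      have "s1(0 := s1 0 - 1) = B (Suc i)"
        by (auto simp: s1_def B_def fun_eq_iff)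
      moreover have "0 < s1 0" using i by (simp add: s1_def B_def)
      ultimately have "run ?w (DEC 0) s1 1 (B (Suc i))" using run_DEC[of s1 0 ?w] by simp
      moreover have "run ?w (DEC ?q) (B i) 1 s1"
        unfolding s1_def using i by (intro run_DEC) (simp add: B_def)
      ultimately have "run ?w (SEQ (DEC ?q) (DEC 0)) (B i) (1 + 1) (B (Suc i))"
        by (intro run_SEQ)
      then have "run ?w (SEQ (DEC ?q) (DEC 0)) (B i) 2 (B (Suc i))"
        by (rule run_mono) simp
      moreover have "holds ?w (Pos ?q) (B i)" using i by (simp add: B_def)
      ultimately show "holds ?w (Pos ?q) (B i) \<and>
        run ?w (SEQ (DEC ?q) (DEC 0)) (B i) 2 (B (Suc i))" by blast
    qed (simp add: B_def)
    have B: "(S m)(1 := f) = B 0" "B m = s(1 := f)"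
      using z by (auto simp: S_def B_def fun_eq_iff)
    have "run ?w (SEQ (c ?p (j + 5)) (SEQ ?forth (SEQ (SET_FLAG (Reads a)) ?back))) s
        (b ?n + ((m * Suc 3 + 1) + (4 + (m * Suc 2 + 1)))) (B m)"
      by (intro run_SEQ[OF 1] run_SEQ[OF 2[unfolded S0]] run_SEQ[OF 3[unfolded B]] 4)
    then show "run ?w (SEQ (c ?p (j + 5)) (SEQ ?forth (SEQ (SET_FLAG (Reads a)) ?back))) s
        (b ?n + ((b ?n * 4 + 1) + (4 + (b ?n * 3 + 1))))
        (s(1 := of_bool (sym ?w (T x y (env s)) = a)))"
      unfolding m_def[symmetric] f_def[symmetric] B
      by (rule run_mono) (use m in simp)
  qed
qed

section \<open>From definable relations to polynomial time\<close>

lemma poly_nat_mono: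
  fixes p :: "nat poly"
  shows "m \<le> n \<Longrightarrow> poly p m \<le> poly p n"
  by (induction p) (auto intro: add_mono mult_le_mono)

lemma sym_pair_word:
  "sym (pair_word x y) p =
    (if p < length x then bit_symbol (x ! p) else if p = length x then 3
     else if p < length x + 1 + length y then bit_symbol (y ! (p - length x - 1)) else 0)"
  by (auto simp: sym_def pair_word_def nth_append nth_Cons')

text \<open>Evaluation presupposes \<open>length x\<close> in register 2. The program finds it by
  moving right and counting until the separator 3 is read, and then takes the head back by the same
  number of cells.\<close>

lemma poly_time_decidable_definable:
  assumes "definable 0 P"
  shows "poly_time_decidable (\<lambda>x y. P x y (\<lambda>_. 0))"
proof -
  obtain b c where b: "poly_bounded b" and c: "\<And>x y s. ready 0 x s \<Longrightarrow>
      run (pair_word x y) c s (b (length x)) (s(1 := of_bool (P x y (env s))))"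
    using assms by (rule definableE) blast
  have "poly_bounded (\<lambda>n. 1 + ((Suc n * 5 + 1) + ((n * (1 + 9) + 3) + b n)))"
    using b poly_bounded_add[OF poly_bounded_id poly_bounded_const[of 1]]
    by (intro poly_bounded_intros) simp_all
  then obtain p :: "nat poly" where
    p: "\<And>n. 1 + ((Suc n * 5 + 1) + ((n * (1 + 9) + 3) + b n)) \<le> poly p n"
    unfolding poly_bounded_def by blast
  let ?scan_body = "IF (Reads 3) (DEC 1) (SEQ (INC 0) (INC 2))"
  let ?scan = "WHILE (Pos 1) ?scan_body"
  let ?prog = "SEQ (INC 1) (SEQ ?scan (SEQ (FOR 2 3 (DEC 0)) c))"
  show ?thesis
  proof (rule poly_time_decidableI)
    fix x y
    let ?w = "pair_word x y" and ?n = "length x"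
    \<comment> \<open>Register 1 controls the scan. There is one round more than \<open>?n\<close>:
      in the last one the head stands on the separator and only register 1 is cleared.\<close>
    define S :: "nat \<Rightarrow> regs" where
      "S i = (if i \<le> ?n then (\<lambda>_. 0)(1 := 1, 0 := i, 2 := i) else (\<lambda>_. 0)(0 := ?n, 2 := ?n))" for i
    have "(\<lambda>_. 0)(1 := Suc 0) = S 0" by (auto simp: S_def fun_eq_iff)
    then have 1: "run ?w (INC 1) (\<lambda>_. 0) 1 (S 0)" using run_INC[of ?w 1 "\<lambda>_. 0"] by simp
    have 2: "run ?w ?scan (S 0) (Suc ?n * Suc 4 + 1) (S (Suc ?n))"
    proof (rule run_WHILE)
      fix i assume i: "i < Suc ?n"
      have "run ?w ?scan_body (S i) (Suc 2) (S (Suc i))"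
      proof (rule run_IF)
        assume "holds ?w (Reads 3) (S i)"
        then have "i = ?n" using i by (auto simp: S_def sym_pair_word bit_symbol_def split: if_splits)
        then have "(S i)(1 := S i 1 - 1) = S (Suc i)" "0 < S i 1" by (auto simp: S_def fun_eq_iff)
        then show "run ?w (DEC 1) (S i) 2 (S (Suc i))"
          using run_mono[OF run_DEC[of "S i" 1 ?w], of 2] by simp
      next
        assume "\<not> holds ?w (Reads 3) (S i)"
        then have "i < ?n" using i by (cases "i = ?n") (auto simp: S_def sym_pair_word)
        then have "((S i)(0 := Suc (S i 0)))(2 := Suc (((S i)(0 := Suc (S i 0))) 2)) = S (Suc i)"
          by (auto simp: S_def fun_eq_iff)
        then have "run ?w (SEQ (INC 0) (INC 2)) (S i) (1 + 1) (S (Suc i))"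
          using run_SEQ[OF run_INC[of ?w 0 "S i"] run_INC[of ?w 2 "(S i)(0 := Suc (S i 0))"]] by simp
        then show "run ?w (SEQ (INC 0) (INC 2)) (S i) 2 (S (Suc i))"
          by (rule run_mono) simp
      qed
      then have "run ?w ?scan_body (S i) 4 (S (Suc i))" by (rule run_mono) simp
      moreover have "holds ?w (Pos 1) (S i)" using i by (simp add: S_def)
      ultimately show "holds ?w (Pos 1) (S i) \<and> run ?w ?scan_body (S i) 4 (S (Suc i))" by blast
    qed (simp add: S_def)
    define B :: "nat \<Rightarrow> regs" where "B i = (\<lambda>_. 0)(0 := ?n - i, 2 := ?n)" for i
    have 3: "run ?w (FOR 2 3 (DEC 0)) (B 0) (?n * (1 + 9) + 3) (B ?n)"
    proof (rule run_FOR)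
      fix i assume i: "i < ?n"
      let ?s = "(B i)(3 := ?n - Suc i)"
      have "?s(0 := ?s 0 - 1) = (B (Suc i))(3 := ?n - Suc i)" "0 < ?s 0"
        using i by (auto simp: B_def fun_eq_iff)
      then show "run ?w (DEC 0) ?s 1 ((B (Suc i))(3 := ?n - Suc i))"
        using run_DEC[of ?s 0 ?w] by simp
    qed (auto simp: B_def)
    have SB: "S (Suc ?n) = B 0" by (auto simp: S_def B_def)
    have rdy: "ready 0 x (B ?n)" by (simp add: ready_def small_def B_def)
    have env: "env (B ?n) = (\<lambda>_. 0)" by (auto simp: env_def B_def)
    have "run ?w ?prog (\<lambda>_. 0) (1 + ((Suc ?n * Suc 4 + 1) + ((?n * (1 + 9) + 3) + b ?n)))
        ((B ?n)(1 := of_bool (P x y (\<lambda>_. 0))))"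
      by (intro run_SEQ[OF 1] run_SEQ[OF 2[unfolded SB]] run_SEQ[OF 3] c[OF rdy, of y, unfolded env])
    then obtain t where t: "t \<le> 1 + ((Suc ?n * Suc 4 + 1) + ((?n * (1 + 9) + 3) + b ?n))"
      "exec ?w ?prog (\<lambda>_. 0) t ((B ?n)(1 := of_bool (P x y (\<lambda>_. 0))))"
      unfolding run_def by blast
    have "t \<le> poly p ?n" using t(1) p[of ?n] by simp
    also have "\<dots> \<le> poly p (length ?w)" by (rule poly_nat_mono) (simp add: pair_word_def)
    finally show "\<exists>t s. exec ?w ?prog (\<lambda>_. 0) t s \<and> t \<le> poly p (length ?w) \<and>
        (0 < s 1 \<longleftrightarrow> P x y (\<lambda>_. 0))"
      using t(2) by (intro exI[of _ t] exI[of _ "(B ?n)(1 := of_bool (P x y (\<lambda>_. 0)))"]) simp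
  qed
qed

section \<open>Linear extensions and their greedy chains\<close>

definition lext :: "('a \<Rightarrow> 'a \<Rightarrow> bool) \<Rightarrow> 'a set \<Rightarrow> 'a list set" where
  "lext lt A = {L. distinct L \<and> set L = A \<and> sorted_wrt (\<lambda>a b. \<not> lt b a) L}"

fun chain :: "('a \<Rightarrow> 'a \<Rightarrow> bool) \<Rightarrow> 'a list \<Rightarrow> 'a set" where
  "chain lt [] = {}"
| "chain lt [c] = {c}"
| "chain lt (c # y # r) = (if lt c y then insert c (chain lt (y # r)) else chain lt (c # r))"

text \<open>This is Schuetzenberger's promotion (jeu de taquin) stopped at \<open>x\<close>. The
  head \<open>c\<close> is carried past elements that are not above it and put down in front of the
  first one that is, which is then carried in its place. Only for \<open>x\<close> on the chain is
  it \<open>x\<close> that gets lost; otherwise the last equation drops the element carried to the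
  end.\<close>

fun slide :: "('a \<Rightarrow> 'a \<Rightarrow> bool) \<Rightarrow> 'a \<Rightarrow> 'a list \<Rightarrow> 'a list" where
  "slide lt x (c # y # r) =
     (if c = x then y # r else if lt c y then c # slide lt x (y # r) else y # slide lt x (c # r))"
| "slide lt x L = []"

text \<open>The reverse movement, from the end of the list: the head of
  \<open>unslide lt x zs\<close> is the element being carried, and it passes \<open>z\<close> unless
  \<open>z\<close> lies below it, in which case \<open>z\<close> is carried on. The inner case
  \<open>[]\<close> never arises, since the result always contains \<open>x\<close>.\<close>

fun unslide :: "('a \<Rightarrow> 'a \<Rightarrow> bool) \<Rightarrow> 'a \<Rightarrow> 'a list \<Rightarrow> 'a list" where
  "unslide lt x [] = [x]"
| "unslide lt x (z # zs) =
     (case unslide lt x zs of c # r \<Rightarrow> if lt z c then z # c # r else c # z # r | [] \<Rightarrow> [])"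

lemma chain_subset: "chain lt L \<subseteq> set L"
  by (induction lt L rule: chain.induct) auto

lemma hd_in_chain: "c \<in> chain lt (c # r)"
  by (induction r) auto

lemma chain_above:
  "transp lt \<Longrightarrow> a \<in> chain lt (c # r) \<Longrightarrow> a = c \<or> lt c a"
proof (induction lt "c # r" arbitrary: c r rule: chain.induct)
  case (3 lt c y r)
  then show ?case by (auto split: if_splits dest: transpD[OF \<open>transp lt\<close>])
qed auto

lemma chain_comparable:
  "transp lt \<Longrightarrow> a \<in> chain lt L \<Longrightarrow> b \<in> chain lt L \<Longrightarrow> a = b \<or> lt a b \<or> lt b a"
proof (induction lt L rule: chain.induct)
  case (3 lt c y r)
  have "c = d \<or> lt c d" if "d \<in> chain lt (c # y # r)" for d
    using chain_above[OF 3(3) that] by blast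
  then show ?case using 3 by (auto split: if_splits)
qed auto

lemma mset_slide: "x \<in> chain lt L \<Longrightarrow> add_mset x (mset (slide lt x L)) = mset L"
  by (induction lt x L rule: slide.induct) (auto split: if_splits)

lemma mset_unslide: "mset (unslide lt x L) = add_mset x (mset L)"
  by (induction L) (auto split: list.splits)

lemma unslide_Cons: obtains c r where "unslide lt x L = c # r"
  using mset_unslide[of lt x L] by (cases "unslide lt x L") auto

abbreviation lsorted :: "('a \<Rightarrow> 'a \<Rightarrow> bool) \<Rightarrow> 'a list \<Rightarrow> bool" where
  "lsorted lt \<equiv> sorted_wrt (\<lambda>a b. \<not> lt b a)"

lemma set_slide:
  assumes "x \<in> chain lt L"
  shows "set L = insert x (set (slide lt x L))"
  using mset_slide[OF assms] by (metis set_mset_add_mset_insert set_mset_mset)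

lemma set_unslide: "set (unslide lt x L) = insert x (set L)"
  using mset_unslide[of lt x L] by (metis set_mset_add_mset_insert set_mset_mset)

lemma lsorted_slide: "lsorted lt L \<Longrightarrow> x \<in> chain lt L \<Longrightarrow> lsorted lt (slide lt x L)"
proof (induction lt x L rule: slide.induct)
  case (1 lt x c y r)
  show ?case
  proof (cases "c = x")
    case False
    show ?thesis
    proof (cases "lt c y")
      case True
      then have x: "x \<in> chain lt (y # r)" using 1 False by auto
      have "set (slide lt x (y # r)) \<subseteq> set (y # r)" using set_slide[OF x] by auto
      then show ?thesis using 1 True False x by auto
    next
      case nlt: False
      then have x: "x \<in> chain lt (c # r)" using 1 False by auto
      have "set (slide lt x (c # r)) \<subseteq> set (c # r)" using set_slide[OF x] by auto
      then show ?thesis using 1 nlt False x by auto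
    qed
  qed (use 1 in auto)
qed auto

lemma unslide_last: "(\<And>z. z \<in> set L \<Longrightarrow> \<not> lt z x) \<Longrightarrow> unslide lt x L = x # L"
  by (induction L) auto

lemma unslide_slide:
  "lsorted lt L \<Longrightarrow> x \<in> chain lt L \<Longrightarrow> unslide lt x (slide lt x L) = L"
proof (induction lt x L rule: slide.induct)
  case (1 lt x c y r)
  show ?case
  proof (cases "c = x")
    case True
    \<comment> \<open>In a sorted list nothing behind \<open>x\<close> lies below it, so the
      reinserted \<open>x\<close> travels back all the way to the front.\<close>
    then show ?thesis using 1 unslide_last[of "y # r" lt x] by auto
  next
    case False
    then show ?thesis using 1 by (cases "lt c y") auto
  qed
qed auto

lemma slide_hd: "slide lt x (x # r) = r"
  by (cases r) auto

lemma slide_unslide: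
  "lsorted lt L \<Longrightarrow> x \<notin> set L \<Longrightarrow>
     x \<in> chain lt (unslide lt x L) \<and> slide lt x (unslide lt x L) = L"
proof (induction L)
  case (Cons z zs)
  obtain c r where cr: "unslide lt x zs = c # r" by (rule unslide_Cons)
  have IH: "x \<in> chain lt (c # r)" "slide lt x (c # r) = zs" using Cons cr by auto
  have c: "c = x \<or> c \<in> set zs" using set_unslide[of lt x zs] cr by auto
  show ?case
  proof (cases "lt z c")
    case True
    then show ?thesis using Cons cr IH by auto
  next
    case False
    show ?thesis
    proof (cases "c = x")
      case True
      then show ?thesis using False cr IH by (simp add: slide_hd hd_in_chain)
    next
      case cx: False
      \<comment> \<open>As \<open>c\<close> stands behind \<open>z\<close> in the sorted list it is
        not below \<open>z\<close>, so \<open>slide\<close> carries it past \<open>z\<close>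
        again.\<close>
      then have "\<not> lt c z" using c Cons by auto
      then show ?thesis using False cr IH cx by simp
    qed
  qed
qed simp

text \<open>Only \<open>x\<close> can cause a new inversion. Since \<open>x\<close> is on the chain
  that starts at the head \<open>c\<close>, it lies weakly above \<open>c\<close>. Hence
  \<open>lt z c\<close> yields \<open>lt z x\<close>, and \<open>x\<close> may stay behind
  \<open>z\<close>; and if \<open>x\<close> differs from \<open>c\<close> and were below
  \<open>z\<close>, then so would be \<open>c\<close>, contradicting the order of the given
  list.\<close>

lemma lsorted_unslide:
  assumes "irreflp lt" "transp lt"
  shows "lsorted lt L \<Longrightarrow> x \<notin> set L \<Longrightarrow> lsorted lt (unslide lt x L)"
proof (induction L)
  case (Cons z zs)
  obtain c r where cr: "unslide lt x zs = c # r" by (rule unslide_Cons)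
  have sorted: "lsorted lt (c # r)" using Cons cr by auto
  have set: "set (c # r) = insert x (set zs)" using set_unslide[of lt x zs] cr by auto
  have "x \<in> chain lt (c # r)" using slide_unslide[of lt zs x] Cons.prems cr by simp
  then have x: "x = c \<or> lt c x" using chain_above[OF assms(2)] by blast
  have asym: "lt a b \<Longrightarrow> \<not> lt b a" for a b using assms by (meson irreflpD transpD)
  have z: "\<not> lt b z" if "b \<in> set zs" for b using Cons.prems that by simp
  show ?case
  proof (cases "lt z c")
    case True
    then have "lt z x" using x assms(2) by (auto dest: transpD)
    then have "\<not> lt b z" if "b \<in> set (c # r)" for b using that asym z unfolding set by auto
    then show ?thesis using True cr sorted by simp
  next
    case False
    have "\<not> lt b z" if "b \<in> set r" for b
    proof (cases "b = x")
      case True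
      show ?thesis
      proof
        assume "lt b z"
        show False
        proof (cases "c = x")
          case True
          then have "lt x z" using \<open>lt b z\<close> \<open>b = x\<close> by simp
          have "x \<notin> set r"
            using arg_cong[OF cr, of mset] Cons.prems True by (auto simp: mset_unslide dest: mset_eq_setD)
          then show False using that \<open>b = x\<close> by simp
        next
          case False
          then have "c \<in> set zs" using set by auto
          moreover have "lt c z" using x False \<open>b = x\<close> \<open>lt b z\<close> transpD[OF assms(2)] by blast
          ultimately show False using z by blast
        qed
      qed
    qed (use that set z in auto)
    then show ?thesis using False cr sorted by simp
  qed
qed simp

lemma card_lext_chain:
  assumes "irreflp lt" "transp lt" "x \<in> A"
  shows "card {L \<in> lext lt A. x \<in> chain lt L} = card (lext lt (A - {x}))"
proof (rule bij_betw_same_card, rule bij_betwI)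
  show "slide lt x \<in> {L \<in> lext lt A. x \<in> chain lt L} \<rightarrow> lext lt (A - {x})"
  proof
    fix L assume "L \<in> {L \<in> lext lt A. x \<in> chain lt L}"
    then have L: "distinct L" "set L = A" "lsorted lt L" "x \<in> chain lt L" by (auto simp: lext_def)
    have "mset L = mset (x # slide lt x L)" using mset_slide[OF L(4)] by simp
    then have "distinct (x # slide lt x L)" "set (x # slide lt x L) = A"
      using L(1,2) mset_eq_imp_distinct_iff mset_eq_setD by blast+
    then show "slide lt x L \<in> lext lt (A - {x})"
      using lsorted_slide[OF L(3,4)] by (auto simp: lext_def)
  qed
  show "unslide lt x \<in> lext lt (A - {x}) \<rightarrow> {L \<in> lext lt A. x \<in> chain lt L}"
  proof
    fix L assume "L \<in> lext lt (A - {x})"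
    then have L: "distinct (x # L)" "set (x # L) = A" "lsorted lt L" "x \<notin> set L"
      using assms(3) by (auto simp: lext_def)
    have "mset (unslide lt x L) = mset (x # L)" by (simp add: mset_unslide)
    then have "distinct (unslide lt x L)" "set (unslide lt x L) = A"
      using L(1,2) mset_eq_imp_distinct_iff mset_eq_setD by blast+
    then show "unslide lt x L \<in> {L \<in> lext lt A. x \<in> chain lt L}"
      using lsorted_unslide[OF assms(1,2) L(3,4)] slide_unslide[OF L(3,4)] by (auto simp: lext_def)
  qed
  show "unslide lt x (slide lt x L) = L" if "L \<in> {L \<in> lext lt A. x \<in> chain lt L}" for L
    using that by (auto simp: lext_def intro: unslide_slide)
  show "slide lt x (unslide lt x L) = L" if "L \<in> lext lt (A - {x})" for L
    using that slide_unslide[of lt L x] by (auto simp: lext_def)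
qed

lemma finite_lext: "finite A \<Longrightarrow> finite (lext lt A)"
  by (rule finite_subset[OF _ finite_subset_distinct[of A]]) (auto simp: lext_def)

section \<open>The recursion for the product of the two counts\<close>

definition disjoint_chains :: "('a \<Rightarrow> 'a \<Rightarrow> bool) \<Rightarrow> ('a \<Rightarrow> 'a \<Rightarrow> bool) \<Rightarrow> 'a set \<Rightarrow> ('a list \<times> 'a list) set" where
  "disjoint_chains lt1 lt2 A =
     {(L1, L2). L1 \<in> lext lt1 A \<and> L2 \<in> lext lt2 A \<and> chain lt1 L1 \<inter> chain lt2 L2 = {}}"

definition witnesses :: "('a \<Rightarrow> 'a \<Rightarrow> bool) \<Rightarrow> ('a \<Rightarrow> 'a \<Rightarrow> bool) \<Rightarrow> 'a set \<Rightarrow> ('a list \<times> 'a list \<times> 'a list) set" where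
  "witnesses lt1 lt2 A =
     {(X, L1, L2). distinct X \<and> set X \<subset> A \<and> (L1, L2) \<in> disjoint_chains lt1 lt2 (A - set X)}"

lemma finite_disjoint_chains: "finite A \<Longrightarrow> finite (disjoint_chains lt1 lt2 A)"
  by (rule finite_subset[of _ "lext lt1 A \<times> lext lt2 A"]) (auto simp: disjoint_chains_def finite_lext)

lemma finite_witnesses:
  assumes "finite A"
  shows "finite (witnesses lt1 lt2 A)"
proof -
  have "witnesses lt1 lt2 A \<subseteq> (SIGMA X:{X. set X \<subseteq> A \<and> distinct X}. disjoint_chains lt1 lt2 (A - set X))"
    by (auto simp: witnesses_def)
  then show ?thesis
    using assms by (auto intro!: finite_subset[of "witnesses lt1 lt2 A"] finite_SigmaI finite_disjoint_chains
        finite_subset_distinct)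
qed

context
  fixes lt1 lt2 :: "'a \<Rightarrow> 'a \<Rightarrow> bool"
  assumes lt1: "irreflp lt1" "transp lt1" and lt2: "irreflp lt2" "transp lt2"
    and excl: "\<And>a b. lt1 a b \<Longrightarrow> \<not> lt2 a b \<and> \<not> lt2 b a"
begin

lemma card_lext_product:
  assumes "finite A"
  shows "card (lext lt1 A) * card (lext lt2 A) = card (disjoint_chains lt1 lt2 A) +
    (\<Sum>x\<in>A. card (lext lt1 (A - {x})) * card (lext lt2 (A - {x})))"
proof -
  define M where "M x = {L \<in> lext lt1 A. x \<in> chain lt1 L} \<times> {L \<in> lext lt2 A. x \<in> chain lt2 L}" for x
  have split: "lext lt1 A \<times> lext lt2 A = disjoint_chains lt1 lt2 A \<union> (\<Union>x\<in>A. M x)"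
    using chain_subset by (fastforce simp: disjoint_chains_def M_def lext_def)
  have fin: "finite (M x)" for x
    unfolding M_def using finite_lext[OF assms] by simp
  \<comment> \<open>Two common elements of a chain of \<open>lt1\<close> and a chain of
    \<open>lt2\<close> would be comparable in both orders, which \<open>excl\<close>
    forbids.\<close>
  have "M x \<inter> M y = {}" if "x \<noteq> y" for x y
    using that chain_comparable[OF lt1(2)] chain_comparable[OF lt2(2)] excl
    unfolding M_def by blast
  then have "card (\<Union>x\<in>A. M x) = (\<Sum>x\<in>A. card (M x))"
    using assms fin by (intro card_UN_disjoint) auto
  also have "\<dots> = (\<Sum>x\<in>A. card (lext lt1 (A - {x})) * card (lext lt2 (A - {x})))"
    by (intro sum.cong) (simp_all add: M_def card_cartesian_product card_lext_chain lt1 lt2)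
  finally have "card (\<Union>x\<in>A. M x) = (\<Sum>x\<in>A. card (lext lt1 (A - {x})) * card (lext lt2 (A - {x})))" .
  moreover have "disjoint_chains lt1 lt2 A \<inter> (\<Union>x\<in>A. M x) = {}"
    by (auto simp: disjoint_chains_def M_def)
  ultimately show ?thesis
    using assms fin finite_disjoint_chains[OF assms]
    by (simp flip: card_cartesian_product add: split card_Un_disjoint)
qed

lemma card_lext_product_witnesses:
  assumes "finite A"
  shows "card (lext lt1 A) * card (lext lt2 A) = fact (card A) + card (witnesses lt1 lt2 A)"
  using assms
proof (induction "card A" arbitrary: A)
  \<comment> \<open>The single pair of empty lists gives 1, which equals \<open>fact 0\<close>; the
    strict inclusion in \<open>witnesses\<close> leaves no witness here. These units add up to the
    factorial.\<close>
  case 0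
  then have "A = {}" by simp
  moreover have "lext lt {} = {[]}" for lt :: "'a \<Rightarrow> 'a \<Rightarrow> bool" by (auto simp: lext_def)
  moreover have "witnesses lt1 lt2 {} = {}" by (auto simp: witnesses_def)
  ultimately show ?case by simp
next
  case (Suc n)
  let ?W = "witnesses lt1 lt2"
  define N where "N x = (\<lambda>(X, L1, L2). (x # X, L1, L2)) ` ?W (A - {x})" for x
  have A: "card A = Suc n" "finite A" using Suc by auto
  have N: "card (N x) = card (?W (A - {x}))" "finite (N x)" for x
    unfolding N_def using A finite_witnesses[of "A - {x}"]
    by (auto intro!: card_image inj_onI)
  \<comment> \<open>Split by the first element of \<open>X\<close>. The part with empty
    \<open>X\<close> consists of all pairs with disjoint chains on \<open>A\<close>, because
    \<open>A\<close> is nonempty in this case.\<close>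
  have "?W A = ({[]} \<times> disjoint_chains lt1 lt2 A) \<union> (\<Union>x\<in>A. N x)"
  proof (rule set_eqI)
    fix w :: "'a list \<times> 'a list \<times> 'a list"
    obtain X L1 L2 where w: "w = (X, L1, L2)" by (cases w) auto
    show "w \<in> ?W A \<longleftrightarrow> w \<in> ({[]} \<times> disjoint_chains lt1 lt2 A) \<union> (\<Union>x\<in>A. N x)"
    proof (cases X)
      case Nil
      then show ?thesis using A w by (auto simp: witnesses_def N_def)
    next
      case (Cons x X')
      have "w \<in> ?W A \<longleftrightarrow> x \<in> A \<and> (X', L1, L2) \<in> ?W (A - {x})"
        unfolding w Cons witnesses_def by (auto simp: Diff_insert2[symmetric] set_diff_eq[symmetric])
      also have "\<dots> \<longleftrightarrow> w \<in> ({[]} \<times> disjoint_chains lt1 lt2 A) \<union> (\<Union>x\<in>A. N x)"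
        unfolding w Cons N_def by force
      finally show ?thesis .
    qed
  qed
  moreover have "card (\<Union>x\<in>A. N x) = (\<Sum>x\<in>A. card (N x))"
    using A N by (intro card_UN_disjoint) (auto simp: N_def)
  moreover have "({[]} \<times> disjoint_chains lt1 lt2 A) \<inter> (\<Union>x\<in>A. N x) = {}"
    by (auto simp: N_def)
  ultimately have "card (?W A) = card (disjoint_chains lt1 lt2 A) + (\<Sum>x\<in>A. card (?W (A - {x})))"
    using A N finite_disjoint_chains[of A lt1 lt2] by (simp add: card_Un_disjoint card_cartesian_product)
  moreover have "(\<Sum>x\<in>A. card (lext lt1 (A - {x})) * card (lext lt2 (A - {x}))) =
      (\<Sum>x\<in>A. fact n + card (?W (A - {x})))"
    using A by (intro sum.cong refl) (subst Suc.hyps(1), auto)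
  ultimately show ?case
    unfolding card_lext_product[OF A(2)] by (simp add: sum.distrib A)
qed

end

section \<open>Linear orders as relations\<close>

text \<open>The diagonal is included so that a relation also records its elements; a strict version
  could not tell \<open>[]\<close> from \<open>[a]\<close>.\<close>

fun before :: "'a list \<Rightarrow> ('a \<times> 'a) set" where
  "before [] = {}"
| "before (a # L) = {a} \<times> set (a # L) \<union> before L"

definition lin_order :: "'a set \<Rightarrow> ('a \<times> 'a) set \<Rightarrow> bool" where
  "lin_order A F \<longleftrightarrow> F \<subseteq> A \<times> A \<and> (\<forall>a\<in>A. \<forall>b\<in>A. (a, b) \<in> F \<or> (b, a) \<in> F) \<and> antisym F \<and> trans F"

lemma lin_orderI:
  assumes "F \<subseteq> A \<times> A" "\<And>a b. a \<in> A \<Longrightarrow> b \<in> A \<Longrightarrow> (a, b) \<in> F \<or> (b, a) \<in> F"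
    and "\<And>a b. (a, b) \<in> F \<Longrightarrow> (b, a) \<in> F \<Longrightarrow> a = b"
    and "\<And>a b c. (a, b) \<in> F \<Longrightarrow> (b, c) \<in> F \<Longrightarrow> (a, c) \<in> F"
  shows "lin_order A F"
  unfolding lin_order_def
  by (intro conjI antisymI transI ballI assms(1)) (rule assms; assumption)+

lemma lin_orderD:
  assumes "lin_order A F"
  shows "F \<subseteq> A \<times> A" "a \<in> A \<Longrightarrow> b \<in> A \<Longrightarrow> (a, b) \<in> F \<or> (b, a) \<in> F"
    and "(a, b) \<in> F \<Longrightarrow> (b, a) \<in> F \<Longrightarrow> a = b"
    and "(a, b) \<in> F \<Longrightarrow> (b, c) \<in> F \<Longrightarrow> (a, c) \<in> F"
  using assms by (auto simp: lin_order_def dest: antisymD transD)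

lemma before_subset: "before L \<subseteq> set L \<times> set L"
  by (induction L) auto

lemma lin_order_before: "distinct L \<Longrightarrow> lin_order (set L) (before L)"
proof (induction L)
  case (Cons a L)
  then have IH: "lin_order (set L) (before L)" and a: "a \<notin> set L" by auto
  have [simp]: "(b, a) \<notin> before L" "(a, b) \<notin> before L" for b using before_subset[of L] a by auto
  have mem: "(b, c) \<in> before (a # L) \<longleftrightarrow> b = a \<and> c \<in> set (a # L) \<or> b \<in> set L \<and> (b, c) \<in> before L" for b c
    using before_subset[of L] by auto
  show ?case
  proof (rule lin_orderI)
    show "before (a # L) \<subseteq> set (a # L) \<times> set (a # L)" by (rule before_subset)
  next
    fix b c assume "b \<in> set (a # L)" "c \<in> set (a # L)"
    then show "(b, c) \<in> before (a # L) \<or> (c, b) \<in> before (a # L)"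
      using lin_orderD(2)[OF IH] by auto
  next
    fix b c assume "(b, c) \<in> before (a # L)" "(c, b) \<in> before (a # L)"
    then show "b = c" unfolding mem using lin_orderD(3)[OF IH, of b c] a by auto
  next
    fix b c d assume "(b, c) \<in> before (a # L)" "(c, d) \<in> before (a # L)"
    then show "(b, d) \<in> before (a # L)"
      unfolding mem using lin_orderD(4)[OF IH, of b c d] lin_orderD(1)[OF IH] a by auto
  qed
qed (simp add: lin_order_def antisym_def)

lemma before_refl: "(a, a) \<in> before L \<longleftrightarrow> a \<in> set L"
  by (induction L) auto

text \<open>The diagonal yields the set of elements, the least element is the head, and deleting its
  row leaves the relation of the tail.\<close>

lemma before_inject: "distinct L \<Longrightarrow> distinct L' \<Longrightarrow> before L = before L' \<Longrightarrow> L = L'"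
proof (induction L arbitrary: L')
  case Nil
  then show ?case by (cases L') auto
next
  case (Cons a L)
  have set: "set (a # L) = set L'" using Cons.prems(3) by (auto simp flip: before_refl)
  then obtain b M where L': "L' = b # M" by (cases L') auto
  have "(a, b) \<in> before L'" using set L' unfolding Cons.prems(3)[symmetric] by auto
  moreover have "a \<notin> set M" if "a \<noteq> b"
    using calculation that before_subset[of M] Cons.prems(2) L' by auto
  ultimately have ab: "a = b" using set L' by auto
  have "before L = before (a # L) - {a} \<times> UNIV" using before_subset[of L] Cons.prems(1) by auto
  also have "\<dots> = before (b # M) - {b} \<times> UNIV" using Cons.prems(3) L' ab by simp
  also have "\<dots> = before M" using before_subset[of M] Cons.prems(2) L' by auto
  finally show ?case using Cons.IH[of M] Cons.prems(1,2) L' ab by simp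
qed

lemma lin_order_restrict:
  assumes "lin_order A F" "B \<subseteq> A"
  shows "lin_order B (F \<inter> B \<times> B)"
proof (rule lin_orderI)
  fix a b assume "a \<in> B" "b \<in> B"
  then show "(a, b) \<in> F \<inter> B \<times> B \<or> (b, a) \<in> F \<inter> B \<times> B"
    using lin_orderD(2)[OF assms(1), of a b] assms(2) by auto
next
  fix a b assume "(a, b) \<in> F \<inter> B \<times> B" "(b, a) \<in> F \<inter> B \<times> B"
  then show "a = b" using lin_orderD(3)[OF assms(1), of a b] by auto
next
  fix a b c assume "(a, b) \<in> F \<inter> B \<times> B" "(b, c) \<in> F \<inter> B \<times> B"
  then show "(a, c) \<in> F \<inter> B \<times> B" using lin_orderD(4)[OF assms(1), of a b c] by auto
qed auto

lemma lin_order_min: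
  assumes "finite A" "A \<noteq> {}" "lin_order A F"
  shows "\<exists>a\<in>A. \<forall>b\<in>A. (a, b) \<in> F"
  using assms
proof (induction arbitrary: F rule: finite_ne_induct)
  case (singleton x)
  then show ?case by (auto simp: lin_order_def)
next
  case (insert x A)
  have "lin_order A (F \<inter> A \<times> A)" using lin_order_restrict[OF insert.prems] by blast
  from insert.IH[OF this] obtain a where a: "a \<in> A" "\<forall>b\<in>A. (a, b) \<in> F" by blast
  show ?case
  proof (cases "(a, x) \<in> F")
    case True
    then show ?thesis using a by auto
  next
    case False
    then have xa: "(x, a) \<in> F" and "(x, x) \<in> F" using lin_orderD(2)[OF insert.prems] a by blast+
    then have "\<forall>b\<in>insert x A. (x, b) \<in> F" using lin_orderD(4)[OF insert.prems xa] a by blast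
    then show ?thesis by blast
  qed
qed

lemma lin_order_imp_before:
  assumes "finite A" "lin_order A F"
  shows "\<exists>L. distinct L \<and> set L = A \<and> before L = F"
  using assms
proof (induction "card A" arbitrary: A F)
  case 0
  then show ?case by (intro exI[of _ "[]"]) (auto dest: lin_orderD(1))
next
  case (Suc n)
  then have "A \<noteq> {}" by auto
  then obtain a where a: "a \<in> A" "\<forall>b\<in>A. (a, b) \<in> F" using lin_order_min Suc.prems by blast
  let ?A = "A - {a}"
  let ?F = "F \<inter> ?A \<times> ?A"
  have "lin_order ?A ?F" using lin_order_restrict[OF Suc.prems(2)] by blast
  moreover have "n = card ?A" using Suc a by simp
  ultimately obtain L where L: "distinct L" "set L = ?A" "before L = ?F"
    using Suc.hyps(1)[of ?A ?F] Suc.prems by auto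
  have "F \<subseteq> A \<times> A" "\<forall>b\<in>A. (b, a) \<in> F \<longrightarrow> b = a"
    using a lin_orderD(1,3)[OF Suc.prems(2)] by blast+
  then have "F = {a} \<times> A \<union> ?F" using a by auto
  then have "before (a # L) = F" using L a by (auto simp: insert_absorb)
  then show ?case using L a by (intro exI[of _ "a # L"]) auto
qed

text \<open>This moves the order condition from the list to its relation, where a formula over
  positions can express it.\<close>

lemma lext_iff_before:
  assumes "irreflp lt"
  shows "L \<in> lext lt A \<longleftrightarrow>
    distinct L \<and> set L = A \<and> (\<forall>a\<in>A. \<forall>b\<in>A. lt a b \<longrightarrow> (a, b) \<in> before L)"
proof -
  have "distinct L \<Longrightarrow>
      sorted_wrt (\<lambda>a b. \<not> lt b a) L \<longleftrightarrow> (\<forall>a\<in>set L. \<forall>b\<in>set L. lt a b \<longrightarrow> (a, b) \<in> before L)"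
  proof (induction L)
    case (Cons z L)
    then have "(b, z) \<notin> before L" for b using before_subset[of L] by auto
    then show ?case using Cons irreflpD[OF assms] by auto
  qed simp
  then show ?thesis by (auto simp: lext_def)
qed

section \<open>Greedy chains without recursion\<close>

text \<open>A fixed-point equation replaces the recursion of \<open>chain\<close>: \<open>C\<close>
  occurs on both sides, and every clause only quantifies over elements. That it has a single
  solution is the next lemma.\<close>

definition is_greedy_chain :: "('a \<Rightarrow> 'a \<Rightarrow> bool) \<Rightarrow> 'a set \<Rightarrow> ('a \<times> 'a) set \<Rightarrow> 'a set \<Rightarrow> bool" where
  "is_greedy_chain lt A F C \<longleftrightarrow> (\<forall>e. e \<in> C \<longleftrightarrow> e \<in> A \<and> ((\<forall>a\<in>A. (e, a) \<in> F) \<or>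
     (\<exists>d\<in>C. lt d e \<and> (\<forall>a\<in>A. lt d a \<longrightarrow> (e, a) \<in> F))))"

text \<open>Whether \<open>e\<close> is a member depends only on members \<open>d\<close> with
  \<open>lt d e\<close>. These come strictly before \<open>e\<close> in \<open>F\<close>, so
  induction on the number of predecessors in \<open>F\<close> settles membership.\<close>

lemma is_greedy_chain_unique:
  assumes "finite A" "lin_order A F" "\<And>a b. a \<in> A \<Longrightarrow> b \<in> A \<Longrightarrow> lt a b \<Longrightarrow> (a, b) \<in> F" "irreflp lt"
    and C: "is_greedy_chain lt A F C" and C': "is_greedy_chain lt A F C'"
  shows "C = C'"
proof -
  have "e \<in> C \<longleftrightarrow> e \<in> C'" if "e \<in> A" for e
    using that
  proof (induction "card {a. (a, e) \<in> F}" arbitrary: e rule: less_induct)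
    case less
    have "d \<in> C \<longleftrightarrow> d \<in> C'" if "d \<in> A" "lt d e" for d
    proof (rule less(1))
      have de: "(d, e) \<in> F" "d \<noteq> e"
        using assms(3)[OF that(1) less(2) that(2)] that assms(4) by (auto dest: irreflpD)
      have "{a. (a, d) \<in> F} \<subseteq> {a. (a, e) \<in> F}"
        using lin_orderD(4)[OF assms(2)] de by blast
      moreover have "(e, d) \<notin> F" "(e, e) \<in> F"
        using lin_orderD(2,3)[OF assms(2)] de that less(2) by blast+
      ultimately have "{a. (a, d) \<in> F} \<subset> {a. (a, e) \<in> F}" by blast
      moreover have "finite {a. (a, e) \<in> F}"
        using assms(1) lin_orderD(1)[OF assms(2)] by (auto intro: finite_subset[of _ A])
      ultimately show "card {a. (a, d) \<in> F} < card {a. (a, e) \<in> F}" by (rule psubset_card_mono[rotated])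
    qed (fact that)
    moreover have "C \<subseteq> A" "C' \<subseteq> A" using C C' unfolding is_greedy_chain_def by blast+
    ultimately have "(\<exists>d\<in>C. lt d e \<and> (\<forall>a\<in>A. lt d a \<longrightarrow> (e, a) \<in> F)) \<longleftrightarrow>
        (\<exists>d\<in>C'. lt d e \<and> (\<forall>a\<in>A. lt d a \<longrightarrow> (e, a) \<in> F))"
      by blast
    then show ?case using C C' unfolding is_greedy_chain_def by blast
  qed
  moreover have "C \<subseteq> A" "C' \<subseteq> A" using C C' unfolding is_greedy_chain_def by blast+
  ultimately show ?thesis by blast
qed

lemma before_first:
  assumes "distinct (c # L)" "e \<in> set (c # L)"
  shows "(\<forall>a\<in>set (c # L). (e, a) \<in> before (c # L)) \<longleftrightarrow> e = c"
proof (cases "e = c")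
  case False
  then have "(e, c) \<notin> before (c # L)" using assms before_subset[of L] by auto
  then show ?thesis using False by auto
qed simp

text \<open>Each recursive call of \<open>chain\<close> deletes one element: the head
  \<open>c\<close> after recording it, or the skipped \<open>y\<close>. No chain member of the
  shorter list lies below the deleted element, so none of their successors changes. If
  \<open>c\<close> is deleted, its successor \<open>y\<close> takes over as the least
  element.\<close>

lemma is_greedy_chain_chain:
  "lsorted lt L \<Longrightarrow> distinct L \<Longrightarrow> irreflp lt \<Longrightarrow> is_greedy_chain lt (set L) (before L) (chain lt L)"
proof (induction lt L rule: chain.induct)
  case (2 lt c)
  then show ?case by (auto simp: is_greedy_chain_def irreflp_def)
next
  case (3 lt c y r)
  define s where "s A F d e \<longleftrightarrow> lt d e \<and> (\<forall>a\<in>A. lt d a \<longrightarrow> (e, a) \<in> F)" for A F d e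
  have rel: "is_greedy_chain lt (set (h # t)) (before (h # t)) C \<longleftrightarrow> (\<forall>e. e \<in> C \<longleftrightarrow>
      e \<in> set (h # t) \<and> (e = h \<or> (\<exists>d\<in>C. s (set (h # t)) (before (h # t)) d e)))"
    if "distinct (h # t)" for h t C
    unfolding is_greedy_chain_def s_def using before_first[OF that] by blast
  have irr: "\<not> lt a a" for a using 3(5) by (auto dest: irreflpD)
  have below: "\<not> lt d c" if "d \<in> set (c # y # r)" for d using 3(3) irr that by auto
  have below': "\<not> lt d y" if "d \<in> set (y # r)" for d using 3(3) irr that by auto
  have before: "(a, c) \<notin> before r" "(c, a) \<notin> before r" "(a, y) \<notin> before r" "(y, a) \<notin> before r" for a
    using before_subset[of r] 3(4) by auto
  have ne: "c \<noteq> y" using 3(4) by simp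
  let ?A = "set (c # y # r)" and ?F = "before (c # y # r)"
  show ?case
  proof (cases "lt c y")
    case True
    let ?C = "chain lt (y # r)"
    have IH: "is_greedy_chain lt (set (y # r)) (before (y # r)) ?C" and dist: "distinct (y # r)"
      using 3 True by simp_all
    have C: "?C \<subseteq> set (y # r)" by (rule chain_subset)
    have c: "s ?A ?F c e \<longleftrightarrow> e = y" for e
      using True irr before ne by (auto simp: s_def)
    have d: "s ?A ?F d e \<longleftrightarrow> s (set (y # r)) (before (y # r)) d e" if "d \<in> ?C" "e \<noteq> c" for d e
      using below[of d] C that by (auto simp: s_def)
    have d': "\<not> s ?A ?F d c" if "d \<in> ?C" for d
      using below[of d] C that by (auto simp: s_def)
    show ?thesis
      unfolding rel[OF 3(4)]
    proof
      fix e
      have "e \<in> ?C \<longleftrightarrow> e \<in> set (y # r) \<and>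
          (e = y \<or> (\<exists>d\<in>?C. s (set (y # r)) (before (y # r)) d e))"
        using iffD1[OF rel[OF dist] IH] by blast
      then have *: "e \<in> ?C \<longleftrightarrow> e \<in> set (y # r) \<and> (e = y \<or> (\<exists>d\<in>?C. s ?A ?F d e))"
        if "e \<noteq> c"
        using d[OF _ that] by blast
      have "chain lt (c # y # r) = insert c ?C" "?A = insert c (set (y # r))"
        using True by simp_all
      moreover have "e \<in> insert c ?C \<longleftrightarrow>
          e \<in> insert c (set (y # r)) \<and> (e = c \<or> (\<exists>d\<in>insert c ?C. s ?A ?F d e))"
        using * c[of e] by blast
      ultimately show "e \<in> chain lt (c # y # r) \<longleftrightarrow>
          e \<in> ?A \<and> (e = c \<or> (\<exists>d\<in>chain lt (c # y # r). s ?A ?F d e))"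
        by (simp only:)
    qed
  next
    case False
    let ?C = "chain lt (c # r)"
    have IH: "is_greedy_chain lt (set (c # r)) (before (c # r)) ?C" and dist: "distinct (c # r)"
      using 3 False by simp_all
    have C: "?C \<subseteq> set (c # r)" by (rule chain_subset)
    have d: "s ?A ?F d e \<longleftrightarrow> s (set (c # r)) (before (c # r)) d e" if "d \<in> ?C" "e \<noteq> y" for d e
      using below'[of d] C that False by (auto simp: s_def)
    have d': "\<not> s ?A ?F d y" if "d \<in> ?C" for d
      using below'[of d] C that False by (auto simp: s_def)
    show ?thesis
      unfolding rel[OF 3(4)]
    proof
      fix e
      have "e \<in> ?C \<longleftrightarrow> e \<in> set (c # r) \<and>
          (e = c \<or> (\<exists>d\<in>?C. s (set (c # r)) (before (c # r)) d e))"
        using iffD1[OF rel[OF dist] IH] by blast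
      then have *: "e \<in> ?C \<longleftrightarrow> e \<in> set (c # r) \<and> (e = c \<or> (\<exists>d\<in>?C. s ?A ?F d e))"
        if "e \<noteq> y"
        using d[OF _ that] by blast
      have "y \<notin> ?C" using C 3(4) by auto
      then have "e \<in> ?C \<longleftrightarrow>
          e \<in> insert y (set (c # r)) \<and> (e = c \<or> (\<exists>d\<in>?C. s ?A ?F d e))"
        using * d' ne by blast
      moreover have "chain lt (c # y # r) = ?C" "?A = insert y (set (c # r))"
        using False by auto
      ultimately show "e \<in> chain lt (c # y # r) \<longleftrightarrow>
          e \<in> ?A \<and> (e = c \<or> (\<exists>d\<in>chain lt (c # y # r). s ?A ?F d e))"
        by (simp only:)
    qed
  qed
qed (simp add: is_greedy_chain_def)

lemma is_greedy_chain_iff: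
  assumes "irreflp lt" "finite A" "L \<in> lext lt A"
  shows "is_greedy_chain lt A (before L) C \<longleftrightarrow> C = chain lt L"
proof -
  have L: "distinct L" "set L = A" "lsorted lt L" using assms(3) by (auto simp: lext_def)
  have "is_greedy_chain lt A (before L) (chain lt L)" using is_greedy_chain_chain L assms(1) by blast
  moreover have "C = C'" if "is_greedy_chain lt A (before L) C" "is_greedy_chain lt A (before L) C'" for C C'
    using that assms L lin_order_before[OF L(1)] lext_iff_before[OF assms(1), of L A]
    by (intro is_greedy_chain_unique[of A "before L" lt]) auto
  ultimately show ?thesis by blast
qed

section \<open>Words encoding permutations\<close>

text \<open>A numbering \<open>f\<close> corresponds to the list of the elements in the order of
  their numbers. The transport along \<open>h\<close> is built in, so that a permutation and its
  reversal can be placed on one ground set although they number it differently.\<close>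

lemma num_linear_extensions_eq_card_lext:
  assumes "finite A" and h: "bij_betw h A B" and r: "r \<subseteq> A \<times> A" and "irreflp lt"
    and iso: "\<And>a b. a \<in> A \<Longrightarrow> b \<in> A \<Longrightarrow> (a, b) \<in> r \<longleftrightarrow> lt (h a) (h b)"
  shows "num_linear_extensions A r = card (lext lt B)"
proof -
  let ?n = "card A"
  define \<Phi> where "\<Phi> f = map (\<lambda>i. h (inv_into A f (Suc i))) [0..<?n]" for f
  have "bij_betw \<Phi> (linear_extensions A r) (lext lt B)"
  proof (rule bij_betw_imageI)
    show "inj_on \<Phi> (linear_extensions A r)"
    proof (rule inj_onI)
      fix f g assume f: "f \<in> linear_extensions A r" and g: "g \<in> linear_extensions A r" and eq: "\<Phi> f = \<Phi> g"
      have bf: "bij_betw f A {1..?n}" and bg: "bij_betw g A {1..?n}"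
        using f g by (auto simp: linear_extensions_def)
      show "f = g"
      proof (rule extensionalityI[of _ A])
        show "f \<in> extensional A" "g \<in> extensional A"
          using f g by (auto simp: linear_extensions_def PiE_def)
        fix a assume a: "a \<in> A"
        then have "f a \<in> {1..?n}" using bf by (auto simp: bij_betw_def)
        then obtain i where i: "i < ?n" "f a = Suc i" by (cases "f a") auto
        have "\<Phi> f ! i = \<Phi> g ! i" using eq by simp
        then have "h (inv_into A f (f a)) = h (inv_into A g (Suc i))" using i by (simp add: \<Phi>_def)
        moreover have "inv_into A f (f a) = a" using bf a by (simp add: bij_betw_def)
        moreover have "Suc i \<in> g ` A" using bg i by (auto simp: bij_betw_def)
        ultimately have "a = inv_into A g (Suc i)"
          using h a inv_into_into[of "Suc i" g A] by (auto simp: bij_betw_def inj_on_def)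
        then show "f a = g a" using f_inv_into_f[OF \<open>Suc i \<in> g ` A\<close>] i by simp
      qed
    qed
    show "\<Phi> ` linear_extensions A r = lext lt B"
    proof (intro equalityI subsetI)
      fix L assume "L \<in> \<Phi> ` linear_extensions A r"
      then obtain f where L: "L = \<Phi> f" and f: "f \<in> linear_extensions A r" by blast
      have bf: "bij_betw f A {1..?n}" and ext: "\<And>a b. (a, b) \<in> r \<Longrightarrow> f a < f b"
        using f by (auto simp: linear_extensions_def)
      have inv: "bij_betw (inv_into A f) {1..?n} A" using bf by (rule bij_betw_inv_into)
      have Suc: "bij_betw Suc {0..<?n} {1..?n}"
        by (rule bij_betwI[where g = "\<lambda>i. i - 1"]) auto
      have b: "bij_betw (\<lambda>i. h (inv_into A f (Suc i))) {0..<?n} B"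
        using bij_betw_trans[OF bij_betw_trans[OF Suc inv] h] by (simp add: comp_def)
      then have "distinct L" "set L = B"
        by (auto simp: L \<Phi>_def distinct_map bij_betw_def)
      moreover have "\<not> lt (L ! j) (L ! i)" if "i < j" "j < length L" for i j
      proof
        have ij: "Suc i \<in> {1..?n}" "Suc j \<in> {1..?n}" using that by (auto simp: L \<Phi>_def)
        assume "lt (L ! j) (L ! i)"
        then have "(inv_into A f (Suc j), inv_into A f (Suc i)) \<in> r"
          using that iso bij_betwE[OF inv] ij by (simp add: L \<Phi>_def)
        from ext[OF this] show False
          using that ij bf by (simp add: bij_betw_def f_inv_into_f)
      qed
      ultimately show "L \<in> lext lt B" by (auto simp: lext_def sorted_wrt_iff_nth_less)
    next
      fix L assume "L \<in> lext lt B"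
      then have L: "distinct L" "set L = B" "\<And>i j. i < j \<Longrightarrow> j < length L \<Longrightarrow> \<not> lt (L ! j) (L ! i)"
        by (auto simp: lext_def sorted_wrt_iff_nth_less)
      have len: "length L = ?n"
        using L distinct_card[of L] bij_betw_same_card[OF h] by simp
      have "bij_betw (\<lambda>i. i - 1) {1..?n} {..<?n}"
        by (rule bij_betwI[where g = Suc]) auto
      moreover have "bij_betw ((!) L) {..<?n} B"
        using L len by (auto intro: bij_betw_nth)
      ultimately have b: "bij_betw (\<lambda>i. inv_into A h (L ! (i - 1))) {1..?n} A"
        using bij_betw_trans[OF bij_betw_trans bij_betw_inv_into[OF h]] by (fastforce simp: comp_def)
      define k where "k i = inv_into A h (L ! (i - 1))" for i
      note b = b[folded k_def]
      have hk: "h (k i) = L ! (i - 1)" if "i \<in> {1..?n}" for i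
      proof -
        have "L ! (i - 1) \<in> h ` A" using that L(2) len h nth_mem[of "i - 1" L] by (auto simp: bij_betw_def)
        then show ?thesis unfolding k_def by (rule f_inv_into_f)
      qed
      \<comment> \<open>Conversely, \<open>k i\<close> is the element listed in place
        \<open>i\<close>, and its inverse is the numbering; \<open>linear_extensions\<close>
        requires it to be undefined outside \<open>A\<close>, hence \<open>restrict\<close>.\<close>
      define f where "f = restrict (inv_into {1..?n} k) A"
      have bf: "bij_betw f A {1..?n}"
        unfolding f_def using bij_betw_inv_into[OF b] by (simp cong: bij_betw_cong)
      have fk: "f a \<in> {1..?n} \<and> k (f a) = a" if "a \<in> A" for a
        using that b bij_betwE[OF bf] unfolding f_def by (auto simp: bij_betw_def f_inv_into_f)
      have "f a < f c" if "(a, c) \<in> r" for a c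
      proof -
        have ac: "a \<in> A" "c \<in> A" using r that by auto
        then have "lt (h a) (h c)" using iso that by blast
        then have lt: "lt (L ! (f a - 1)) (L ! (f c - 1))" using hk[of "f a"] hk[of "f c"] fk ac by auto
        then have "f a \<noteq> f c" using assms(4) by (metis irreflpD)
        moreover have "\<not> f c < f a"
        proof
          assume "f c < f a"
          then have "f c - 1 < f a - 1" "f a - 1 < length L"
            using fk[OF ac(1)] fk[OF ac(2)] len by auto
          from L(3)[OF this] lt show False by blast
        qed
        ultimately show ?thesis by simp
      qed
      moreover have "f \<in> extensional A" by (simp add: f_def)
      ultimately have "f \<in> linear_extensions A r"
        using bf bij_betwE[OF bf] by (auto simp: linear_extensions_def PiE_def)
      moreover have "\<Phi> f = L"
      proof (rule nth_equalityI)
        fix i assume "i < length (\<Phi> f)"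
        then have i: "i < ?n" by (simp add: \<Phi>_def)
        then have "k (Suc i) \<in> A" using bij_betwE[OF b] by simp
        moreover have "f (k (Suc i)) = Suc i"
          using calculation b i unfolding f_def by (simp add: bij_betw_def)
        ultimately have "inv_into A f (Suc i) = k (Suc i)"
          using bf by (metis bij_betw_inv_into_left)
        then show "\<Phi> f ! i = L ! i" using i hk[of "Suc i"] by (simp add: \<Phi>_def)
      qed (simp add: \<Phi>_def len)
      ultimately show "L \<in> \<Phi> ` linear_extensions A r" by blast
    qed
  qed
  then show ?thesis
    unfolding num_linear_extensions_def by (rule bij_betw_same_card)
qed

section \<open>Unary codes of permutations\<close>

definition unary_code :: "nat list \<Rightarrow> bool list" where
  "unary_code ks = concat (map (\<lambda>k. replicate k True @ [False]) ks)"

text \<open>The place of the zero that closes block \<open>i\<close>, counted from 0. These zeros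
  take over the role of the ground set \<open>{1..n}\<close>.\<close>

definition entry_pos :: "nat list \<Rightarrow> nat \<Rightarrow> nat" where
  "entry_pos ks i = length (unary_code (take i ks)) + ks ! i"

definition zeros :: "bool list \<Rightarrow> nat set" where
  "zeros x = {a. a < length x \<and> \<not> x ! a}"

text \<open>The start of the block of ones that ends just before \<open>a\<close>. The minimum
  exists since \<open>s = a\<close> satisfies the condition vacuously.\<close>

definition run_start :: "bool list \<Rightarrow> nat \<Rightarrow> nat" where
  "run_start x a = (LEAST s. \<forall>c. s \<le> c \<longrightarrow> c < a \<longrightarrow> x ! c)"

definition entry :: "bool list \<Rightarrow> nat \<Rightarrow> nat" where
  "entry x a = a - run_start x a"

lemma unary_code_simps [simp]:
  "unary_code [] = []" "unary_code (k # ks) = replicate k True @ False # unary_code ks"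
  "unary_code (ks @ ks') = unary_code ks @ unary_code ks'"
  by (simp_all add: unary_code_def)

lemma encode_perm_eq: "encode_perm n \<sigma> = unary_code (map \<sigma> [1..<n + 1])"
  by (simp add: encode_perm_def unary_code_def comp_def)

lemma unary_code_split:
  assumes "i < length ks"
  shows "unary_code ks = unary_code (take i ks) @ replicate (ks ! i) True @ False # unary_code (drop (Suc i) ks)"
proof -
  have "unary_code ks = unary_code (take i ks @ ks ! i # drop (Suc i) ks)"
    using id_take_nth_drop[OF assms] by simp
  then show ?thesis by (simp only: unary_code_simps append.assoc)
qed

lemma entry_pos_in_zeros:
  assumes "i < length ks"
  shows "entry_pos ks i \<in> zeros (unary_code ks)"
  by (subst unary_code_split[OF assms]) (simp add: zeros_def entry_pos_def nth_append)

lemma entry_pos_less: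
  assumes "i < j" "j < length ks"
  shows "entry_pos ks i < entry_pos ks j"
proof -
  have "entry_pos ks i < length (unary_code (take (Suc i) ks))"
    using assms by (simp add: entry_pos_def take_Suc_conv_app_nth)
  also have "\<dots> \<le> length (unary_code (take j ks))"
  proof -
    have "take j ks = take (Suc i) ks @ drop (Suc i) (take j ks)"
      using assms append_take_drop_id[of "Suc i" "take j ks"] by (simp add: min_def)
    then have "unary_code (take j ks) = unary_code (take (Suc i) ks) @ unary_code (drop (Suc i) (take j ks))"
      by (metis unary_code_simps(3))
    then show ?thesis by simp
  qed
  finally show ?thesis by (simp add: entry_pos_def)
qed

lemma unary_code_last: "unary_code ks \<noteq> [] \<Longrightarrow> \<not> unary_code ks ! (length (unary_code ks) - 1)"
  by (cases ks rule: rev_cases) (auto simp: nth_append)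

lemma run_start_entry_pos:
  assumes "i < length ks"
  shows "run_start (unary_code ks) (entry_pos ks i) = length (unary_code (take i ks))"
  unfolding run_start_def
proof (rule Least_equality)
  let ?l = "length (unary_code (take i ks))"
  show "\<forall>c. ?l \<le> c \<longrightarrow> c < entry_pos ks i \<longrightarrow> unary_code ks ! c"
    by (subst unary_code_split[OF assms]) (auto simp: entry_pos_def nth_append)
next
  let ?l = "length (unary_code (take i ks))"
  fix s assume s: "\<forall>c. s \<le> c \<longrightarrow> c < entry_pos ks i \<longrightarrow> unary_code ks ! c"
  show "?l \<le> s"
  proof (rule ccontr)
    assume "\<not> ?l \<le> s"
    \<comment> \<open>A start further left would cover the zero that closes the preceding
      block.\<close>
    then have "unary_code ks ! (?l - 1)" and ne: "unary_code (take i ks) \<noteq> []" using s by (auto simp: entry_pos_def)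
    then have "unary_code (take i ks) ! (?l - 1)"
      by (subst (asm) unary_code_split[OF assms]) (auto simp: nth_append)
    then show False using unary_code_last[OF ne] by simp
  qed
qed

lemma entry_entry_pos: "i < length ks \<Longrightarrow> entry (unary_code ks) (entry_pos ks i) = ks ! i"
  by (simp add: entry_def run_start_entry_pos) (simp add: entry_pos_def)

lemma zeros_unary_code: "zeros (unary_code ks) = entry_pos ks ` {..<length ks}"
proof
  show "zeros (unary_code ks) \<subseteq> entry_pos ks ` {..<length ks}"
  proof (induction ks rule: rev_induct)
    case (snoc k ks)
    have "entry_pos (ks @ [k]) i = entry_pos ks i" if "i < length ks" for i
      using that by (simp add: entry_pos_def nth_append)
    moreover have "entry_pos (ks @ [k]) (length ks) = length (unary_code ks) + k"
      by (simp add: entry_pos_def)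
    moreover have "zeros (unary_code (ks @ [k])) \<subseteq> insert (length (unary_code ks) + k) (zeros (unary_code ks))"
      by (auto simp: zeros_def nth_append nth_Cons' split: if_splits)
    ultimately show ?case using snoc by (auto simp: lessThan_Suc)
  qed (simp add: zeros_def)
  show "entry_pos ks ` {..<length ks} \<subseteq> zeros (unary_code ks)"
    using entry_pos_in_zeros by auto
qed

lemma inj_on_entry_pos: "inj_on (entry_pos ks) {..<length ks}"
  by (rule linorder_inj_onI) (use entry_pos_less in \<open>fastforce+\<close>)

lemma ex_unary_code:
  "x = [] \<or> \<not> last x \<Longrightarrow> \<exists>ks. x = unary_code ks"
proof (induction x)
  case Nil
  show ?case by (intro exI[of _ "[]"]) simp
next
  case (Cons b x)
  then obtain ks where ks: "x = unary_code ks" by (cases x) auto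
  show ?case
  proof (cases b)
    case False
    then show ?thesis using ks by (intro exI[of _ "0 # ks"]) simp
  next
    case True
    then obtain k ks' where "ks = k # ks'" using Cons.prems ks by (cases ks) auto
    then show ?thesis using ks True by (intro exI[of _ "Suc k # ks'"]) simp
  qed
qed

definition is_code :: "bool list \<Rightarrow> bool" where
  "is_code x \<longleftrightarrow> (\<exists>n \<sigma>. \<sigma> permutes {1..n} \<and> x = encode_perm n \<sigma>)"

text \<open>The number \<open>n\<close> does not occur on the right: entries that are positive and
  closed downwards fill \<open>{1..m}\<close> for their maximum \<open>m\<close>, and their
  distinctness makes \<open>m\<close> the number of blocks. The first condition says that the word
  does not break off inside a block.\<close>

lemma is_code_iff:
  "is_code x \<longleftrightarrow>
     (\<forall>a<length x. x ! a \<longrightarrow> (\<exists>b<length x. a < b \<and> \<not> x ! b)) \<and>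
     (\<forall>a\<in>zeros x. 0 < entry x a) \<and>
     (\<forall>a\<in>zeros x. \<forall>b\<in>zeros x. entry x a = entry x b \<longrightarrow> a = b) \<and>
     (\<forall>a\<in>zeros x. \<forall>k. 0 < k \<longrightarrow> k < entry x a \<longrightarrow> (\<exists>b\<in>zeros x. entry x b = k))"
  (is "_ \<longleftrightarrow> ?ends \<and> ?pos \<and> ?inj \<and> ?down")
proof
  assume "is_code x"
  then obtain n \<sigma> where \<sigma>: "\<sigma> permutes {1..n}" and x: "x = unary_code (map \<sigma> [1..<n + 1])"
    by (auto simp: is_code_def encode_perm_eq)
  define ks where "ks = map \<sigma> [1..<n + 1]"
  note x = x[folded ks_def]
  have ks: "length ks = n" "\<And>i. i < n \<Longrightarrow> ks ! i = \<sigma> (Suc i)"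
    by (simp_all add: ks_def del: upt_Suc)
  have \<sigma>_in: "\<sigma> (Suc i) \<in> {1..n}" if "i < n" for i
    using permutes_in_image[OF \<sigma>, of "Suc i"] that by simp
  have ?ends
  proof (intro allI impI)
    fix a assume a: "a < length x" "x ! a"
    then have "x \<noteq> []" by auto
    then have "\<not> x ! (length x - 1)" using unary_code_last[of ks] x by simp
    then show "\<exists>b<length x. a < b \<and> \<not> x ! b"
      using a by (intro exI[of _ "length x - 1"]) (cases "a = length x - 1"; auto)
  qed
  moreover have ?pos using \<sigma>_in by (auto simp: x zeros_unary_code entry_entry_pos ks Suc_le_eq)
  moreover have ?inj
    using permutes_inj[OF \<sigma>] by (auto simp: x zeros_unary_code entry_entry_pos ks inj_eq)
  moreover have ?down
  proof (intro ballI allI impI)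
    fix a k assume "a \<in> zeros x" "0 < k" "k < entry x a"
    then have "k \<in> {1..n}" using \<sigma>_in by (fastforce simp: x zeros_unary_code entry_entry_pos ks)
    then have "k \<in> \<sigma> ` {1..n}" using permutes_image[OF \<sigma>] by simp
    then obtain j where j: "j \<in> {1..n}" "\<sigma> j = k" by auto
    then show "\<exists>b\<in>zeros x. entry x b = k"
      by (intro bexI[of _ "entry_pos ks (j - 1)"])
        (auto simp: x ks entry_entry_pos intro!: entry_pos_in_zeros)
  qed
  ultimately show "?ends \<and> ?pos \<and> ?inj \<and> ?down" by blast
next
  assume *: "?ends \<and> ?pos \<and> ?inj \<and> ?down"
  have "x = [] \<or> \<not> last x"
  proof (rule ccontr)
    assume "\<not> (x = [] \<or> \<not> last x)"
    then have "length x - 1 < length x" "x ! (length x - 1)" by (auto simp: last_conv_nth)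
    then obtain b where "b < length x" "length x - 1 < b" using * by blast
    then show False by simp
  qed
  then obtain ks where x: "x = unary_code ks" using ex_unary_code by blast
  define n where "n = length ks"
  have entries: "entry x ` zeros x = set ks"
    by (auto simp: x zeros_unary_code entry_entry_pos in_set_conv_nth image_iff)
  have dist: "distinct ks"
    unfolding distinct_conv_nth
  proof (intro allI impI)
    fix i j assume ij: "i < length ks" "j < length ks" "i \<noteq> j"
    then have "entry_pos ks i \<noteq> entry_pos ks j" using inj_on_entry_pos[of ks] by (auto simp: inj_on_def)
    then show "ks ! i \<noteq> ks ! j"
      using * ij entry_pos_in_zeros[of i ks] entry_pos_in_zeros[of j ks] entry_entry_pos[of i ks] entry_entry_pos[of j ks]
      unfolding x by metis
  qed
  have pos: "0 < k" if "k \<in> set ks" for k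
    using * that unfolding entries[symmetric] by auto
  have down: "k' \<in> set ks" if "k \<in> set ks" "0 < k'" "k' < k" for k k'
    using * that unfolding entries[symmetric] by blast
  have set: "set ks = {1..n}"
  proof (cases "ks = []")
    case False
    define m where "m = Max (set ks)"
    have m: "m \<in> set ks" "\<And>k. k \<in> set ks \<Longrightarrow> k \<le> m" using False by (simp_all add: m_def)
    have "set ks = {1..m}"
    proof (intro equalityI subsetI)
      fix k assume "k \<in> {1..m}"
      then show "k \<in> set ks" using down[OF m(1), of k] m(1) by (cases "k = m") auto
    qed (use pos m in \<open>auto simp: Suc_le_eq\<close>)
    moreover from this have "m = n" using distinct_card[OF dist] by (simp add: n_def)
    ultimately show ?thesis by simp
  qed (simp add: n_def)
  define \<sigma> where "\<sigma> i = (if i \<in> {1..n} then ks ! (i - 1) else i)" for i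
  have "bij_betw (\<lambda>i. i - 1) {1..n} {..<n}"
    by (rule bij_betwI[where g = Suc]) auto
  moreover have "bij_betw ((!) ks) {..<n} {1..n}"
    using bij_betw_nth[OF dist, of "{..<n}" "{1..n}"] set by (simp add: n_def)
  ultimately have "bij_betw (\<lambda>i. ks ! (i - 1)) {1..n} {1..n}"
    using bij_betw_trans by (fastforce simp: comp_def)
  then have "bij_betw \<sigma> {1..n} {1..n}"
    by (rule bij_betw_cong[THEN iffD1, rotated]) (simp add: \<sigma>_def)
  then have "\<sigma> permutes {1..n}"
  proof (rule bij_imp_permutes)
    fix i assume "i \<notin> {1..n}"
    then show "\<sigma> i = i" unfolding \<sigma>_def by (rule if_not_P)
  qed
  moreover have "map \<sigma> [1..<n + 1] = ks"
    by (rule nth_equalityI) (simp_all add: \<sigma>_def n_def del: upt_Suc)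
  ultimately show "is_code x"
    unfolding is_code_def encode_perm_eq using x by (intro exI[of _ n] exI[of _ \<sigma>]) simp
qed

section \<open>The two orders on the zeros of a word\<close>

definition lt1 :: "bool list \<Rightarrow> nat \<Rightarrow> nat \<Rightarrow> bool" where
  "lt1 x a b \<longleftrightarrow> a \<in> zeros x \<and> b \<in> zeros x \<and> a < b \<and> entry x a < entry x b"

text \<open>The order of the reversal, read at the places of the original word: reversing turns the
  order of the places around and leaves the entries alone.\<close>

definition lt2 :: "bool list \<Rightarrow> nat \<Rightarrow> nat \<Rightarrow> bool" where
  "lt2 x a b \<longleftrightarrow> a \<in> zeros x \<and> b \<in> zeros x \<and> b < a \<and> entry x a < entry x b"

lemma lt_order: "irreflp (lt1 x)" "transp (lt1 x)" "irreflp (lt2 x)" "transp (lt2 x)"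
  by (auto simp: lt1_def lt2_def intro!: irreflpI transpI)

lemma eta_eq_card_witnesses:
  assumes \<sigma>: "\<sigma> permutes {1..n}" and x: "x = encode_perm n \<sigma>"
  shows "eta n \<sigma> = int (card (witnesses (lt1 x) (lt2 x) (zeros x)))"
proof -
  define ks where "ks = map \<sigma> [1..<n + 1]"
  have x: "x = unary_code ks" using x by (simp only: encode_perm_eq ks_def)
  have ks: "length ks = n" "\<And>i. i < n \<Longrightarrow> ks ! i = \<sigma> (Suc i)"
    by (simp_all add: ks_def del: upt_Suc)
  have entry_pos_iff: "entry_pos ks i < entry_pos ks j \<longleftrightarrow> i < j" if "i < n" "j < n" for i j
    using entry_pos_less[of i j ks] entry_pos_less[of j i ks] that ks(1) by (metis less_asym linorder_neqE_nat)
  have b: "bij_betw (entry_pos ks) {..<n} (zeros x)"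
    using inj_on_entry_pos[of ks] by (simp add: bij_betw_def x zeros_unary_code ks)
  have "bij_betw (\<lambda>i. i - 1) {1..n} {..<n}"
    by (rule bij_betwI[where g = Suc]) auto
  from bij_betw_trans[OF this b] have b1: "bij_betw (\<lambda>i. entry_pos ks (i - 1)) {1..n} (zeros x)"
    by (simp add: comp_def)
  \<comment> \<open>Place \<open>i\<close> of the reversal is place \<open>n + 1 - i\<close> of
    \<open>\<sigma>\<close>, which has index \<open>n - i\<close> in the list
    \<open>ks\<close>.\<close>
  have "bij_betw (\<lambda>i. n - i) {1..n} {..<n}"
    by (rule bij_betwI[where g = "\<lambda>i. n - i"]) auto
  from bij_betw_trans[OF this b] have b2: "bij_betw (\<lambda>i. entry_pos ks (n - i)) {1..n} (zeros x)"
    by (simp add: comp_def)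
  have 1: "num_linear_extensions {1..n} (perm_order n \<sigma>) = card (lext (lt1 x) (zeros x))"
  proof (rule num_linear_extensions_eq_card_lext[OF _ b1 _ lt_order(1)])
    fix i j assume ij: "i \<in> {1..n}" "j \<in> {1..n}"
    then have "entry_pos ks (i - 1) < entry_pos ks (j - 1) \<longleftrightarrow> i < j"
      by (subst entry_pos_iff) auto
    then show "(i, j) \<in> perm_order n \<sigma> \<longleftrightarrow> lt1 x (entry_pos ks (i - 1)) (entry_pos ks (j - 1))"
      using ij entry_pos_in_zeros[of "i - 1" ks] entry_pos_in_zeros[of "j - 1" ks]
      by (auto simp: perm_order_def lt1_def x entry_entry_pos ks)
  qed (auto simp: perm_order_def)
  have 2: "num_linear_extensions {1..n} (perm_order n (reverse_perm n \<sigma>)) = card (lext (lt2 x) (zeros x))"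
  proof (rule num_linear_extensions_eq_card_lext[OF _ b2 _ lt_order(3)])
    fix i j assume ij: "i \<in> {1..n}" "j \<in> {1..n}"
    then have "Suc (n - i) = Suc n - i" "Suc (n - j) = Suc n - j" by auto
    moreover have "entry_pos ks (n - j) < entry_pos ks (n - i) \<longleftrightarrow> i < j"
      using ij by (subst entry_pos_iff) auto
    ultimately show "(i, j) \<in> perm_order n (reverse_perm n \<sigma>) \<longleftrightarrow> lt2 x (entry_pos ks (n - i)) (entry_pos ks (n - j))"
      using ij entry_pos_in_zeros[of "n - i" ks] entry_pos_in_zeros[of "n - j" ks]
      by (auto simp: perm_order_def lt2_def x entry_entry_pos ks reverse_perm_def)
  qed (auto simp: perm_order_def)
  have fin: "finite (zeros x)" by (simp add: zeros_def)
  have "card (zeros x) = n" using bij_betw_same_card[OF b1] by simp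
  moreover have "card (lext (lt1 x) (zeros x)) * card (lext (lt2 x) (zeros x)) =
      fact (card (zeros x)) + card (witnesses (lt1 x) (lt2 x) (zeros x))"
    by (rule card_lext_product_witnesses[OF lt_order _ fin]) (auto simp: lt1_def lt2_def)
  ultimately show ?thesis
    unfolding eta_def 1 2 of_nat_mult[symmetric] by simp
qed

section \<open>Witnesses as bit matrices\<close>

text \<open>The witness word consists of five consecutive square bit matrices.\<close>

definition plane :: "bool list \<Rightarrow> bool list \<Rightarrow> nat \<Rightarrow> (nat \<times> nat) set" where
  "plane x y k = {(a, b). a < length x \<and> b < length x \<and>
     k * (length x * length x) + a * length x + b < length y \<and>
     y ! (k * (length x * length x) + a * length x + b)}"

definition of_planes :: "nat \<Rightarrow> (nat \<Rightarrow> (nat \<times> nat) set) \<Rightarrow> bool list" where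
  "of_planes N r = map (\<lambda>p. (p mod (N * N) div N, p mod N) \<in> r (p div (N * N))) [0..<5 * (N * N)]"

lemma length_of_planes [simp]: "length (of_planes N r) = 5 * (N * N)"
  by (simp add: of_planes_def)

text \<open>A position below \<open>5 * (N * N)\<close> is a number in mixed radix whose digits are
  plane, row and column; division and remainder recover them.\<close>

lemma plane_of_planes:
  assumes "k < 5" "r k \<subseteq> {..<length x} \<times> {..<length x}"
  shows "plane x (of_planes (length x) r) k = r k"
proof -
  let ?N = "length x"
  have "(a, b) \<in> plane x (of_planes ?N r) k \<longleftrightarrow> (a, b) \<in> r k" if ab: "a < ?N" "b < ?N" for a b
  proof -
    let ?p = "k * (?N * ?N) + a * ?N + b"
    have q: "a * ?N + b < ?N * ?N"
    proof -
      have "a * ?N + b < Suc a * ?N" using ab by simp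
      also have "\<dots> \<le> ?N * ?N" using ab by (intro mult_le_mono1) simp
      finally show ?thesis .
    qed
    have "?p < Suc k * (?N * ?N)" using q by simp
    also have "\<dots> \<le> 5 * (?N * ?N)" using assms(1) by (intro mult_le_mono1) simp
    finally have p: "?p < 5 * (?N * ?N)" .
    have "?p = k * (?N * ?N) + (a * ?N + b)" by simp
    then have 1: "?p div (?N * ?N) = k" "?p mod (?N * ?N) = a * ?N + b"
      using q by (simp_all only: div_mult_self3 mod_mult_self3 div_less mod_less)
    have 2: "(a * ?N + b) div ?N = a" "(a * ?N + b) mod ?N = b"
      using ab div_mult_self3[of ?N b a] by (cases "?N = 0", auto)
    have "?p mod ?N = (?p mod (?N * ?N)) mod ?N" by (simp add: mod_mult2_eq)
    then have 3: "?p mod ?N = b" using 1 2 by simp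
    have "of_planes ?N r ! ?p \<longleftrightarrow>
        (?p mod (?N * ?N) div ?N, ?p mod ?N) \<in> r (?p div (?N * ?N))"
      unfolding of_planes_def using p by (simp del: mod_mult_self3 mod_mult_self4)
    then have "of_planes ?N r ! ?p \<longleftrightarrow> (a, b) \<in> r k"
      unfolding 1 3 2 .
    then show ?thesis using p ab by (simp add: plane_def)
  qed
  then show ?thesis using assms(2) by (auto simp: plane_def)
qed

lemma of_planes_plane:
  assumes "length y = 5 * (length x * length x)"
  shows "of_planes (length x) (plane x y) = y"
proof (rule nth_equalityI)
  let ?N = "length x"
  fix p assume "p < length (of_planes ?N (plane x y))"
  then have p: "p < 5 * (?N * ?N)" by simp
  then have N: "0 < ?N" by (cases "?N = 0") auto
  let ?q = "p mod (?N * ?N)"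
  have "?q < ?N * ?N" using N by simp
  then have "?q div ?N < ?N" by (simp add: less_mult_imp_div_less)
  moreover have "p mod ?N = ?q mod ?N" by (simp add: mod_mult2_eq)
  then have "p div (?N * ?N) * (?N * ?N) + ?q div ?N * ?N + p mod ?N = p"
    by (metis add.assoc div_mult_mod_eq)
  ultimately show "of_planes ?N (plane x y) ! p = y ! p"
    using p N assms by (simp add: of_planes_def plane_def del: mod_mult_self3 mod_mult_self4)
qed (simp add: assms)

lemma plane_subset: "plane x y k \<subseteq> {..<length x} \<times> {..<length x}"
  by (auto simp: plane_def)

text \<open>
  Reflexive linear orders determine their domain. The chains are stored as sets of diagonal pairs;
  \<open>is_greedy_chain\<close> determines them uniquely, so they do not change the number of witnesses.
\<close>

definition valid :: "bool list \<Rightarrow> (nat \<times> nat) set \<Rightarrow> (nat \<times> nat) set \<Rightarrow> (nat \<times> nat) set \<Rightarrow>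
    (nat \<times> nat) set \<Rightarrow> (nat \<times> nat) set \<Rightarrow> bool" where
  "valid x W F G C D \<longleftrightarrow> (\<exists>A. A = {a. (a, a) \<in> F} \<and> A \<noteq> {} \<and> A \<subseteq> zeros x \<and>
     lin_order (zeros x - A) W \<and>
     lin_order A F \<and> (\<forall>a\<in>A. \<forall>b\<in>A. lt1 x a b \<longrightarrow> (a, b) \<in> F) \<and>
     lin_order A G \<and> (\<forall>a\<in>A. \<forall>b\<in>A. lt2 x a b \<longrightarrow> (a, b) \<in> G) \<and>
     C \<subseteq> Id \<and> is_greedy_chain (lt1 x) A F {a. (a, a) \<in> C} \<and>
     D \<subseteq> Id \<and> is_greedy_chain (lt2 x) A G {a. (a, a) \<in> D} \<and> C \<inter> D = {})"

definition relations :: "bool list \<Rightarrow> nat list \<times> nat list \<times> nat list \<Rightarrow> nat \<Rightarrow> (nat \<times> nat) set" where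
  "relations x = (\<lambda>(X, L1, L2) k. [before X, before L1, before L2,
     Id_on (chain (lt1 x) L1), Id_on (chain (lt2 x) L2)] ! k)"

lemma finite_zeros: "finite (zeros x)"
  by (simp add: zeros_def)

lemma valid_witness:
  assumes "valid x W F G C D"
  shows "\<exists>w\<in>witnesses (lt1 x) (lt2 x) (zeros x). \<forall>k<5. relations x w k = [W, F, G, C, D] ! k"
proof -
  obtain A where A: "A = {a. (a, a) \<in> F}" "A \<noteq> {}" "A \<subseteq> zeros x"
    and W: "lin_order (zeros x - A) W"
    and F: "lin_order A F" "\<forall>a\<in>A. \<forall>b\<in>A. lt1 x a b \<longrightarrow> (a, b) \<in> F"
    and G: "lin_order A G" "\<forall>a\<in>A. \<forall>b\<in>A. lt2 x a b \<longrightarrow> (a, b) \<in> G"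
    and C: "C \<subseteq> Id" "is_greedy_chain (lt1 x) A F {a. (a, a) \<in> C}"
    and D: "D \<subseteq> Id" "is_greedy_chain (lt2 x) A G {a. (a, a) \<in> D}"
    and CD: "C \<inter> D = {}"
    using assms unfolding valid_def by (elim exE conjE)
  have fin: "finite A" "finite (zeros x - A)"
    using A finite_zeros[of x] finite_subset by auto
  obtain X where X: "distinct X" "set X = zeros x - A" "before X = W"
    using lin_order_imp_before[OF fin(2) W] by (elim exE conjE)
  obtain L1 where L1: "distinct L1" "set L1 = A" "before L1 = F"
    using lin_order_imp_before[OF fin(1) F(1)] by (elim exE conjE)
  obtain L2 where L2: "distinct L2" "set L2 = A" "before L2 = G"
    using lin_order_imp_before[OF fin(1) G(1)] by (elim exE conjE)
  have L1': "L1 \<in> lext (lt1 x) A" using L1 F(2) by (simp add: lext_iff_before lt_order)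
  have L2': "L2 \<in> lext (lt2 x) A" using L2 G(2) by (simp add: lext_iff_before lt_order)
  \<comment> \<open>Uniqueness of the greedy chain identifies the stored diagonal with the chain of
    the reconstructed list.\<close>
  have C': "{a. (a, a) \<in> C} = chain (lt1 x) L1"
    using C(2) is_greedy_chain_iff[OF lt_order(1) fin(1) L1'] L1(3) by simp
  have D': "{a. (a, a) \<in> D} = chain (lt2 x) L2"
    using D(2) is_greedy_chain_iff[OF lt_order(3) fin(1) L2'] L2(3) by simp
  have "Id_on (chain (lt1 x) L1) = C" using C(1) unfolding C'[symmetric] by auto
  moreover have "Id_on (chain (lt2 x) L2) = D" using D(1) unfolding D'[symmetric] by auto
  moreover have "chain (lt1 x) L1 \<inter> chain (lt2 x) L2 = {}"
    using CD unfolding C'[symmetric] D'[symmetric] by auto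
  moreover have "zeros x - set X = A" "set X \<subset> zeros x" using X A by auto
  ultimately show ?thesis
    using X L1 L2 L1' L2'
    by (intro bexI[of _ "(X, L1, L2)"])
      (auto simp: relations_def witnesses_def disjoint_chains_def less_Suc_eq numeral_eq_Suc)
qed

lemma witness_valid:
  assumes "w \<in> witnesses (lt1 x) (lt2 x) (zeros x)"
  shows "valid x (relations x w 0) (relations x w 1) (relations x w 2) (relations x w 3) (relations x w 4)"
proof -
  obtain X L1 L2 where w: "w = (X, L1, L2)" by (cases w) auto
  define A where "A = zeros x - set X"
  have X: "distinct X" "set X \<subset> zeros x" and L1: "L1 \<in> lext (lt1 x) A" and L2: "L2 \<in> lext (lt2 x) A"
    and disj: "chain (lt1 x) L1 \<inter> chain (lt2 x) L2 = {}"
    using assms by (auto simp: w A_def witnesses_def disjoint_chains_def)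
  have fin: "finite A" by (simp add: A_def finite_zeros)
  have A: "A = {a. (a, a) \<in> before L1}" using L1 by (auto simp: before_refl lext_def)
  have A': "zeros x - A = set X" "A \<noteq> {}" "A \<subseteq> zeros x" using X by (auto simp: A_def)
  note L1b = L1[unfolded lext_iff_before[OF lt_order(1)]]
    and L2b = L2[unfolded lext_iff_before[OF lt_order(3)]]
  have "is_greedy_chain (lt1 x) A (before L1) (chain (lt1 x) L1)"
    using is_greedy_chain_iff[OF lt_order(1) fin L1] by simp
  moreover have "is_greedy_chain (lt2 x) A (before L2) (chain (lt2 x) L2)"
    using is_greedy_chain_iff[OF lt_order(3) fin L2] by simp
  moreover have "lin_order (zeros x - A) (before X)" using lin_order_before[OF X(1)] A' by simp
  moreover have "lin_order A (before L1)" "lin_order A (before L2)" using lin_order_before[of L1] lin_order_before[of L2] L1b L2b by auto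
  moreover have "Id_on (chain (lt1 x) L1) \<inter> Id_on (chain (lt2 x) L2) = {}" using disj by auto
  moreover have diag: "{a. (a, a) \<in> Id_on B} = B" and "Id_on B \<subseteq> Id" for B :: "nat set" by auto
  ultimately have "valid x (before X) (before L1) (before L2) (Id_on (chain (lt1 x) L1)) (Id_on (chain (lt2 x) L2))"
    unfolding valid_def diag using L1b L2b by (intro exI[of _ A] conjI A A'(2,3)) simp_all
  then show ?thesis
    by (simp add: relations_def w numeral_eq_Suc)
qed

text \<open>Fixing the length exactly excludes bits outside the five planes, so \<open>y\<close> is
  determined by its planes and no witness is counted twice.\<close>

definition checks :: "bool list \<Rightarrow> bool list \<Rightarrow> bool" where
  "checks x y \<longleftrightarrow> is_code x \<and> length y = 5 * (length x * length x) \<and>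
     valid x (plane x y 0) (plane x y 1) (plane x y 2) (plane x y 3) (plane x y 4)"

lemma relations_subset:
  assumes "w \<in> witnesses (lt1 x) (lt2 x) (zeros x)" "k < 5"
  shows "relations x w k \<subseteq> {..<length x} \<times> {..<length x}"
proof -
  obtain X L1 L2 where w: "w = (X, L1, L2)" by (cases w) auto
  have "zeros x \<subseteq> {..<length x}" by (auto simp: zeros_def)
  then have X: "set X \<subseteq> {..<length x}" "set L1 \<subseteq> {..<length x}" "set L2 \<subseteq> {..<length x}"
    using assms(1) by (auto simp: w witnesses_def disjoint_chains_def lext_def)
  have "before L \<subseteq> {..<length x} \<times> {..<length x}" if "set L \<subseteq> {..<length x}" for L
    using before_subset[of L] that by auto
  note before = this[OF X(1)] this[OF X(2)] this[OF X(3)]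
  have "Id_on (chain lt L) \<subseteq> {..<length x} \<times> {..<length x}" if "set L \<subseteq> {..<length x}" for L and lt :: "nat \<Rightarrow> nat \<Rightarrow> bool"
    using chain_subset[of lt L] that by auto
  note this[OF X(2)] this[OF X(3)]
  then show ?thesis
    using assms(2) before unfolding relations_def w
    by (simp add: numeral_eq_Suc less_Suc_eq) (elim disjE; simp)
qed

lemma card_checks:
  assumes "is_code x"
  shows "card {y. checks x y} = card (witnesses (lt1 x) (lt2 x) (zeros x))"
proof -
  let ?W = "witnesses (lt1 x) (lt2 x) (zeros x)"
  define enc where "enc w = of_planes (length x) (relations x w)" for w
  have plane: "plane x (enc w) k = relations x w k" if "w \<in> ?W" "k < 5" for w k
    unfolding enc_def using that by (intro plane_of_planes relations_subset)
  have "bij_betw enc ?W {y. checks x y}"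
  proof (rule bij_betw_imageI)
    show "inj_on enc ?W"
    proof (rule inj_onI)
      fix w w' assume w: "w \<in> ?W" "w' \<in> ?W" "enc w = enc w'"
      obtain X L1 L2 where 1: "w = (X, L1, L2)" by (cases w) auto
      obtain X' L1' L2' where 2: "w' = (X', L1', L2')" by (cases w') auto
      have *: "relations x w k = relations x w' k" if "k < 5" for k
        using plane[OF w(1) that] plane[OF w(2) that] w(3) by simp
      \<comment> \<open>The first three planes already determine the three lists; the two chain
        planes are functions of them.\<close>
      have "before X = before X'" "before L1 = before L1'" "before L2 = before L2'"
        using *[of 0] *[of 1] *[of 2] by (simp_all add: relations_def 1 2)
      moreover have "distinct X" "distinct X'" "distinct L1" "distinct L1'" "distinct L2" "distinct L2'"
        using w(1,2) by (simp_all add: 1 2 witnesses_def disjoint_chains_def lext_def)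
      ultimately show "w = w'" using before_inject 1 2 by auto
    qed
    show "enc ` ?W = {y. checks x y}"
    proof (intro equalityI subsetI)
      fix y assume "y \<in> enc ` ?W"
      then obtain w where w: "w \<in> ?W" "y = enc w" by auto
      have "length y = 5 * (length x * length x)" by (simp add: w(2) enc_def)
      then show "y \<in> {y. checks x y}"
        using witness_valid[OF w(1)] assms by (simp add: checks_def w(2) plane[OF w(1)])
    next
      fix y assume "y \<in> {y. checks x y}"
      then have len: "length y = 5 * (length x * length x)"
        and "valid x (plane x y 0) (plane x y 1) (plane x y 2) (plane x y 3) (plane x y 4)"
        by (simp_all add: checks_def)
      from valid_witness[OF this(2)] obtain w where w: "w \<in> ?W"
        "\<forall>k<5. relations x w k = [plane x y 0, plane x y 1, plane x y 2, plane x y 3, plane x y 4] ! k"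
        by (elim bexE)
      have "relations x w k = plane x y k" if "k < 5" for k
      proof -
        have "k \<in> {0, 1, 2, 3, 4}" using that by auto
        then show ?thesis using w(2) by (elim insertE emptyE) simp_all
      qed
      \<comment> \<open>Agreement on the five planes suffices: a position
        \<open>p < 5 * (N * N)\<close> only consults plane \<open>p div (N * N) < 5\<close>.\<close>
      then have "enc w = of_planes (length x) (plane x y)"
        by (auto simp: enc_def of_planes_def less_mult_imp_div_less)
      then have "enc w = y" using of_planes_plane[OF len] by simp
      then show "y \<in> enc ` ?W" using w(1) by blast
    qed
  qed
  then show ?thesis by (rule bij_betw_same_card[symmetric])
qed

section \<open>Definability of the witness relation\<close>

lemma definable_cong:
  assumes "definable j P" "\<And>x y e. P x y e = Q x y e"
  shows "definable j Q"
proof -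
  have "P = Q" by (intro ext) (rule assms(2))
  then show ?thesis using assms(1) by simp
qed

lemma definable_disj:
  assumes "definable j P" "definable j Q"
  shows "definable j (\<lambda>x y e. P x y e \<or> Q x y e)"
proof (rule definable_cong)
  show "definable j (\<lambda>x y e. \<not> (\<not> P x y e \<and> \<not> Q x y e))"
    by (intro definable_not definable_conj assms)
qed simp

lemma definable_imp:
  assumes "definable j P" "definable j Q"
  shows "definable j (\<lambda>x y e. P x y e \<longrightarrow> Q x y e)"
proof (rule definable_cong)
  show "definable j (\<lambda>x y e. \<not> P x y e \<or> Q x y e)"
    by (intro definable_not definable_disj assms)
qed simp

lemma definable_iff:
  assumes "definable j P" "definable j Q"
  shows "definable j (\<lambda>x y e. P x y e \<longleftrightarrow> Q x y e)"
proof (rule definable_cong)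
  show "definable j (\<lambda>x y e. (P x y e \<longrightarrow> Q x y e) \<and> (Q x y e \<longrightarrow> P x y e))"
    by (intro definable_imp definable_conj assms)
qed auto

lemma definable_eq:
  assumes "eterm j T" "eterm j U"
  shows "definable j (\<lambda>x y e. T x y e = U x y e)"
proof (rule definable_cong)
  show "definable j (\<lambda>x y e. \<not> T x y e < U x y e \<and> \<not> U x y e < T x y e)"
    by (intro definable_not definable_conj definable_less assms)
qed auto

lemma definable_Ball:
  assumes "definable (Suc (Suc j)) (\<lambda>x y e. Q x y e (e j))"
    and "\<And>x y e a b c. Q x y (e(j := a, Suc j := b)) c = Q x y e c"
  shows "definable j (\<lambda>x y e. \<forall>a<length x. Q x y e a)"
proof (rule definable_cong)
  show "definable j (\<lambda>x y e. \<not> (\<exists>a<length x. \<not> Q x y e a))"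
    by (intro definable_not definable_Bex assms(1)) (simp add: assms(2))
qed simp

lemmas eterm_intros = eterm_plus eterm_times_length eterm_times_var eterm_length eterm_var eterm_const

lemmas definable_intros =
  definable_conj definable_disj definable_not definable_imp definable_iff definable_Bex
  definable_Ball definable_less definable_eq

lemma bit_symbol_eq: "bit_symbol b = 2 \<longleftrightarrow> b" "bit_symbol b = Suc 0 \<longleftrightarrow> \<not> b" "bit_symbol b \<noteq> 0"
  by (simp_all add: bit_symbol_def)

lemma definable_zeros:
  assumes "v < j"
  shows "definable j (\<lambda>x y e. e v \<in> zeros x)"
proof (rule definable_cong)
  show "definable j (\<lambda>x y e. e v < length x \<and> sym (pair_word x y) (e v) = 1)"
    by (intro definable_conj definable_less definable_sym eterm_intros assms)
qed (auto simp: zeros_def sym_pair_word bit_symbol_eq)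

lemma definable_ones:
  assumes "v < j"
  shows "definable j (\<lambda>x y e. e v < length x \<and> x ! (e v))"
proof (rule definable_cong)
  show "definable j (\<lambda>x y e. e v < length x \<and> sym (pair_word x y) (e v) = 2)"
    by (intro definable_conj definable_less definable_sym eterm_intros assms)
qed (auto simp: sym_pair_word bit_symbol_eq)

lemma definable_plane:
  assumes "u < j" "v < j"
  shows "definable j (\<lambda>x y e. (e u, e v) \<in> plane x y k)"
proof (rule definable_cong)
  \<comment> \<open>The summand \<open>1 + length x\<close> skips \<open>x\<close> and the
    separator, the rest is the index in \<open>y\<close>. Behind \<open>y\<close> the blank is read,
    so finding the symbol 2 also shows that the index is below \<open>length y\<close>.\<close>
  let ?T = "\<lambda>(x :: bool list) (y :: bool list) (e :: nat \<Rightarrow> nat). 1 + length x + (length x * (length x * k) + e u * length x + e v)"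
  show "definable j (\<lambda>x y e. e u < length x \<and> e v < length x \<and> sym (pair_word x y) (?T x y e) = 2)"
    by (intro definable_conj definable_less definable_sym eterm_intros assms)
  fix x y and e :: "nat \<Rightarrow> nat"
  have *: "sym (pair_word x y) (1 + length x + p) = 2 \<longleftrightarrow> p < length y \<and> y ! p" for p
    by (simp add: sym_pair_word bit_symbol_eq)
  show "(e u < length x \<and> e v < length x \<and> sym (pair_word x y) (?T x y e) = 2) =
      ((e u, e v) \<in> plane x y k)"
    unfolding * by (simp add: plane_def mult.commute mult.left_commute)
qed

text \<open>No quantifier reaches the end of \<open>y\<close>, but its length shows at the first
  blank: the input fills the positions up to \<open>length x + length y\<close>, so two adjacent
  cells decide the equation.\<close>

lemma definable_length_eq: "definable j (\<lambda>x y e. length y = 5 * (length x * length x))"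
proof (rule definable_cong)
  show "definable j (\<lambda>x y e. \<not> sym (pair_word x y) (length x + length x * (length x * 5)) = 0 \<and>
      sym (pair_word x y) (1 + (length x + length x * (length x * 5))) = 0)"
    by (intro definable_conj definable_not definable_sym eterm_intros)
  fix x y and e :: "nat \<Rightarrow> nat"
  have *: "sym (pair_word x y) p = 0 \<longleftrightarrow> length x + length y < p" for p
    by (auto simp: sym_pair_word bit_symbol_def)
  show "(\<not> sym (pair_word x y) (length x + length x * (length x * 5)) = 0 \<and>
      sym (pair_word x y) (1 + (length x + length x * (length x * 5))) = 0) =
      (length y = 5 * (length x * length x))"
    unfolding * by (auto simp: mult.commute mult.left_commute)
qed

text \<open>\<open>entry\<close> is not among the terms, so it is only accessed through comparisons
  \<open>k < entry x a\<close>. Such a comparison holds if some start \<open>s\<close> of a stretch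
  of ones reaching up to \<open>a\<close> satisfies \<open>k + s < a\<close>; the least start is the
  most favourable one.\<close>

lemma definable_entry_gt:
  assumes "u < j" "v < j"
  shows "definable j (\<lambda>x y e. e v < length x \<and> e u < entry x (e v))"
proof (rule definable_cong)
  show "definable j (\<lambda>x y e. e v < length x \<and> (\<exists>s<length x. e u + s < e v \<and>
      (\<forall>c<length x. c < s \<or> e v < c \<or> e v = c \<or> c < length x \<and> x ! c)))"
    by (intro definable_intros definable_ones eterm_intros) (use assms in \<open>simp_all\<close>)
  fix x y and e :: "nat \<Rightarrow> nat"
  let ?a = "e v" and ?k = "e u"
  define P where "P s \<longleftrightarrow> (\<forall>c. s \<le> c \<longrightarrow> c < ?a \<longrightarrow> x ! c)" for s
  have "P ?a" by (simp add: P_def)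
  then have P: "P (run_start x ?a)" and le: "\<And>s. P s \<Longrightarrow> run_start x ?a \<le> s"
    unfolding run_start_def P_def[symmetric] by (auto intro: LeastI Least_le)
  have iff: "(\<forall>c<length x. c < s \<or> e v < c \<or> e v = c \<or> c < length x \<and> x ! c) \<longleftrightarrow> P s"
    if "?a < length x" for s
    using that unfolding P_def by (metis leI less_trans linorder_not_less nat_less_le)
  have "(\<exists>s<length x. ?k + s < ?a \<and> P s) \<longleftrightarrow> ?k < entry x ?a" if a: "?a < length x"
  proof
    assume "\<exists>s<length x. ?k + s < ?a \<and> P s"
    then obtain s where "?k + s < ?a" "P s" by (elim exE conjE)
    then show "?k < entry x ?a" using le[of s] by (simp add: entry_def)
  next
    assume k: "?k < entry x ?a"
    then have "?k + run_start x ?a < ?a" by (simp add: entry_def)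
    then show "\<exists>s<length x. ?k + s < ?a \<and> P s"
      using a P by (intro exI[of _ "run_start x ?a"]) simp
  qed
  note gt = this
  show "(?a < length x \<and> (\<exists>s<length x. e u + s < e v \<and>
      (\<forall>c<length x. c < s \<or> e v < c \<or> e v = c \<or> c < length x \<and> x ! c))) =
      (?a < length x \<and> ?k < entry x ?a)"
    by (rule conj_cong[OF refl]) (simp only: iff gt)
qed

lemma entry_less:
  assumes "a < length x" "b < length x"
  shows "entry x a < entry x b \<longleftrightarrow>
    (\<exists>k<length x. \<not> (a < length x \<and> k < entry x a) \<and> b < length x \<and> k < entry x b)"
proof
  have "entry x a < length x" using assms by (simp add: entry_def)
  then show "\<exists>k<length x. \<not> (a < length x \<and> k < entry x a) \<and> b < length x \<and> k < entry x b"
    if "entry x a < entry x b"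
    using assms that by (intro exI[of _ "entry x a"]) simp
qed (use assms in auto)

lemma definable_lt1:
  assumes "u < j" "v < j"
  shows "definable j (\<lambda>x y e. lt1 x (e u) (e v))"
proof (rule definable_cong)
  show "definable j (\<lambda>x y e. e u \<in> zeros x \<and> e v \<in> zeros x \<and> e u < e v \<and>
      (\<exists>k<length x. \<not> (e u < length x \<and> k < entry x (e u)) \<and> (e v < length x \<and> k < entry x (e v))))"
    by (intro definable_entry_gt definable_zeros definable_intros eterm_intros)
      (use assms in \<open>simp_all\<close>)
  fix x y and e :: "nat \<Rightarrow> nat"
  show "(e u \<in> zeros x \<and> e v \<in> zeros x \<and> e u < e v \<and>
      (\<exists>k<length x. \<not> (e u < length x \<and> k < entry x (e u)) \<and> (e v < length x \<and> k < entry x (e v)))) =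
      lt1 x (e u) (e v)"
    using entry_less[of "e u" x "e v"] by (auto simp: lt1_def zeros_def)
qed

lemma definable_lt2:
  assumes "u < j" "v < j"
  shows "definable j (\<lambda>x y e. lt2 x (e u) (e v))"
proof (rule definable_cong)
  show "definable j (\<lambda>x y e. e u \<in> zeros x \<and> e v \<in> zeros x \<and> e v < e u \<and>
      (\<exists>k<length x. \<not> (e u < length x \<and> k < entry x (e u)) \<and> (e v < length x \<and> k < entry x (e v))))"
    by (intro definable_entry_gt definable_zeros definable_intros eterm_intros)
      (use assms in \<open>simp_all\<close>)
  fix x y and e :: "nat \<Rightarrow> nat"
  show "(e u \<in> zeros x \<and> e v \<in> zeros x \<and> e v < e u \<and>
      (\<exists>k<length x. \<not> (e u < length x \<and> k < entry x (e u)) \<and> (e v < length x \<and> k < entry x (e v)))) =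
      lt2 x (e u) (e v)"
    using entry_less[of "e u" x "e v"] by (auto simp: lt2_def zeros_def)
qed

lemma zeros_Ball: "(\<forall>a<length x. a \<in> zeros x \<longrightarrow> P a) \<longleftrightarrow> (\<forall>a\<in>zeros x. P a)"
  by (auto simp: zeros_def)

lemma zeros_Bex: "(\<exists>a<length x. a \<in> zeros x \<and> P a) \<longleftrightarrow> (\<exists>a\<in>zeros x. P a)"
  by (auto simp: zeros_def)

lemma initial_segment_eq:
  fixes k k' :: nat
  assumes "k < n" "k' < n"
  shows "(\<forall>m<n. m < k \<longleftrightarrow> m < k') \<longleftrightarrow> k = k'"
proof
  assume *: "\<forall>m<n. m < k \<longleftrightarrow> m < k'"
  have "\<not> k < k'" using *[rule_format, OF assms(1)] by simp
  moreover have "\<not> k' < k" using *[rule_format, OF assms(2)] by simp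
  ultimately show "k = k'" by simp
qed simp

text \<open>Entries are smaller than \<open>length x\<close>, so all quantifiers can be bounded, and
  an equation between entries becomes equality of the initial segments below them. The repeated
  guards such as \<open>a < length x\<close> give the subformulas the shape provided by
  \<open>definable_entry_gt\<close> and \<open>definable_ones\<close>.\<close>

lemma is_code_iff_bounded:
  "is_code x \<longleftrightarrow>
     (\<forall>a<length x. (a < length x \<and> x ! a) \<longrightarrow> (\<exists>b<length x. b \<in> zeros x \<and> a < b)) \<and>
     (\<forall>a<length x. a \<in> zeros x \<longrightarrow> (\<exists>k<length x. a < length x \<and> k < entry x a)) \<and>
     (\<forall>a<length x. a \<in> zeros x \<longrightarrow> (\<forall>b<length x. b \<in> zeros x \<longrightarrow>
        (\<forall>k<length x. (a < length x \<and> k < entry x a) \<longleftrightarrow> (b < length x \<and> k < entry x b)) \<longrightarrow> a = b)) \<and>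
     (\<forall>a<length x. a \<in> zeros x \<longrightarrow> (\<forall>k<length x. 0 < k \<longrightarrow> (a < length x \<and> k < entry x a) \<longrightarrow>
        (\<exists>b<length x. b \<in> zeros x \<and> (\<forall>m<length x. (b < length x \<and> m < entry x b) \<longleftrightarrow> m < k))))"
  unfolding is_code_iff zeros_Ball zeros_Bex
proof (intro arg_cong2[where f = "(\<and>)"] ball_cong refl)
  have z: "a < length x" "entry x a < length x" if "a \<in> zeros x" for a
    using that by (auto simp: zeros_def entry_def)
  show "(\<forall>a<length x. x ! a \<longrightarrow> (\<exists>b<length x. a < b \<and> \<not> x ! b)) \<longleftrightarrow>
      (\<forall>a<length x. (a < length x \<and> x ! a) \<longrightarrow> (\<exists>b\<in>zeros x. a < b))"
    by (auto simp: zeros_def)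
  show "0 < entry x a \<longleftrightarrow> (\<exists>k<length x. a < length x \<and> k < entry x a)" if "a \<in> zeros x" for a
  proof
    assume "0 < entry x a"
    then show "\<exists>k<length x. a < length x \<and> k < entry x a"
      using z[OF that] by (intro exI[of _ 0]) linarith
  qed auto
  show "(entry x a = entry x b \<longrightarrow> a = b) \<longleftrightarrow>
      ((\<forall>k<length x. (a < length x \<and> k < entry x a) \<longleftrightarrow> (b < length x \<and> k < entry x b)) \<longrightarrow> a = b)"
    if "a \<in> zeros x" "b \<in> zeros x" for a b
    using z[OF that(1)] z[OF that(2)] by (simp add: initial_segment_eq)
  have eq: "(\<forall>m<length x. (b < length x \<and> m < entry x b) \<longleftrightarrow> m < k) \<longleftrightarrow> entry x b = k"
    if "b \<in> zeros x" "k < length x" for b k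
    using z[OF that(1)] that(2) by (simp add: initial_segment_eq)
  show "(\<forall>k. 0 < k \<longrightarrow> k < entry x a \<longrightarrow> (\<exists>b\<in>zeros x. entry x b = k)) \<longleftrightarrow>
      (\<forall>k<length x. 0 < k \<longrightarrow> (a < length x \<and> k < entry x a) \<longrightarrow>
        (\<exists>b\<in>zeros x. \<forall>m<length x. (b < length x \<and> m < entry x b) \<longleftrightarrow> m < k))"
    if "a \<in> zeros x" for a
  proof (intro iffI allI impI)
    fix k assume *: "\<forall>k. 0 < k \<longrightarrow> k < entry x a \<longrightarrow> (\<exists>b\<in>zeros x. entry x b = k)"
      and k: "k < length x" "0 < k" "a < length x \<and> k < entry x a"
    from * k obtain b where "b \<in> zeros x" "entry x b = k" by auto
    then show "\<exists>b\<in>zeros x. \<forall>m<length x. (b < length x \<and> m < entry x b) \<longleftrightarrow> m < k"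
      using eq[of b k] k(1) by (intro bexI[of _ b]) simp_all
  next
    fix k assume *: "\<forall>k<length x. 0 < k \<longrightarrow> (a < length x \<and> k < entry x a) \<longrightarrow>
        (\<exists>b\<in>zeros x. \<forall>m<length x. (b < length x \<and> m < entry x b) \<longleftrightarrow> m < k)"
      and k: "0 < k" "k < entry x a"
    have "k < length x" using k z[OF that] by simp
    with * k z[OF that] obtain b where "b \<in> zeros x"
      "\<forall>m<length x. (b < length x \<and> m < entry x b) \<longleftrightarrow> m < k" by blast
    then show "\<exists>b\<in>zeros x. entry x b = k"
      using eq[of b k] \<open>k < length x\<close> by (intro bexI[of _ b]) simp_all
  qed
qed

lemma definable_is_code: "definable 0 (\<lambda>x y e. is_code x)"
  unfolding is_code_iff_bounded
  by (intro definable_entry_gt definable_ones definable_zeros definable_intros eterm_intros) simp_all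

section \<open>Defining orders and chains\<close>

text \<open>Membership in \<open>S\<close> and \<open>F\<close> is assumed definable for every
  \<open>j\<close>, because the tests occur under different numbers of quantifiers and hence in
  environments of different length. The inclusions in \<open>sub\<close> let quantifiers below
  \<open>length x\<close> reach all elements.\<close>

lemma definable_lin_order:
  assumes S: "\<And>j v. v < j \<Longrightarrow> definable j (\<lambda>x y e. e v \<in> S x y)"
    and F: "\<And>j u v. u < j \<Longrightarrow> v < j \<Longrightarrow> definable j (\<lambda>x y e. (e u, e v) \<in> F x y)"
    and sub: "\<And>x y. S x y \<subseteq> {..<length x}" "\<And>x y. F x y \<subseteq> {..<length x} \<times> {..<length x}"
  shows "definable 0 (\<lambda>x y e. lin_order (S x y) (F x y))"
proof (rule definable_cong)
  show "definable 0 (\<lambda>x y e.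
      (\<forall>a<length x. \<forall>b<length x. (a, b) \<in> F x y \<longrightarrow> a \<in> S x y \<and> b \<in> S x y) \<and>
      (\<forall>a<length x. \<forall>b<length x. a \<in> S x y \<and> b \<in> S x y \<longrightarrow> (a, b) \<in> F x y \<or> (b, a) \<in> F x y) \<and>
      (\<forall>a<length x. \<forall>b<length x. (a, b) \<in> F x y \<and> (b, a) \<in> F x y \<longrightarrow> a = b) \<and>
      (\<forall>a<length x. \<forall>b<length x. \<forall>c<length x.
         (a, b) \<in> F x y \<and> (b, c) \<in> F x y \<longrightarrow> (a, c) \<in> F x y))"
    by (intro S F definable_intros eterm_intros) simp_all
  fix x y and e :: "nat \<Rightarrow> nat"
  have S: "a < length x" if "a \<in> S x y" for a using sub(1) that by auto
  have F: "a < length x" "b < length x" if "(a, b) \<in> F x y" for a b using sub(2) that by auto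
  show "((\<forall>a<length x. \<forall>b<length x. (a, b) \<in> F x y \<longrightarrow> a \<in> S x y \<and> b \<in> S x y) \<and>
      (\<forall>a<length x. \<forall>b<length x. a \<in> S x y \<and> b \<in> S x y \<longrightarrow> (a, b) \<in> F x y \<or> (b, a) \<in> F x y) \<and>
      (\<forall>a<length x. \<forall>b<length x. (a, b) \<in> F x y \<and> (b, a) \<in> F x y \<longrightarrow> a = b) \<and>
      (\<forall>a<length x. \<forall>b<length x. \<forall>c<length x.
         (a, b) \<in> F x y \<and> (b, c) \<in> F x y \<longrightarrow> (a, c) \<in> F x y)) = lin_order (S x y) (F x y)"
  proof
    assume lin_order: "lin_order (S x y) (F x y)"
    show "(\<forall>a<length x. \<forall>b<length x. (a, b) \<in> F x y \<longrightarrow> a \<in> S x y \<and> b \<in> S x y) \<and>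
      (\<forall>a<length x. \<forall>b<length x. a \<in> S x y \<and> b \<in> S x y \<longrightarrow> (a, b) \<in> F x y \<or> (b, a) \<in> F x y) \<and>
      (\<forall>a<length x. \<forall>b<length x. (a, b) \<in> F x y \<and> (b, a) \<in> F x y \<longrightarrow> a = b) \<and>
      (\<forall>a<length x. \<forall>b<length x. \<forall>c<length x.
         (a, b) \<in> F x y \<and> (b, c) \<in> F x y \<longrightarrow> (a, c) \<in> F x y)"
      using lin_orderD[OF lin_order] by (intro conjI allI impI) (auto 0 2)
  next
    assume *: "(\<forall>a<length x. \<forall>b<length x. (a, b) \<in> F x y \<longrightarrow> a \<in> S x y \<and> b \<in> S x y) \<and>
      (\<forall>a<length x. \<forall>b<length x. a \<in> S x y \<and> b \<in> S x y \<longrightarrow> (a, b) \<in> F x y \<or> (b, a) \<in> F x y) \<and>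
      (\<forall>a<length x. \<forall>b<length x. (a, b) \<in> F x y \<and> (b, a) \<in> F x y \<longrightarrow> a = b) \<and>
      (\<forall>a<length x. \<forall>b<length x. \<forall>c<length x.
         (a, b) \<in> F x y \<and> (b, c) \<in> F x y \<longrightarrow> (a, c) \<in> F x y)"
    show "lin_order (S x y) (F x y)"
    proof (rule lin_orderI)
      show "F x y \<subseteq> S x y \<times> S x y"
        using *[THEN conjunct1, rule_format, OF F] by auto
      show "(a, b) \<in> F x y \<or> (b, a) \<in> F x y" if "a \<in> S x y" "b \<in> S x y" for a b
        using *[THEN conjunct2, THEN conjunct1, rule_format, OF S S] that by blast
      show "a = b" if "(a, b) \<in> F x y" "(b, a) \<in> F x y" for a b
        using *[THEN conjunct2, THEN conjunct2, THEN conjunct1, rule_format, of a b] F that by blast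
      show "(a, c) \<in> F x y" if "(a, b) \<in> F x y" "(b, c) \<in> F x y" for a b c
        using *[THEN conjunct2, THEN conjunct2, THEN conjunct2, rule_format, of a b c]
          F[OF that(1)] F[OF that(2)] that by blast
    qed
  qed
qed

lemma definable_extends:
  assumes S: "\<And>j v. v < j \<Longrightarrow> definable j (\<lambda>x y e. e v \<in> S x y)"
    and F: "\<And>j u v. u < j \<Longrightarrow> v < j \<Longrightarrow> definable j (\<lambda>x y e. (e u, e v) \<in> F x y)"
    and lt: "\<And>j u v. u < j \<Longrightarrow> v < j \<Longrightarrow> definable j (\<lambda>x y e. lt x (e u) (e v))"
    and sub: "\<And>x y. S x y \<subseteq> {..<length x}"
  shows "definable 0 (\<lambda>x y e. \<forall>a\<in>S x y. \<forall>b\<in>S x y. lt x a b \<longrightarrow> (a, b) \<in> F x y)"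
proof (rule definable_cong)
  show "definable 0 (\<lambda>x y e. \<forall>a<length x. a \<in> S x y \<longrightarrow>
      (\<forall>b<length x. b \<in> S x y \<longrightarrow> lt x a b \<longrightarrow> (a, b) \<in> F x y))"
    by (intro S F lt definable_intros eterm_intros) simp_all
  fix x y and e :: "nat \<Rightarrow> nat"
  show "(\<forall>a<length x. a \<in> S x y \<longrightarrow>
      (\<forall>b<length x. b \<in> S x y \<longrightarrow> lt x a b \<longrightarrow> (a, b) \<in> F x y)) =
      (\<forall>a\<in>S x y. \<forall>b\<in>S x y. lt x a b \<longrightarrow> (a, b) \<in> F x y)"
    using sub[of x y] by (auto simp: subset_eq)
qed

lemma definable_is_greedy_chain:
  assumes S: "\<And>j v. v < j \<Longrightarrow> definable j (\<lambda>x y e. e v \<in> S x y)"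
    and F: "\<And>j u v. u < j \<Longrightarrow> v < j \<Longrightarrow> definable j (\<lambda>x y e. (e u, e v) \<in> F x y)"
    and C: "\<And>j v. v < j \<Longrightarrow> definable j (\<lambda>x y e. e v \<in> C x y)"
    and lt: "\<And>j u v. u < j \<Longrightarrow> v < j \<Longrightarrow> definable j (\<lambda>x y e. lt x (e u) (e v))"
    and sub: "\<And>x y. S x y \<subseteq> {..<length x}" "\<And>x y. C x y \<subseteq> {..<length x}"
  shows "definable 0 (\<lambda>x y e. is_greedy_chain (lt x) (S x y) (F x y) (C x y))"
proof (rule definable_cong)
  show "definable 0 (\<lambda>x y e. \<forall>c<length x. c \<in> C x y \<longleftrightarrow> c \<in> S x y \<and>
      ((\<forall>a<length x. a \<in> S x y \<longrightarrow> (c, a) \<in> F x y) \<or>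
       (\<exists>d<length x. d \<in> C x y \<and> lt x d c \<and>
          (\<forall>a<length x. a \<in> S x y \<longrightarrow> lt x d a \<longrightarrow> (c, a) \<in> F x y))))"
    by (intro S F C lt definable_intros eterm_intros) simp_all
  fix x y and e :: "nat \<Rightarrow> nat"
  have S: "(\<forall>a<length x. a \<in> S x y \<longrightarrow> P a) \<longleftrightarrow> (\<forall>a\<in>S x y. P a)" for P
    using sub(1)[of x y] by (auto simp: subset_eq)
  have C: "(\<exists>a<length x. a \<in> C x y \<and> P a) \<longleftrightarrow> (\<exists>a\<in>C x y. P a)" for P
    using sub(2)[of x y] by (auto simp: subset_eq)
  have all: "(\<forall>c<length x. c \<in> C x y \<longleftrightarrow> c \<in> S x y \<and> P c) \<longleftrightarrow> (\<forall>c. c \<in> C x y \<longleftrightarrow> c \<in> S x y \<and> P c)" for P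
    using sub(1,2)[of x y] unfolding subset_eq lessThan_iff by blast
  show "(\<forall>c<length x. c \<in> C x y \<longleftrightarrow> c \<in> S x y \<and>
      ((\<forall>a<length x. a \<in> S x y \<longrightarrow> (c, a) \<in> F x y) \<or>
       (\<exists>d<length x. d \<in> C x y \<and> lt x d c \<and>
          (\<forall>a<length x. a \<in> S x y \<longrightarrow> lt x d a \<longrightarrow> (c, a) \<in> F x y)))) =
      is_greedy_chain (lt x) (S x y) (F x y) (C x y)"
    unfolding is_greedy_chain_def S C all ..
qed

lemma definable_checks: "definable 0 (\<lambda>x y e. checks x y)"
proof (rule definable_cong)
  \<comment> \<open>The set \<open>A\<close> that \<open>valid\<close> introduces existentially is
    the diagonal of plane 1, so no quantifier over sets remains.\<close>
  define S where "S k x y = {a. (a, a) \<in> plane x y k}" for k x y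
  define T where "T x y = zeros x - S 1 x y" for x y
  have zeros: "zeros x \<subseteq> {..<length x}" for x by (auto simp: zeros_def)
  have sub: "S k x y \<subseteq> {..<length x}" "T x y \<subseteq> {..<length x}" for k x y
    using plane_subset[of x y k] zeros[of x] by (auto simp: S_def T_def)
  have S: "definable j (\<lambda>x y e. e v \<in> S k x y)" if "v < j" for j v k
    using definable_plane[OF that that] by (simp add: S_def)
  have T: "definable j (\<lambda>x y e. e v \<in> T x y)" if "v < j" for j v
    unfolding T_def Diff_iff using that by (intro definable_conj definable_not definable_zeros S)
  have sub_zeros: "definable 0 (\<lambda>x y e. \<forall>a<length x. a \<in> S 1 x y \<longrightarrow> a \<in> zeros x)"
    by (intro definable_zeros S definable_intros) simp_all
  have nonempty: "definable 0 (\<lambda>x y e. \<exists>a<length x. a \<in> S 1 x y)"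
    by (intro S definable_intros) simp_all
  have diag: "definable 0 (\<lambda>x y e. \<forall>a<length x. \<forall>b<length x. (a, b) \<in> plane x y k \<longrightarrow> a = b)" for k
    by (intro definable_plane definable_intros eterm_intros) simp_all
  have disj: "definable 0 (\<lambda>x y e. \<forall>a<length x. \<forall>b<length x. \<not> ((a, b) \<in> plane x y 3 \<and> (a, b) \<in> plane x y 4))"
    by (intro definable_plane definable_intros) simp_all
  show "definable 0 (\<lambda>x y e. is_code x \<and> length y = 5 * (length x * length x) \<and>
     (\<exists>a<length x. a \<in> S 1 x y) \<and> (\<forall>a<length x. a \<in> S 1 x y \<longrightarrow> a \<in> zeros x) \<and>
     lin_order (T x y) (plane x y 0) \<and>
     lin_order (S 1 x y) (plane x y 1) \<and> (\<forall>a\<in>S 1 x y. \<forall>b\<in>S 1 x y. lt1 x a b \<longrightarrow> (a, b) \<in> plane x y 1) \<and>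
     lin_order (S 1 x y) (plane x y 2) \<and> (\<forall>a\<in>S 1 x y. \<forall>b\<in>S 1 x y. lt2 x a b \<longrightarrow> (a, b) \<in> plane x y 2) \<and>
     (\<forall>a<length x. \<forall>b<length x. (a, b) \<in> plane x y 3 \<longrightarrow> a = b) \<and>
     is_greedy_chain (lt1 x) (S 1 x y) (plane x y 1) (S 3 x y) \<and>
     (\<forall>a<length x. \<forall>b<length x. (a, b) \<in> plane x y 4 \<longrightarrow> a = b) \<and>
     is_greedy_chain (lt2 x) (S 1 x y) (plane x y 2) (S 4 x y) \<and>
     (\<forall>a<length x. \<forall>b<length x. \<not> ((a, b) \<in> plane x y 3 \<and> (a, b) \<in> plane x y 4)))"
    by (intro definable_conj definable_is_code definable_length_eq nonempty sub_zeros diag disj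
        definable_lin_order definable_extends definable_is_greedy_chain S T definable_plane
        definable_lt1 definable_lt2 sub plane_subset; assumption)
  fix x y and e :: "nat \<Rightarrow> nat"
  have mem: "a < length x" "b < length x" if "(a, b) \<in> plane x y k" for a b k
    using plane_subset[of x y k] that by auto
  have 1: "(\<exists>a<length x. a \<in> S 1 x y) \<longleftrightarrow> S 1 x y \<noteq> {}"
    "(\<forall>a<length x. a \<in> S 1 x y \<longrightarrow> a \<in> zeros x) \<longleftrightarrow> S 1 x y \<subseteq> zeros x"
    using sub(1)[of 1 x y] by auto
  have 2: "(\<forall>a<length x. \<forall>b<length x. (a, b) \<in> plane x y k \<longrightarrow> a = b) \<longleftrightarrow> plane x y k \<subseteq> Id" for k
    using mem[of _ _ k] by auto
  have 3: "(\<forall>a<length x. \<forall>b<length x. \<not> ((a, b) \<in> plane x y 3 \<and> (a, b) \<in> plane x y 4)) \<longleftrightarrow>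
      plane x y 3 \<inter> plane x y 4 = {}"
    using mem[of _ _ 3] by auto
  show "(is_code x \<and> length y = 5 * (length x * length x) \<and>
     (\<exists>a<length x. a \<in> S 1 x y) \<and> (\<forall>a<length x. a \<in> S 1 x y \<longrightarrow> a \<in> zeros x) \<and>
     lin_order (T x y) (plane x y 0) \<and>
     lin_order (S 1 x y) (plane x y 1) \<and> (\<forall>a\<in>S 1 x y. \<forall>b\<in>S 1 x y. lt1 x a b \<longrightarrow> (a, b) \<in> plane x y 1) \<and>
     lin_order (S 1 x y) (plane x y 2) \<and> (\<forall>a\<in>S 1 x y. \<forall>b\<in>S 1 x y. lt2 x a b \<longrightarrow> (a, b) \<in> plane x y 2) \<and>
     (\<forall>a<length x. \<forall>b<length x. (a, b) \<in> plane x y 3 \<longrightarrow> a = b) \<and>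
     is_greedy_chain (lt1 x) (S 1 x y) (plane x y 1) (S 3 x y) \<and>
     (\<forall>a<length x. \<forall>b<length x. (a, b) \<in> plane x y 4 \<longrightarrow> a = b) \<and>
     is_greedy_chain (lt2 x) (S 1 x y) (plane x y 2) (S 4 x y) \<and>
     (\<forall>a<length x. \<forall>b<length x. \<not> ((a, b) \<in> plane x y 3 \<and> (a, b) \<in> plane x y 4))) = checks x y"
    unfolding checks_def valid_def 1 2 3 T_def S_def[symmetric] by (simp only: simp_thms)
qed

theorem theorem1p13:
  "\<exists>f \<in> sharpP.
     (\<forall>n \<sigma>. \<sigma> permutes {1..n} \<longrightarrow> int (f (encode_perm n \<sigma>)) = eta n \<sigma>) \<and>
     (\<forall>x. (\<nexists>n \<sigma>. \<sigma> permutes {1..n} \<and> x = encode_perm n \<sigma>) \<longrightarrow> f x = 0)"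
proof (intro bexI[of _ "\<lambda>x. card {y. checks x y}"] conjI allI impI)
  fix n :: nat and \<sigma> assume \<sigma>: "\<sigma> permutes {1..n}"
  then have "is_code (encode_perm n \<sigma>)" by (auto simp: is_code_def)
  then show "int (card {y. checks (encode_perm n \<sigma>) y}) = eta n \<sigma>"
    using eta_eq_card_witnesses[OF \<sigma> refl] by (simp add: card_checks)
next
  fix x assume "\<nexists>n \<sigma>. \<sigma> permutes {1..n} \<and> x = encode_perm n \<sigma>"
  then have "\<not> is_code x" by (simp add: is_code_def)
  then show "card {y. checks x y} = 0" by (simp add: checks_def)
next
  have "poly_time_decidable checks"
    using poly_time_decidable_definable[OF definable_checks] by simp
  \<comment> \<open>The polynomial is \<open>5 n^2\<close>, the exact length of an accepted
    witness.\<close>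
  moreover have "length y \<le> poly [:0, 0, 5:] (length x)" if "checks x y" for x y
    using that by (simp add: checks_def)
  ultimately show "(\<lambda>x. card {y. checks x y}) \<in> sharpP"
    unfolding sharpP_def by blast
qed

end
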